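(* There exists a one-parameter family of gordian unlinks with absolute curvature bounded by $1$ and with thickness ranging in $[1,2)$; that is, for every $d\in[1,2)$ there is a gordian unlink of thickness $d$ whose components are $1$-constrained.
   Context: A curve $\gamma:[0,s]\to\mathbb R^3$ is called $\kappa$-constrained ($\kappa>0$) if it is an embedded arc-length parametrised curve that is $C^1$ and piecewise $C^2$ (the second derivative fails to exist at finitely many points at most) with $\|\gamma''(t)\|\le\kappa$ wherever $\gamma''(t)$ is defined. For a loop ($\gamma(0)=\gamma(s)$) the same conditions are understood on the closed curve, i.e. the image is homeomorphic to $S^1$ and is $C^1$ as a closed curve. Knots are images of $\kappa$-constrained loops; here $\kappa=1$. Radius of thickness of a knot $\gamma$: $\tau(\gamma)=\min\{R_1(\gamma),\tfrac12R_2(\gamma)\}$, where $R_1(\gamma)$ is the minimum radius of curvature (the reciprocal of the maximal curvature) and $R_2(\gamma)$ is the minimum of $\|p-q\|$ over all pairs of distinct points $p,q\in\gamma$ such that the chord $pq$ is orthogonal to the tangent vectors of $\gamma$ at $p$ and at $q$. Thin link of thickness $d\in[1,2)$: a finite collection of pairwise disjoint $1$-constrained knots (the components), each with $\tau\ge d/2$, such that the open tubular neighbourhoods of radius $d/2$ of distinct components are disjoint. A thin isotopy is a continuous one-parameter family (in the $C^1$ sense) of thin links of the same thickness $d$ in which the length of each component is constant. Gordian unlink of thickness $d$: a thin link of thickness $d$ with at least two components, each of which is an unknot, which is (ambient) isotopic to the trivial link in the usual topological sense, but which cannot be disentangled by a thin isotopy: it is not the case that for every $R>0$ there is a thin isotopy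 starting at it and ending at a link whose components have pairwise disjoint $R$-neighbourhoods. *)

theory Defs
  imports "HOL-Analysis.Analysis"
begin

text \<open>
  A closed curve of length \<open>s\<close> is represented by an \<open>s\<close>-periodic function on the whole real line,
  so that regularity at the base point is regularity as a closed curve; its image is its range.
\<close>

type_synonym curve = "real \<Rightarrow> real ^ 3"

definition tangent :: "curve \<Rightarrow> curve"
  where "tangent \<gamma> t = vector_derivative \<gamma> (at t)"

definition constrained_loop :: "real \<Rightarrow> real \<Rightarrow> curve \<Rightarrow> bool"
  where "constrained_loop \<kappa> s \<gamma> \<longleftrightarrow>
    s > 0 \<and>
    (\<forall>t. \<gamma> (t + s) = \<gamma> t) \<and>
    inj_on \<gamma> {0..<s} \<and>
    \<gamma> C1_differentiable_on UNIV \<and>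
    (\<forall>t. norm (tangent \<gamma> t) = 1) \<and>
    tangent \<gamma> piecewise_C1_differentiable_on {0..s} \<and>
    (\<forall>t a. (tangent \<gamma> has_vector_derivative a) (at t) \<longrightarrow> norm a \<le> \<kappa>)"

text \<open>
  The radii take values in the extended reals, so that an infimum over the empty set and the
  reciprocal of \<open>0\<close> are both infinite.
\<close>

definition max_curvature :: "curve \<Rightarrow> ereal"
  where "max_curvature \<gamma> =
    Sup {ereal (norm a) | a t. (tangent \<gamma> has_vector_derivative a) (at t)}"

definition R1 :: "curve \<Rightarrow> ereal"
  where "R1 \<gamma> = 1 / max_curvature \<gamma>"

definition R2 :: "curve \<Rightarrow> ereal"
  where "R2 \<gamma> =
    Inf {ereal (norm (\<gamma> a - \<gamma> b)) | a b. \<gamma> a \<noteq> \<gamma> b \<and>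
           orthogonal (\<gamma> a - \<gamma> b) (tangent \<gamma> a) \<and> orthogonal (\<gamma> a - \<gamma> b) (tangent \<gamma> b)}"

definition thickness_radius :: "curve \<Rightarrow> ereal"
  where "thickness_radius \<gamma> = min (R1 \<gamma>) (R2 \<gamma> / 2)"

definition nbhd :: "real \<Rightarrow> (real ^ 3) set \<Rightarrow> (real ^ 3) set"
  where "nbhd r K = (\<Union>p\<in>K. ball p r)"

text \<open>
  A link consists of the number \<open>n\<close> of components, their lengths \<open>s i\<close> and arc-length
  parametrisations \<open>L i\<close>; only the indices \<open>i < n\<close> are relevant.  The open tube
  of radius \<open>d / 2\<close> (the union of the open normal discs) around a compact \<open>C\<^sup>1\<close> loop is its open
  metric neighbourhood, because nearest points are feet of normals.
\<close>

definition thin_link :: "real \<Rightarrow> nat \<Rightarrow> (nat \<Rightarrow> real) \<Rightarrow> (nat \<Rightarrow> curve) \<Rightarrow> bool"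
  where "thin_link d n s L \<longleftrightarrow>
    (\<forall>i<n. constrained_loop 1 (s i) (L i) \<and> thickness_radius (L i) \<ge> ereal (d / 2)) \<and>
    disjoint_family_on (\<lambda>i. range (L i)) {..<n} \<and>
    disjoint_family_on (\<lambda>i. nbhd (d / 2) (range (L i))) {..<n}"

text \<open>
  The lengths \<open>s\<close> do not depend on the parameter \<open>u\<close> of the isotopy.  The \<open>C\<^sup>1\<close> topology is that of
  uniform convergence of curves and their derivatives.
\<close>

definition thin_isotopy ::
    "real \<Rightarrow> nat \<Rightarrow> (nat \<Rightarrow> real) \<Rightarrow> (real \<Rightarrow> nat \<Rightarrow> curve) \<Rightarrow> bool"
  where "thin_isotopy d n s \<Gamma> \<longleftrightarrow>
    (\<forall>u\<in>{0..1}. thin_link d n s (\<Gamma> u)) \<and>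
    (\<forall>i<n. \<forall>u\<in>{0..1}.
       uniform_limit UNIV (\<lambda>v. \<Gamma> v i) (\<Gamma> u i) (at u within {0..1}) \<and>
       uniform_limit UNIV (\<lambda>v. tangent (\<Gamma> v i)) (tangent (\<Gamma> u i)) (at u within {0..1}))"

definition ambient_isotopic :: "(real ^ 3) set \<Rightarrow> (real ^ 3) set \<Rightarrow> bool"
  where "ambient_isotopic A B \<longleftrightarrow>
    (\<exists>H :: real \<Rightarrow> real ^ 3 \<Rightarrow> real ^ 3.
       continuous_on ({0..1} \<times> UNIV) (\<lambda>(t, x). H t x) \<and>
       (\<forall>t\<in>{0..1}. \<exists>G. homeomorphism UNIV UNIV (H t) G) \<and>
       (\<forall>x. H 0 x = x) \<and>
       H 1 ` A = B)"

definition flat_circle :: "real ^ 3 \<Rightarrow> (real ^ 3) set"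
  where "flat_circle c = {x. dist c x = 1 \<and> x $ 3 = c $ 3}"

definition trivial_link :: "nat \<Rightarrow> (real ^ 3) set"
  where "trivial_link n = (\<Union>i<n. flat_circle (vector [3 * real i, 0, 0]))"

definition unknot :: "(real ^ 3) set \<Rightarrow> bool"
  where "unknot K \<longleftrightarrow> ambient_isotopic K (flat_circle 0)"

definition disentangled_by_thin_isotopy ::
    "real \<Rightarrow> nat \<Rightarrow> (nat \<Rightarrow> real) \<Rightarrow> (nat \<Rightarrow> curve) \<Rightarrow> bool"
  where "disentangled_by_thin_isotopy d n s L \<longleftrightarrow>
    (\<forall>R>0. \<exists>\<Gamma>. thin_isotopy d n s \<Gamma> \<and> (\<forall>i<n. \<Gamma> 0 i = L i) \<and>
       disjoint_family_on (\<lambda>i. nbhd R (range (\<Gamma> 1 i))) {..<n})"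

definition gordian_unlink :: "real \<Rightarrow> nat \<Rightarrow> (nat \<Rightarrow> real) \<Rightarrow> (nat \<Rightarrow> curve) \<Rightarrow> bool"
  where "gordian_unlink d n s L \<longleftrightarrow>
    thin_link d n s L \<and>
    n \<ge> 2 \<and>
    (\<forall>i<n. unknot (range (L i))) \<and>
    ambient_isotopic (\<Union>i<n. range (L i)) (trivial_link n) \<and>
    \<not> disentangled_by_thin_isotopy d n s L"

end

theory Submission
  imports Defs "HOL-Real_Asymp.Real_Asymp"
begin

text \<open>
  The link consists of a planar dumbbell \<open>K\<close>, hardly different from the unit circle, and of a stadium
  \<open>A\<close> of cap radius \<open>d\<close> in a perpendicular plane that encircles the two strands of \<open>K\<close> at its waist.
  Topologically the ring \<open>A\<close> slides off \<open>K\<close>.  It cannot do so within the thickness, because it would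
  have to pass a place where it encircles two points of \<open>K\<close> that cut off an arc of length exactly \<open>\<pi>\<close>.
  By the curvature bound such points are at distance at least 2 (lemma \<open>chord_ge_sin\<close>), and a ring that
  keeps distance \<open>d\<close> from two points \<open>p, q\<close> and encircles them has length at least
  \<open>2 |p - q| + 2 \<pi> d\<close>, hence at least \<open>4 + 2 \<pi> d\<close>.  The ring \<open>A\<close> is shorter, since the waist of the
  dumbbell is narrower than 2; this is possible for every \<open>d < 2\<close>, and \<open>d \<ge> 1\<close> makes the caps of the
  ring admissible.

  "Encircles" is made precise by the notion of a clasp: parameters \<open>t, t'\<close> of \<open>K\<close>, cutting it into arcs
  of length at least \<open>\<pi>\<close>, and four points of \<open>A\<close> in cyclic order, such that in the two planes orthogonal
  to the chord \<open>pq\<close> through \<open>p = K t\<close> and \<open>q = K t'\<close> these points span segments that contain \<open>p\<close> and \<open>q\<close>.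
  Being clasped is a closed condition on the time of an isotopy.  It is also open: a clasp is a
  zero of a map from \<open>\<real>\<^sup>6\<close> to itself, and its derivative at a clasp is invertible, so by Brouwer's theorem
  nearby maps have nearby zeros (\<open>zero_persists\<close>); the inequalities in the definition
  are strict at every clasp by the length bound above.  So the link remains clasped, and its
  components remain close to each other (\<open>clasped_not_disentangled\<close>).

  Invertibility comes from rigidity.  The numbers are chosen such that all length inequalities
  are almost equalities at a clasp: \<open>K\<close> is almost a unit circle with diameter \<open>pq\<close>, the two strands of \<open>A\<close>
  between the planes are almost straight and parallel to \<open>pq\<close>, and the caps have radius almost \<open>d\<close>.
  Since the middle of a strand must not come too close to the points of the circle that are
  farthest from the diameter, the plane of the ring makes a definite angle with the plane of \<open>K\<close>,
  and the linearised equations have only the trivial solution (\<open>linearised_clasp\<close>).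

  For the topological part, shears and fibrewise scalings along the coordinate axes push the ring
  off the dumbbell and turn both into round circles (\<open>unlink_perpendicular\<close>).
\<close>

section \<open>Curves of bounded curvature\<close>

lemma cos_ge_quadratic: "cos y \<ge> 1 - y\<^sup>2 / 2" for y :: real
proof -
  have "(sin (y / 2))\<^sup>2 \<le> (y / 2)\<^sup>2"
    using abs_sin_x_le_abs_x[of "y / 2"] by (simp only: abs_le_square_iff)
  then show ?thesis using cos_double_sin[of "y / 2"] by (simp add: power_divide)
qed

lemma arccos_inner_triangle:
  fixes x y z :: "'a::real_inner"
  assumes "norm x = 1" "norm y = 1" "norm z = 1"
  shows "arccos (x \<bullet> z) \<le> arccos (x \<bullet> y) + arccos (y \<bullet> z)"
proof -
  have bnd: "\<bar>u \<bullet> v\<bar> \<le> 1" if "norm u = 1" "norm v = 1" for u v :: 'a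
    using Cauchy_Schwarz_ineq2[of u v] that by simp
  let ?a = "x \<bullet> y" and ?b = "y \<bullet> z"
  have a: "\<bar>?a\<bar> \<le> 1" and b: "\<bar>?b\<bar> \<le> 1" and c: "\<bar>x \<bullet> z\<bar> \<le> 1"
    using bnd assms by blast+
  show ?thesis
  proof (cases "arccos ?a + arccos ?b \<le> pi")
    case False
    then show ?thesis using arccos_ubound[of "x \<bullet> z"] c by linarith
  next
    case True
    have xx: "x \<bullet> x = 1" "y \<bullet> y = 1" "z \<bullet> z = 1"
      using assms by (simp_all add: dot_square_norm)
    have n1: "(norm (x - ?a *\<^sub>R y))\<^sup>2 = 1 - ?a\<^sup>2"
      unfolding power2_norm_eq_inner inner_diff_left inner_diff_right inner_scaleR_left inner_scaleR_right
        inner_commute[of y x] xx by (simp add: power2_eq_square)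
    have n2: "(norm (z - ?b *\<^sub>R y))\<^sup>2 = 1 - ?b\<^sup>2"
      unfolding power2_norm_eq_inner inner_diff_left inner_diff_right inner_scaleR_left inner_scaleR_right
        inner_commute[of z y] xx by (simp add: power2_eq_square)
    have e1: "norm (x - ?a *\<^sub>R y) = sqrt (1 - ?a\<^sup>2)"
      using n1 by (metis norm_ge_zero real_sqrt_unique)
    have e2: "norm (z - ?b *\<^sub>R y) = sqrt (1 - ?b\<^sup>2)"
      using n2 by (metis norm_ge_zero real_sqrt_unique)
    have "(x - ?a *\<^sub>R y) \<bullet> (z - ?b *\<^sub>R y) = x \<bullet> z - ?a * ?b"
      by (simp add: inner_diff inner_commute xx)
    moreover have "\<bar>(x - ?a *\<^sub>R y) \<bullet> (z - ?b *\<^sub>R y)\<bar> \<le> sqrt (1 - ?a\<^sup>2) * sqrt (1 - ?b\<^sup>2)"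
      using Cauchy_Schwarz_ineq2[of "x - ?a *\<^sub>R y" "z - ?b *\<^sub>R y"] e1 e2 by simp
    ultimately have "x \<bullet> z \<ge> ?a * ?b - sqrt (1 - ?a\<^sup>2) * sqrt (1 - ?b\<^sup>2)"
      by linarith
    moreover have "cos (arccos ?a + arccos ?b) = ?a * ?b - sqrt (1 - ?a\<^sup>2) * sqrt (1 - ?b\<^sup>2)"
      using a b by (simp add: cos_add cos_arccos_abs sin_arccos_abs)
    ultimately have "cos (arccos ?a + arccos ?b) \<le> x \<bullet> z" by linarith
    then have "arccos (x \<bullet> z) \<le> arccos (cos (arccos ?a + arccos ?b))"
      using c by (intro arccos_le_arccos) auto
    also have "\<dots> = arccos ?a + arccos ?b"
      using True arccos_lbound[of ?a] arccos_lbound[of ?b] a b by (intro arccos_cos) auto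
    finally show ?thesis .
  qed
qed

lemma tendsto_polygon_length:
  fixes c :: real
  shows "(\<lambda>n. real n * arccos (1 - (c / real n)\<^sup>2 / 2)) \<longlonglongrightarrow> \<bar>c\<bar>"
proof -
  define h where "h = (\<lambda>x::real. if x = 0 then 1 else arcsin x / x)"
  have "((\<lambda>x. arcsin x) has_real_derivative inverse (sqrt (1 - 0\<^sup>2))) (at 0)"
    by (rule DERIV_arcsin) auto
  then have "((\<lambda>x. arcsin x / x) \<longlongrightarrow> 1) (at 0)"
    by (simp add: has_field_derivative_iff)
  then have "(h \<longlongrightarrow> 1) (at 0)"
    by (rule Lim_transform_eventually) (auto simp: h_def eventually_at_filter)
  then have ch: "isCont h 0" by (simp add: isCont_def h_def)
  have "(\<lambda>n. \<bar>c\<bar> / (2 * real n)) \<longlonglongrightarrow> 0"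
    by real_asymp
  then have "(\<lambda>n. h (\<bar>c\<bar> / (2 * real n))) \<longlonglongrightarrow> h 0"
    by (rule isCont_tendsto_compose[OF ch])
  then have "(\<lambda>n. \<bar>c\<bar> * h (\<bar>c\<bar> / (2 * real n))) \<longlonglongrightarrow> \<bar>c\<bar>"
    using tendsto_mult_left[of _ "h 0" sequentially "\<bar>c\<bar>"] by (simp add: h_def)
  moreover have "eventually (\<lambda>n. \<bar>c\<bar> * h (\<bar>c\<bar> / (2 * real n)) =
       real n * arccos (1 - (c / real n)\<^sup>2 / 2)) sequentially"
  proof -
    obtain N :: nat where N: "\<bar>c\<bar> < real N" using reals_Archimedean2 by blast
    have "\<bar>c\<bar> * h (\<bar>c\<bar> / (2 * real n)) = real n * arccos (1 - (c / real n)\<^sup>2 / 2)"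
      if "n \<ge> max 1 N" for n
    proof (cases "c = 0")
      case False
      define x where "x = \<bar>c\<bar> / (2 * real n)"
      have n: "real n > 0" "\<bar>c\<bar> < real n" using that N by (auto simp: max_def split: if_splits)
      have x: "0 < x" "x < 1" using False n by (auto simp: x_def field_simps)
      have as: "0 \<le> arcsin x" "arcsin x \<le> pi / 2"
        using arcsin_bounded[of x] arcsin_le_arcsin[of 0 x] x by auto
      have "1 - (c / real n)\<^sup>2 / 2 = 1 - 2 * x\<^sup>2"
        by (simp add: x_def field_simps)
      also have "\<dots> = cos (2 * arcsin x)"
        using x by (simp add: cos_double_sin)
      finally have "arccos (1 - (c / real n)\<^sup>2 / 2) = 2 * arcsin x"
        using as by (simp add: arccos_cos)
      then show ?thesis using x False n by (simp add: h_def x_def[symmetric]) (simp add: x_def field_simps)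
    qed (simp add: h_def)
    then show ?thesis unfolding eventually_sequentially by blast
  qed
  ultimately show ?thesis by (rule Lim_transform_eventually)
qed

text \<open>
  The spherical distance is at most the length of a curve: subdivide, bound the distance of neighbours
  by the angle that belongs to their chord, and refine.
\<close>

lemma arccos_inner_lipschitz:
  fixes \<omega> :: "real \<Rightarrow> 'a::real_inner"
  assumes "a \<le> b" "k \<ge> 0"
    and unit: "\<And>x. x \<in> {a..b} \<Longrightarrow> norm (\<omega> x) = 1"
    and lip: "\<And>x y. x \<in> {a..b} \<Longrightarrow> y \<in> {a..b} \<Longrightarrow> norm (\<omega> x - \<omega> y) \<le> k * \<bar>x - y\<bar>"
  shows "arccos (\<omega> a \<bullet> \<omega> b) \<le> k * (b - a)"
proof -
  define c where "c = k * (b - a)"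
  have c0: "c \<ge> 0" using assms by (simp add: c_def)
  have "arccos (\<omega> a \<bullet> \<omega> b) \<le> real n * arccos (1 - (c / real n)\<^sup>2 / 2)"
    if n: "n \<ge> 1" "c < real n" for n
  proof -
    define \<delta> where "\<delta> = (b - a) / real n"
    have d0: "\<delta> \<ge> 0" using assms by (simp add: \<delta>_def)
    have kd: "k * \<delta> = c / real n" by (simp add: \<delta>_def c_def)
    have inside: "a + real i * \<delta> \<in> {a..b}" if "i \<le> n" for i
    proof -
      have "real i * \<delta> \<le> real n * \<delta>" using that d0 by (intro mult_right_mono) auto
      also have "\<dots> = b - a" using n by (simp add: \<delta>_def)
      finally show ?thesis using d0 by auto
    qed
    have "arccos (\<omega> a \<bullet> \<omega> (a + real i * \<delta>)) \<le> real i * arccos (1 - (c / real n)\<^sup>2 / 2)"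
      if "i \<le> n" for i
      using that
    proof (induction i)
      case 0
      have "\<omega> a \<bullet> \<omega> a = 1" using unit[of a] assms by (simp add: dot_square_norm)
      then show ?case by simp
    next
      case (Suc i)
      let ?x = "a + real i * \<delta>" and ?y = "a + real (Suc i) * \<delta>"
      have in1: "?x \<in> {a..b}" and in2: "?y \<in> {a..b}"
        using inside[of i] inside[of "Suc i"] Suc.prems by (blast intro: Suc_leD)+
      have u: "norm (\<omega> ?x) = 1" "norm (\<omega> ?y) = 1" "norm (\<omega> a) = 1"
        using unit in1 in2 assms by auto
      have "norm (\<omega> ?x - \<omega> ?y) \<le> k * \<bar>?x - ?y\<bar>" by (rule lip[OF in1 in2])
      also have "\<bar>?x - ?y\<bar> = \<delta>" using d0 by (simp add: algebra_simps)
      finally have "(norm (\<omega> ?x - \<omega> ?y))\<^sup>2 \<le> (c / real n)\<^sup>2"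
        unfolding kd by (intro power_mono) auto
      moreover have "(norm (\<omega> ?x - \<omega> ?y))\<^sup>2 = 2 - 2 * (\<omega> ?x \<bullet> \<omega> ?y)"
        using u by (simp add: power2_norm_eq_inner inner_diff inner_commute norm_eq_1)
      ultimately have ge: "\<omega> ?x \<bullet> \<omega> ?y \<ge> 1 - (c / real n)\<^sup>2 / 2" by linarith
      have "(c / real n)\<^sup>2 \<le> 1\<^sup>2" using n c0 by (intro power_mono) auto
      then have "arccos (\<omega> ?x \<bullet> \<omega> ?y) \<le> arccos (1 - (c / real n)\<^sup>2 / 2)"
        using ge Cauchy_Schwarz_ineq2[of "\<omega> ?x" "\<omega> ?y"] u by (intro arccos_le_arccos) auto
      moreover have "arccos (\<omega> a \<bullet> \<omega> ?y) \<le> arccos (\<omega> a \<bullet> \<omega> ?x) + arccos (\<omega> ?x \<bullet> \<omega> ?y)"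
        by (rule arccos_inner_triangle) (use u in auto)
      ultimately show ?case using Suc by (simp add: algebra_simps)
    qed
    from this[of n] show ?thesis using n by (simp add: \<delta>_def)
  qed
  moreover obtain N :: nat where N: "c < real N" using reals_Archimedean2 by blast
  ultimately have "\<forall>n\<ge>max 1 N. arccos (\<omega> a \<bullet> \<omega> b) \<le> real n * arccos (1 - (c / real n)\<^sup>2 / 2)"
    by (auto simp: max_def split: if_splits)
  then have "arccos (\<omega> a \<bullet> \<omega> b) \<le> \<bar>c\<bar>"
    by (intro LIMSEQ_le_const[OF tendsto_polygon_length]) blast
  then show ?thesis using c0 by (simp add: c_def)
qed

lemma inner_ge_cos_lipschitz:
  fixes \<omega> :: "real \<Rightarrow> 'a::real_inner"
  assumes "a \<le> b" "k \<ge> 0" "k * (b - a) \<le> pi"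
    and unit: "\<And>x. x \<in> {a..b} \<Longrightarrow> norm (\<omega> x) = 1"
    and lip: "\<And>x y. x \<in> {a..b} \<Longrightarrow> y \<in> {a..b} \<Longrightarrow> norm (\<omega> x - \<omega> y) \<le> k * \<bar>x - y\<bar>"
  shows "\<omega> a \<bullet> \<omega> b \<ge> cos (k * (b - a))"
proof -
  have "\<bar>\<omega> a \<bullet> \<omega> b\<bar> \<le> 1"
    using Cauchy_Schwarz_ineq2[of "\<omega> a" "\<omega> b"] unit assms(1) by simp
  moreover have "arccos (\<omega> a \<bullet> \<omega> b) \<le> k * (b - a)"
    using assms by (intro arccos_inner_lipschitz) auto
  ultimately show ?thesis
    using cos_monotone_0_pi_le[of "arccos (\<omega> a \<bullet> \<omega> b)" "k * (b - a)"] assms(3)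
      arccos_lbound[of "\<omega> a \<bullet> \<omega> b"] by (simp add: cos_arccos_abs)
qed

text \<open>
  Outside the ball of radius \<open>r\<close>, the radial projection to the unit sphere is Lipschitz with constant
  \<open>1 / r\<close>; it turns lengths of curves around a ball into lengths of spherical curves.
\<close>

lemma norm_normalize_diff_le:
  fixes x y :: "'a::real_inner"
  assumes "norm x \<ge> r" "norm y \<ge> r" "r > 0"
  shows "norm (x /\<^sub>R norm x - y /\<^sub>R norm y) \<le> norm (x - y) / r"
proof -
  let ?x = "x /\<^sub>R norm x" and ?y = "y /\<^sub>R norm y"
  have pos: "norm x > 0" "norm y > 0" using assms by linarith+
  have e: "(norm (?x - ?y))\<^sup>2 = 2 - 2 * (x \<bullet> y) / (norm x * norm y)"
    using pos unfolding power2_norm_eq_inner inner_diff inner_scaleR_left inner_scaleR_right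
    by (simp add: dot_square_norm inner_commute field_simps power2_eq_square)
  have "r\<^sup>2 * (norm (?x - ?y))\<^sup>2 \<le> (norm x * norm y) * (norm (?x - ?y))\<^sup>2"
    using assms pos unfolding power2_eq_square[of r] by (intro mult_right_mono mult_mono) auto
  also have "\<dots> = 2 * norm x * norm y - 2 * (x \<bullet> y)"
    unfolding e using pos by (simp add: field_simps)
  also have "\<dots> \<le> (norm x)\<^sup>2 + (norm y)\<^sup>2 - 2 * (x \<bullet> y)"
    using sum_squares_bound[of "norm x" "norm y"] by simp
  also have "\<dots> = (norm (x - y))\<^sup>2"
    by (simp add: power2_norm_eq_inner inner_diff inner_commute)
  finally have "(r * norm (?x - ?y))\<^sup>2 \<le> (norm (x - y))\<^sup>2" by (simp add: power_mult_distrib)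
  then have "r * norm (?x - ?y) \<le> norm (x - y)" by (rule power2_le_imp_le) simp
  then show ?thesis using assms by (simp add: field_simps)
qed

lemma constrained_loopD:
  assumes "constrained_loop 1 s \<gamma>"
  shows "s > 0" "\<gamma> (t + s) = \<gamma> t" "(\<gamma> has_vector_derivative tangent \<gamma> t) (at t)"
    "norm (tangent \<gamma> t) = 1"
  using assms unfolding constrained_loop_def tangent_def C1_differentiable_on_eq
  by (auto simp: vector_derivative_works)

lemma periodic_int:
  fixes f :: "real \<Rightarrow> 'a"
  assumes "\<And>t. f (t + s) = f t"
  shows "f (t + of_int k * s) = f t"
proof -
  have nat: "f (t + real n * s) = f t" for n t
  proof (induction n)
    case (Suc n)
    have "f (t + real (Suc n) * s) = f ((t + real n * s) + s)" by (simp add: algebra_simps)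
    then show ?case using assms Suc by simp
  qed simp
  show ?thesis
  proof (cases "k \<ge> 0")
    case True
    then show ?thesis using nat[of t "nat k"] by simp
  next
    case False
    then show ?thesis using nat[of "t + of_int k * s" "nat (- k)"] by simp
  qed
qed

lemma tangent_periodic:
  assumes "constrained_loop 1 s \<gamma>"
  shows "tangent \<gamma> (t + s) = tangent \<gamma> t"
proof -
  have "((\<gamma> \<circ> (\<lambda>x. x + s)) has_vector_derivative (1 *\<^sub>R tangent \<gamma> (t + s))) (at t)"
    by (intro vector_diff_chain_at) (auto intro!: derivative_eq_intros constrained_loopD[OF assms])
  moreover have "\<gamma> \<circ> (\<lambda>x. x + s) = \<gamma>" using constrained_loopD(2)[OF assms] by auto
  ultimately show ?thesis
    using vector_derivative_unique_at[OF _ constrained_loopD(3)[OF assms]] by simp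
qed

lemma continuous_on_tangent:
  assumes "constrained_loop 1 s \<gamma>"
  shows "continuous_on S (tangent \<gamma>)"
proof -
  have "continuous_on UNIV (\<lambda>x. vector_derivative \<gamma> (at x))"
    using assms by (simp add: constrained_loop_def C1_differentiable_on_eq)
  then show ?thesis unfolding tangent_def[abs_def] by (rule continuous_on_subset) simp
qed

lemma constrained_loop_continuous:
  assumes "constrained_loop 1 s \<gamma>"
  shows "continuous_on S \<gamma>"
  using constrained_loopD(3)[OF assms] has_vector_derivative_continuous
  by (metis continuous_at_imp_continuous_on)

lemma lipschitz_finite_exceptions:
  fixes f :: "real \<Rightarrow> 'a::real_normed_vector"
  assumes "finite F" "a \<le> b" "continuous_on {a..b} f"
    and der: "\<And>x. a < x \<Longrightarrow> x < b \<Longrightarrow> x \<notin> F \<Longrightarrow> \<exists>D. (f has_vector_derivative D) (at x) \<and> norm D \<le> k"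
  shows "norm (f b - f a) \<le> k * (b - a)"
  using assms
proof (induction "F" arbitrary: a b rule: finite_induct)
  case empty
  show ?case
  proof (cases "a = b")
    case False
    then have ab: "a < b" using empty by simp
    have "\<forall>x\<in>{a<..<b}. \<exists>D. (f has_vector_derivative D) (at x) \<and> norm D \<le> k" using empty by auto
    then obtain D where D: "\<And>x. x \<in> {a<..<b} \<Longrightarrow> (f has_vector_derivative D x) (at x) \<and> norm (D x) \<le> k"
      by metis
    have "norm (f b - f a) \<le> k * b - k * a"
      by (rule differentiable_bound_general[OF ab, where f' = D and \<phi>' = "\<lambda>_. k"])
         (use D empty in \<open>auto intro!: continuous_intros derivative_eq_intros\<close>)
    then show ?thesis by (simp add: algebra_simps)
  qed simp
next
  case (insert c F)
  show ?case
  proof (cases "c \<in> {a<..<b}")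
    case True
    have "norm (f c - f a) \<le> k * (c - a)"
      using True insert.prems by (intro insert.IH) (auto elim: continuous_on_subset)
    moreover have "norm (f b - f c) \<le> k * (b - c)"
      using True insert.prems by (intro insert.IH) (auto elim: continuous_on_subset)
    moreover have "f b - f a = (f c - f a) + (f b - f c)" by simp
    ultimately have "norm (f b - f a) \<le> k * (c - a) + k * (b - c)"
      by (metis add_mono norm_triangle_mono)
    then show ?thesis by (simp add: algebra_simps)
  next
    case False
    then show ?thesis using insert.prems by (intro insert.IH) auto
  qed
qed

text \<open>
  The finitely many points without second derivative do no harm to the Lipschitz bound of the
  tangent, because the tangent is continuous there.  The bound is extended from one
  period to the line cell by cell.
\<close>

lemma tangent_lipschitz:
  assumes "constrained_loop 1 s \<gamma>"
  shows "norm (tangent \<gamma> a - tangent \<gamma> b) \<le> \<bar>a - b\<bar>"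
proof -
  have s: "s > 0" and per: "\<And>t. tangent \<gamma> (t + s) = tangent \<gamma> t"
    using constrained_loopD(1)[OF assms] tangent_periodic[OF assms] by auto
  obtain S where S: "finite S" "tangent \<gamma> C1_differentiable_on ({0..s} - S)"
    and bd: "\<And>t D. (tangent \<gamma> has_vector_derivative D) (at t) \<Longrightarrow> norm D \<le> 1"
    using assms unfolding constrained_loop_def piecewise_C1_differentiable_on_def by auto
  have base: "norm (tangent \<gamma> y - tangent \<gamma> x) \<le> y - x" if "0 \<le> x" "x \<le> y" "y \<le> s" for x y
  proof -
    have "norm (tangent \<gamma> y - tangent \<gamma> x) \<le> 1 * (y - x)"
    proof (rule lipschitz_finite_exceptions[OF S(1) that(2) continuous_on_tangent[OF assms]])
      fix z assume "x < z" "z < y" "z \<notin> S"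
      then have "z \<in> {0..s} - S" using that by auto
      then show "\<exists>D. (tangent \<gamma> has_vector_derivative D) (at z) \<and> norm D \<le> 1"
        using S(2) bd unfolding C1_differentiable_on_def by blast
    qed
    then show ?thesis by simp
  qed
  have cell: "norm (tangent \<gamma> y - tangent \<gamma> x) \<le> y - x"
    if "x \<le> y" "of_int k * s \<le> x" "y \<le> (of_int k + 1) * s" for x y and k :: int
  proof -
    have e: "tangent \<gamma> (z - of_int k * s) = tangent \<gamma> z" for z
      using periodic_int[of "tangent \<gamma>" s "z - of_int k * s" k, OF per] by simp
    have "norm (tangent \<gamma> (y - of_int k * s) - tangent \<gamma> (x - of_int k * s))
        \<le> (y - of_int k * s) - (x - of_int k * s)"
      by (rule base) (use that in \<open>auto simp: algebra_simps\<close>)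
    then show ?thesis by (simp only: e)
  qed
  have main: "norm (tangent \<gamma> y - tangent \<gamma> x) \<le> y - x"
    if "x \<le> y" "of_int k * s \<le> x" "y \<le> (of_int k + 1 + real n) * s" for x y n and k :: int
    using that
  proof (induction n arbitrary: y)
    case 0
    then show ?case using cell by simp
  next
    case (Suc n)
    let ?z = "(of_int k + 1 + real n) * s"
    have step: "norm (tangent \<gamma> y - tangent \<gamma> w) \<le> y - w" if "w \<le> y" "?z \<le> w" for w
      by (rule cell[of w y "k + 1 + int n"]) (use that Suc.prems(3) in \<open>simp_all add: algebra_simps\<close>)
    consider "y \<le> ?z" | "x \<le> ?z" "?z \<le> y" | "?z \<le> x" by linarith
    then show ?case
    proof cases
      case 1 then show ?thesis using Suc by blast
    next
      case 2
      have "norm (tangent \<gamma> ?z - tangent \<gamma> x) \<le> ?z - x" using 2(1) Suc.prems(2) by (intro Suc.IH) auto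
      moreover have "norm (tangent \<gamma> y - tangent \<gamma> ?z) \<le> y - ?z"
        by (rule step) (use 2 in auto)
      moreover have "norm (tangent \<gamma> y - tangent \<gamma> x)
          \<le> norm (tangent \<gamma> y - tangent \<gamma> ?z) + norm (tangent \<gamma> ?z - tangent \<gamma> x)"
        by (rule norm_diff_triangle_le[OF order_refl order_refl])
      ultimately show ?thesis by linarith
    next
      case 3
      show ?thesis by (rule step) (use 3 Suc.prems in auto)
    qed
  qed
  have ordered: "norm (tangent \<gamma> y - tangent \<gamma> x) \<le> y - x" if "x \<le> y" for x y
  proof -
    define k where "k = \<lfloor>x / s\<rfloor>"
    have k: "of_int k * s \<le> x" using s by (simp add: k_def floor_divide_lower)
    obtain n :: nat where "y / s - of_int k - 1 \<le> real n" using real_arch_simple by blast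
    then have "y \<le> (of_int k + 1 + real n) * s" using s by (simp add: field_simps)
    then show ?thesis using main that k by blast
  qed
  show ?thesis
    using ordered[of a b] ordered[of b a] by (cases "a \<le> b") (auto simp: norm_minus_commute)
qed

text \<open>
  The tangent moves on the unit sphere with speed at most 1, so it turns at most as fast as the
  tangent of the unit circle.  All comparisons of \<open>K\<close> with the unit circle rest on this.
\<close>

lemma tangent_inner_ge_cos:
  assumes "constrained_loop 1 s \<gamma>" "\<bar>a - b\<bar> \<le> pi"
  shows "tangent \<gamma> a \<bullet> tangent \<gamma> b \<ge> cos (a - b)"
proof -
  have "tangent \<gamma> x \<bullet> tangent \<gamma> y \<ge> cos (1 * (y - x))" if "x \<le> y" "y - x \<le> pi" for x y
    by (rule inner_ge_cos_lipschitz)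
       (use that constrained_loopD(4)[OF assms(1)] tangent_lipschitz[OF assms(1)] in auto)
  from this[of a b] this[of b a] show ?thesis
    using assms(2) cos_minus[of "a - b"] by (cases "a \<le> b") (auto simp: inner_commute)
qed

lemma curve_inner_increment:
  fixes \<gamma> :: "real \<Rightarrow> 'a::real_inner" and g :: "real \<Rightarrow> real"
  assumes "a \<le> b"
    and "\<And>x. (\<gamma> has_vector_derivative T x) (at x)"
    and "\<And>x. x \<in> {a..b} \<Longrightarrow> (g has_real_derivative g' x) (at x)"
    and "\<And>x. x \<in> {a..b} \<Longrightarrow> T x \<bullet> w \<ge> g' x"
  shows "(\<gamma> b - \<gamma> a) \<bullet> w \<ge> g b - g a"
proof -
  have "((\<lambda>x. \<gamma> x \<bullet> w - g x) has_real_derivative (T x \<bullet> w - g' x)) (at x)" if "x \<in> {a..b}" for x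
    unfolding has_real_derivative_iff_has_vector_derivative
    using assms(2)[of x] assms(3)[OF that]
    by (auto intro!: derivative_eq_intros bounded_linear.has_vector_derivative[OF bounded_linear_inner_left]
        simp: has_real_derivative_iff_has_vector_derivative)
  then have "\<gamma> a \<bullet> w - g a \<le> \<gamma> b \<bullet> w - g b"
    using assms by (intro DERIV_nonneg_imp_nondecreasing[OF assms(1)]) (metis atLeastAtMost_iff diff_ge_0_iff_ge)
  then show ?thesis by (simp add: inner_diff_left)
qed

lemma constrained_loop_lipschitz:
  assumes "constrained_loop 1 s \<gamma>"
  shows "norm (\<gamma> a - \<gamma> b) \<le> \<bar>a - b\<bar>"
proof -
  have "norm (\<gamma> y - \<gamma> x) \<le> 1 * (y - x)" if "x \<le> y" for x y
    by (rule lipschitz_finite_exceptions[of "{}"])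
       (use that constrained_loopD(3,4)[OF assms] constrained_loop_continuous[OF assms]
         in \<open>auto intro!: exI\<close>)
  from this[of a b] this[of b a] show ?thesis
    by (cases "a \<le> b") (auto simp: norm_minus_commute)
qed

text \<open>
  A chord is at least as long as the chord of a unit circle arc of the same length (a case of Schur's
  comparison theorem): integrate the component of the tangent along the tangent at the midpoint.
\<close>

lemma chord_ge_sin:
  assumes K: "constrained_loop 1 s K" and "t \<le> t'" "t' - t \<le> 2 * pi"
  shows "norm (K t' - K t) \<ge> 2 * sin ((t' - t) / 2)"
proof -
  let ?m = "(t + t') / 2"
  have "(K t' - K t) \<bullet> tangent K ?m \<ge> sin (t' - ?m) - sin (t - ?m)"
  proof (rule curve_inner_increment[where T = "tangent K"])
    show "((\<lambda>x. sin (x - ?m)) has_real_derivative cos (x - ?m)) (at x)" for x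
      by (auto intro!: derivative_eq_intros)
    show "tangent K x \<bullet> tangent K ?m \<ge> cos (x - ?m)" if "x \<in> {t..t'}" for x
    proof (rule tangent_inner_ge_cos[OF K])
      have "\<bar>x - ?m\<bar> \<le> (t' - t) / 2" using that by (auto simp: abs_if field_simps)
      also have "(t' - t) / 2 \<le> pi" using assms by simp
      finally show "\<bar>x - ?m\<bar> \<le> pi" .
    qed
  qed (use assms constrained_loopD(3)[OF K] in auto)
  moreover have "t' - ?m = (t' - t) / 2" "t - ?m = - ((t' - t) / 2)" by (simp_all add: field_simps)
  moreover have "(K t' - K t) \<bullet> tangent K ?m \<le> norm (K t' - K t)"
    using norm_cauchy_schwarz[of "K t' - K t" "tangent K ?m"] constrained_loopD(4)[OF K] by simp
  ultimately show ?thesis by simp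
qed

lemma chord_ge_near_diameter:
  assumes K: "constrained_loop 1 s K" and t: "t + pi \<le> t'" "t' \<le> t + pi + \<delta>" and \<delta>: "\<delta> \<le> 1"
  shows "norm (K t' - K t) \<ge> 2 - \<delta>\<^sup>2 / 4"
proof -
  define y where "y = (t' - t - pi) / 2"
  have y: "0 \<le> y" "y \<le> \<delta> / 2" using t by (auto simp: y_def)
  have "(t' - t) / 2 = y + pi / 2" by (simp add: y_def field_simps)
  then have "sin ((t' - t) / 2) = cos y" by (simp only: sin_add) simp
  moreover have "cos y \<ge> 1 - y\<^sup>2 / 2" by (rule cos_ge_quadratic)
  moreover have "y\<^sup>2 \<le> (\<delta> / 2)\<^sup>2" using y by (intro power_mono)
  moreover have "norm (K t' - K t) \<ge> 2 * sin ((t' - t) / 2)"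
    using t \<delta> pi_ge_two by (intro chord_ge_sin[OF K]) linarith+
  ultimately show ?thesis by (simp add: power_divide)
qed

section \<open>Clasps\<close>

text \<open>
  This turns the polynomial clasp equations, which are convenient for limits and derivatives, into the
  geometric statement that the origin lies on the segment from \<open>x\<close> to \<open>y\<close>.
\<close>

lemma antipodal_if_coplanar:
  fixes v x y :: "real^3"
  assumes "v \<noteq> 0" "x \<bullet> v = 0" "y \<bullet> v = 0" "v \<bullet> cross3 x y = 0" "x \<bullet> y \<le> 0"
  shows "x \<bullet> y = - (norm x * norm y)"
proof -
  have "cross3 v (cross3 x y) = 0"
    using assms(2,3) Lagrange[of v x y] by (simp add: inner_commute)
  then have "(norm v * norm (cross3 x y))\<^sup>2 = 0"
    using norm_cross_dot[of v "cross3 x y"] assms(4) by simp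
  then have "cross3 x y = 0" using assms(1) by simp
  then have "(norm x * norm y)\<^sup>2 = (x \<bullet> y)\<^sup>2" using norm_cross_dot[of x y] by simp
  then have "norm x * norm y = \<bar>x \<bullet> y\<bar>"
    by (metis abs_mult abs_norm_cancel power2_eq_iff_nonneg abs_ge_zero power2_abs)
  then show ?thesis using assms(5) by simp
qed

lemma norm_diff_sq:
  fixes x y :: "'a::real_inner"
  shows "(norm (x - y))\<^sup>2 = (norm x)\<^sup>2 + (norm y)\<^sup>2 - 2 * (x \<bullet> y)"
  by (simp add: power2_norm_eq_inner inner_diff_left inner_diff_right inner_commute)

lemma norm_diff_antipodal:
  fixes x y :: "'a::real_inner"
  assumes "x \<bullet> y = - (norm x * norm y)"
  shows "norm (x - y) = norm x + norm y"
proof -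
  have "(norm (x - y))\<^sup>2 = (norm x + norm y)\<^sup>2"
    using assms by (simp add: norm_diff_sq power2_sum)
  then show ?thesis by (simp add: power2_eq_iff_nonneg)
qed

text \<open>
  Seen from \<open>q\<close>, the curve sweeps the angle \<open>\<pi>\<close> at distance at least \<open>d\<close>.  The second summand controls
  the distance of the first end from \<open>q\<close>: a curve that starts farther out than \<open>d\<close> needs a while to
  come down, and until then it sweeps angle more slowly.
\<close>

lemma cap_length:
  fixes A :: "real \<Rightarrow> 'a::real_inner"
  assumes A: "\<And>x y. norm (A x - A y) \<le> \<bar>x - y\<bar>" and d: "d > 0"
    and far: "\<And>x. norm (A x - q) \<ge> d"
    and ab: "a \<le> b" and opp: "(A a - q) \<bullet> (A b - q) = - (norm (A a - q) * norm (A b - q))"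
  shows "b - a \<ge> pi * d + (norm (A a - q) - d)\<^sup>2 / (2 * (norm (A a - q) + d))"
proof -
  define r where "r = norm (A a - q)"
  define x1 where "x1 = (r - d) / 2"
  define \<omega> where "\<omega> = (\<lambda>x. (A x - q) /\<^sub>R norm (A x - q))"
  have rd: "r \<ge> d" using far by (simp add: r_def)
  have nz: "norm (A x - q) > 0" for x using far[of x] d by linarith
  have unit: "norm (\<omega> x) = 1" for x using nz[of x] by (simp add: \<omega>_def)
  have lip: "norm (\<omega> x - \<omega> y) \<le> (1 / \<rho>) * \<bar>x - y\<bar>"
    if "norm (A x - q) \<ge> \<rho>" "norm (A y - q) \<ge> \<rho>" "\<rho> > 0" for x y \<rho>
  proof -
    have "norm (\<omega> x - \<omega> y) \<le> norm ((A x - q) - (A y - q)) / \<rho>"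
      unfolding \<omega>_def by (rule norm_normalize_diff_le) (use that in auto)
    also have "\<dots> \<le> \<bar>x - y\<bar> / \<rho>"
      using A[of x y] that by (simp add: divide_right_mono)
    finally show ?thesis by simp
  qed
  have "norm (A a - A b) = r + norm (A b - q)"
    using norm_diff_antipodal[OF opp] by (simp add: r_def)
  then have "r + d \<le> b - a"
    using A[of a b] ab far[of b] by simp
  then have x1: "0 \<le> x1" "a + x1 \<le> b" using rd d by (auto simp: x1_def field_simps)
  have near: "norm (A x - q) \<ge> (r + d) / 2" if "x \<in> {a..a + x1}" for x
  proof -
    have "norm (A a - A x) \<le> x1" using A[of a x] that by auto
    moreover have "r \<le> norm (A a - A x) + norm (A x - q)"
      unfolding r_def using norm_triangle_ineq[of "A a - A x" "A x - q"] by simp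
    ultimately show ?thesis by (simp add: x1_def field_simps)
  qed
  have pi_le: "pi \<le> 2 * x1 / (r + d) + (b - a - x1) / d"
  proof -
    have "arccos (\<omega> a \<bullet> \<omega> (a + x1)) \<le> (1 / ((r + d) / 2)) * ((a + x1) - a)"
    proof (rule arccos_inner_lipschitz)
      show "norm (\<omega> x - \<omega> y) \<le> (1 / ((r + d) / 2)) * \<bar>x - y\<bar>"
        if "x \<in> {a..a + x1}" "y \<in> {a..a + x1}" for x y
        by (rule lip) (use near[OF that(1)] near[OF that(2)] rd d in auto)
    qed (use x1 unit rd d in auto)
    moreover have "arccos (\<omega> (a + x1) \<bullet> \<omega> b) \<le> (1 / d) * (b - (a + x1))"
    proof (rule arccos_inner_lipschitz)
      show "norm (\<omega> x - \<omega> y) \<le> (1 / d) * \<bar>x - y\<bar>" for x y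
        by (rule lip) (use far d in auto)
    qed (use x1 unit d in auto)
    moreover have "\<omega> a \<bullet> \<omega> b = -1"
      using opp nz[of a] nz[of b] unfolding \<omega>_def inner_scaleR_left inner_scaleR_right
      by (simp add: inverse_eq_divide)
    then have "pi \<le> arccos (\<omega> a \<bullet> \<omega> (a + x1)) + arccos (\<omega> (a + x1) \<bullet> \<omega> b)"
      using arccos_inner_triangle[of "\<omega> a" "\<omega> (a + x1)" "\<omega> b"] unit by simp
    moreover have "2 * x1 / (r + d) = (1 / ((r + d) / 2)) * ((a + x1) - a)" "(b - a - x1) / d = (1 / d) * (b - (a + x1))"
      by (simp_all add: diff_diff_eq)
    ultimately show ?thesis by linarith
  qed
  then have "pi * d \<le> (2 * x1 / (r + d) + (b - a - x1) / d) * d"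
    using d by (intro mult_right_mono) auto
  also have "\<dots> = 2 * x1 * d / (r + d) + (b - a - x1)" using d by (simp add: distrib_right)
  also have "2 * x1 * d / (r + d) = x1 - (r - d)\<^sup>2 / (2 * (r + d))"
    using rd d unfolding x1_def by (simp add: divide_simps) (simp add: power2_eq_square algebra_simps)
  finally show ?thesis by (simp add: r_def)
qed

text \<open>
  The defect \<open>1 - T \<bullet> e\<close> is nonnegative with integral at most \<open>E\<close>, and it is 1-Lipschitz by the curvature
  bound; a large value at one point would therefore contribute a triangle of too large an area.
\<close>

lemma nearly_straight:
  assumes \<gamma>: "constrained_loop 1 s \<gamma>" and e: "norm e = 1" and ab: "a + 1 \<le> b"
    and ext: "(\<gamma> b - \<gamma> a) \<bullet> e \<ge> b - a - E" and E: "E < 1/8" "0 \<le> E"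
    and x: "x \<in> {a..b}"
  shows "tangent \<gamma> x \<bullet> e \<ge> 1 - sqrt (2 * E)"
proof (rule ccontr)
  assume neg: "\<not> tangent \<gamma> x \<bullet> e \<ge> 1 - sqrt (2 * E)"
  define f where "f = 1 - tangent \<gamma> x \<bullet> e"
  define y where "y = min f (1/2)"
  have f: "f > sqrt (2 * E)" "f > 0" using neg real_sqrt_ge_zero[of "2 * E"] E unfolding f_def by linarith+
  have y: "0 < y" "y \<le> 1/2" "y \<le> f" using f by (auto simp: y_def)
  have Tle: "tangent \<gamma> z \<bullet> e \<le> 1 - f + \<bar>x - z\<bar>" for z
  proof -
    have "(tangent \<gamma> z - tangent \<gamma> x) \<bullet> e \<le> norm (tangent \<gamma> z - tangent \<gamma> x) * norm e"
      by (rule norm_cauchy_schwarz)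
    then show ?thesis using tangent_lipschitz[OF \<gamma>, of z x] e by (simp add: f_def inner_diff_left)
  qed
  have adv: "(\<gamma> q - \<gamma> p) \<bullet> e \<le> q - p" if "p \<le> q" for p q
    using norm_cauchy_schwarz[of "\<gamma> q - \<gamma> p" e] constrained_loop_lipschitz[OF \<gamma>, of q p] that e by simp
  have "f * y - y\<^sup>2 / 2 \<le> E"
  proof (cases "x - a \<ge> 1/2")
    case True
    have "(\<gamma> x - \<gamma> (x - y)) \<bullet> (- e) \<ge> - ((1 - f + x) * x - x\<^sup>2/2) - - ((1 - f + x) * (x - y) - (x - y)\<^sup>2/2)"
    proof (rule curve_inner_increment[where T = "tangent \<gamma>"])
      show "((\<lambda>z. - ((1 - f + x) * z - z\<^sup>2/2)) has_real_derivative - (1 - f + x - z)) (at z)" for z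
        by (auto intro!: derivative_eq_intros)
      show "- (1 - f + x - z) \<le> tangent \<gamma> z \<bullet> - e" if "z \<in> {x - y..x}" for z
        using Tle[of z] that by auto
    qed (use y constrained_loopD(3)[OF \<gamma>] in auto)
    moreover have "- ((1 - f + x) * x - x\<^sup>2/2) - - ((1 - f + x) * (x - y) - (x - y)\<^sup>2/2) = - (y - f * y + y\<^sup>2/2)"
      by (simp add: power2_eq_square field_simps)
    ultimately have "(\<gamma> x - \<gamma> (x - y)) \<bullet> e \<le> y - f * y + y\<^sup>2/2" by simp
    moreover have "(\<gamma> b - \<gamma> x) \<bullet> e \<le> b - x" "(\<gamma> (x - y) - \<gamma> a) \<bullet> e \<le> x - y - a"
      using True y x by (auto intro!: adv)
    ultimately show ?thesis using ext by (simp add: inner_diff_left)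
  next
    case False
    then have bx: "b - x \<ge> 1/2" using ab by linarith
    have "(\<gamma> (x + y) - \<gamma> x) \<bullet> (- e) \<ge> - ((1 - f - x) * (x + y) + (x + y)\<^sup>2/2) - - ((1 - f - x) * x + x\<^sup>2/2)"
    proof (rule curve_inner_increment[where T = "tangent \<gamma>"])
      show "((\<lambda>z. - ((1 - f - x) * z + z\<^sup>2/2)) has_real_derivative - (1 - f - x + z)) (at z)" for z
        by (auto intro!: derivative_eq_intros)
      show "- (1 - f - x + z) \<le> tangent \<gamma> z \<bullet> - e" if "z \<in> {x..x + y}" for z
        using Tle[of z] that by auto
    qed (use y constrained_loopD(3)[OF \<gamma>] in auto)
    moreover have "- ((1 - f - x) * (x + y) + (x + y)\<^sup>2/2) - - ((1 - f - x) * x + x\<^sup>2/2) = - (y - f * y + y\<^sup>2/2)"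
      by (simp add: power2_eq_square field_simps)
    ultimately have "(\<gamma> (x + y) - \<gamma> x) \<bullet> e \<le> y - f * y + y\<^sup>2/2" by simp
    moreover have "(\<gamma> b - \<gamma> (x + y)) \<bullet> e \<le> b - (x + y)" "(\<gamma> x - \<gamma> a) \<bullet> e \<le> x - a"
      using bx y x by (auto intro!: adv)
    ultimately show ?thesis using ext by (simp add: inner_diff_left)
  qed
  moreover have "f * y \<ge> y * y" using y by (intro mult_right_mono) auto
  ultimately have "y\<^sup>2 \<le> 2 * E" by (simp add: power2_eq_square)
  then have le: "y \<le> sqrt (2 * E)" by (simp add: real_le_rsqrt)
  also have "\<dots> < sqrt ((1/2)\<^sup>2)" using E by (intro real_sqrt_less_mono) (simp add: power2_eq_square)
  finally have "y < 1/2" by simp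
  then have "y = f" by (auto simp: y_def min_def split: if_splits)
  then show False using le f by simp
qed

lemma norm_diff_unit:
  fixes x y :: "'a::real_inner"
  assumes "norm x = 1" "norm y = 1" "x \<bullet> y \<ge> 1 - \<epsilon>"
  shows "norm (x - y) \<le> sqrt (2 * \<epsilon>)"
proof -
  have "(norm (x - y))\<^sup>2 = 2 - 2 * (x \<bullet> y)"
    using assms(1,2) by (simp add: power2_norm_eq_inner inner_diff_left inner_diff_right inner_commute norm_eq_1)
  then have "(norm (x - y))\<^sup>2 \<le> 2 * \<epsilon>" using assms(3) by simp
  then show ?thesis by (simp add: real_le_rsqrt)
qed

text \<open>
  The first four components say that \<open>A a\<close>, \<open>A e\<close> lie in the plane through \<open>K t\<close>, and \<open>A b\<close>, \<open>A c\<close> in the plane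
  through \<open>K t'\<close>, orthogonal to the chord; the last two say that within these planes the
  points are collinear with \<open>K t\<close> and \<open>K t'\<close>.
\<close>

definition clasp_map :: "curve \<Rightarrow> curve \<Rightarrow> real \<times> real \<times> real \<times> real \<times> real \<times> real
    \<Rightarrow> real \<times> real \<times> real \<times> real \<times> real \<times> real"
  where "clasp_map K A = (\<lambda>(t, t', a, b, c, e).
    ((A a - K t) \<bullet> (K t' - K t), (A b - K t') \<bullet> (K t' - K t),
     (A c - K t') \<bullet> (K t' - K t), (A e - K t) \<bullet> (K t' - K t),
     (K t' - K t) \<bullet> cross3 (A a - K t) (A e - K t),
     (K t' - K t) \<bullet> cross3 (A b - K t') (A c - K t')))"

text \<open>
  The ring runs from \<open>A a\<close> along one strand to \<open>A b\<close>, around \<open>K t'\<close> to \<open>A c\<close>, back along the other strand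
  to \<open>A e\<close>, and around \<open>K t\<close> home.  The weak inequalities make the condition closed.
\<close>

definition clasped :: "real \<Rightarrow> real \<Rightarrow> curve \<Rightarrow> curve \<Rightarrow> real \<times> real \<times> real \<times> real \<times> real \<times> real \<Rightarrow> bool"
  where "clasped s L K A = (\<lambda>(t, t', a, b, c, e).
    t + pi \<le> t' \<and> t' \<le> t + s - pi \<and> a \<le> b \<and> b \<le> c \<and> c \<le> e \<and> e \<le> a + L \<and>
    clasp_map K A (t, t', a, b, c, e) = 0 \<and>
    (A a - K t) \<bullet> (A e - K t) \<le> 0 \<and> (A b - K t') \<bullet> (A c - K t') \<le> 0)"

text \<open>
  A clasp read from its other end is a clasp, so it suffices to analyse the end at \<open>t'\<close>.
\<close>

lemma clasped_rotate:
  assumes K: "constrained_loop 1 s K" and A: "constrained_loop 1 L A"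
    and cl: "clasped s L K A (t, t', a, b, c, e)"
  shows "clasped s L K A (t', t + s, c, e, a + L, b + L)"
proof -
  have 1: "(A x - p) \<bullet> (p' - q') = - ((A x - p) \<bullet> (q' - p'))" for x p p' q'
    by (simp add: inner_diff_right)
  have 2: "(q' - p') \<bullet> cross3 x y = (p' - q') \<bullet> cross3 y x" for p' q' x y :: "real^3"
    using cross_skew[of x y] by (simp add: inner_diff_left)
  show ?thesis
    using cl unfolding clasped_def clasp_map_def
    by (auto simp: constrained_loopD(2)[OF K] constrained_loopD(2)[OF A] zero_prod_def inner_commute
        1[of _ _ "K t" "K t'"] 2[of "K t" "K t'"])
qed

text \<open>
  The excess of \<open>K\<close> over the unit circle is so small because \<open>nearly_straight\<close> loses a square root of it, and
  the accumulated errors must leave room in the estimate of the angle between the two planes.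
\<close>

locale clasp =
  fixes s L d :: real and K A :: curve and t t' a b c e :: real
  assumes K: "constrained_loop 1 s K" and A: "constrained_loop 1 L A"
    and d: "1 \<le> d" "d < 2" and s: "2 * pi \<le> s" "s \<le> 2 * pi + 1/100000"
    and L: "L < 4 + 2 * pi * d"
    and far: "\<And>x y. norm (A x - K y) \<ge> d"
    and clasped: "clasped s L K A (t, t', a, b, c, e)"
begin

definition "v = K t' - K t"
definition "u = v /\<^sub>R norm v"
definition "\<delta> = s - 2 * pi"

lemma \<delta>: "0 \<le> \<delta>" "\<delta> \<le> 1/100000"
  using s by (auto simp: \<delta>_def)

lemma order: "t + pi \<le> t'" "t' \<le> t + pi + \<delta>" "a \<le> b" "b \<le> c" "c \<le> e" "e \<le> a + L"
  using clasped by (auto simp: clasped_def \<delta>_def)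

lemma planes: "(A a - K t) \<bullet> v = 0" "(A b - K t') \<bullet> v = 0" "(A c - K t') \<bullet> v = 0" "(A e - K t) \<bullet> v = 0"
  using clasped by (auto simp: clasped_def clasp_map_def v_def zero_prod_def)

lemma chord_ge: "norm v \<ge> 2 * sin ((t' - t) / 2)" and chord_ge': "norm v \<ge> 2 - \<delta>\<^sup>2 / 4"
proof -
  have "t \<le> t'" "t' - t \<le> 2 * pi" using order(1,2) \<delta> pi_ge_two by linarith+
  then show "norm v \<ge> 2 * sin ((t' - t) / 2)" unfolding v_def by (rule chord_ge_sin[OF K])
  show "norm v \<ge> 2 - \<delta>\<^sup>2 / 4"
    unfolding v_def using order(1,2) \<delta> by (intro chord_ge_near_diameter[OF K]) auto
qed

lemma v_bounds: "norm v \<ge> 199/100" "norm v > 0" "v \<noteq> 0"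
proof -
  have "\<delta>\<^sup>2 \<le> (1/100000)\<^sup>2" using \<delta> by (intro power_mono)
  then show 1: "norm v \<ge> 199/100" using chord_ge' by (simp add: power2_eq_square)
  then show "norm v > 0" by linarith
  then show "v \<noteq> 0" by auto
qed

lemma norm_u: "norm u = 1" and v_eq: "v = norm v *\<^sub>R u"
  using v_bounds by (simp_all add: u_def)

lemma planes': "(A a - K t) \<bullet> u = 0" "(A b - K t') \<bullet> u = 0" "(A c - K t') \<bullet> u = 0" "(A e - K t) \<bullet> u = 0"
  using planes by (simp_all add: u_def)

lemma antipodal:
  "(A a - K t) \<bullet> (A e - K t) = - (norm (A a - K t) * norm (A e - K t))"
  "(A b - K t') \<bullet> (A c - K t') = - (norm (A b - K t') * norm (A c - K t'))"
proof -
  have 1: "v \<bullet> cross3 (A a - K t) (A e - K t) = 0" "v \<bullet> cross3 (A b - K t') (A c - K t') = 0"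
    "(A a - K t) \<bullet> (A e - K t) \<le> 0" "(A b - K t') \<bullet> (A c - K t') \<le> 0"
    using clasped by (auto simp: clasped_def clasp_map_def v_def zero_prod_def)
  show "(A a - K t) \<bullet> (A e - K t) = - (norm (A a - K t) * norm (A e - K t))"
    by (rule antipodal_if_coplanar[OF v_bounds(3) planes(1,4) 1(1,3)])
  show "(A b - K t') \<bullet> (A c - K t') = - (norm (A b - K t') * norm (A c - K t'))"
    by (rule antipodal_if_coplanar[OF v_bounds(3) planes(2,3) 1(2,4)])
qed

text \<open>
  The strands connect the planes through the two ends of the chord, hence are at least as long as the chord.
  Together with \<open>caps\<close> this is the bound \<open>2 |p - q| + 2 \<pi> d\<close> for the length of the ring.
\<close>

lemma sides: "(A b - A a) \<bullet> u = norm v" "(A e - A c) \<bullet> u = - norm v"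
  "b - a \<ge> norm v" "e - c \<ge> norm v"
proof -
  have uv: "v \<bullet> u = norm v" using v_eq norm_u by (metis inner_scaleR_left mult.right_neutral norm_eq_1)
  have "(A b - A a) \<bullet> u = (A b - K t') \<bullet> u + v \<bullet> u - (A a - K t) \<bullet> u"
    by (simp add: v_def inner_diff_left)
  then show 1: "(A b - A a) \<bullet> u = norm v" using planes' uv by simp
  have "(A e - A c) \<bullet> u = (A e - K t) \<bullet> u - v \<bullet> u - (A c - K t') \<bullet> u"
    by (simp add: v_def inner_diff_left)
  then show 2: "(A e - A c) \<bullet> u = - norm v" using planes' uv by simp
  show "b - a \<ge> norm v"
    using norm_cauchy_schwarz[of "A b - A a" u] constrained_loop_lipschitz[OF A, of b a] 1 norm_u order
    by simp
  show "e - c \<ge> norm v"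
    using norm_cauchy_schwarz[of "A c - A e" u] constrained_loop_lipschitz[OF A, of c e] 2 norm_u order
    by (simp add: inner_diff_left)
qed

definition "r = norm (A b - K t')"
definition "r' = norm (A c - K t')"

lemma caps: "c - b \<ge> pi * d + (r - d)\<^sup>2 / (2 * (r + d))" "a + L - e \<ge> pi * d"
    "r \<ge> d" "r' \<ge> d" "c - b \<ge> pi * d" "c - b \<ge> pi * d + (r' - d)\<^sup>2 / (2 * (r' + d))"
proof -
  have dd: "d > 0" using d by simp
  show 1: "c - b \<ge> pi * d + (r - d)\<^sup>2 / (2 * (r + d))"
    unfolding r_def by (rule cap_length[OF constrained_loop_lipschitz[OF A] dd far order(4) antipodal(2)])
  have "- b - (- c) \<ge> pi * d + (norm (A (- (- c)) - K t') - d)\<^sup>2 / (2 * (norm (A (- (- c)) - K t') + d))"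
  proof (rule cap_length[OF _ dd])
    show "norm (A (- x) - A (- y)) \<le> \<bar>x - y\<bar>" for x y
      using constrained_loop_lipschitz[OF A, of "- x" "- y"] by simp
    show "(A (- (- c)) - K t') \<bullet> (A (- (- b)) - K t') = - (norm (A (- (- c)) - K t') * norm (A (- (- b)) - K t'))"
      using antipodal(2) by (simp add: inner_commute mult.commute)
  qed (use far order in auto)
  then show "c - b \<ge> pi * d + (r' - d)\<^sup>2 / (2 * (r' + d))" by (simp add: r'_def)
  have p: "A (a + L) = A a" by (rule constrained_loopD(2)[OF A])
  have "(a + L) - e \<ge> pi * d + (norm (A e - K t) - d)\<^sup>2 / (2 * (norm (A e - K t) + d))"
    by (rule cap_length[OF constrained_loop_lipschitz[OF A] dd far order(6)]) (use antipodal(1) in \<open>simp add: p inner_commute mult.commute\<close>)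
  moreover have "(norm (A e - K t) - d)\<^sup>2 / (2 * (norm (A e - K t) + d)) \<ge> 0"
    using far[of e t] d by simp
  ultimately show "a + L - e \<ge> pi * d" by linarith
  show "r \<ge> d" "r' \<ge> d" using far by (auto simp: r_def r'_def)
  then have "(r - d)\<^sup>2 / (2 * (r + d)) \<ge> 0" using d by simp
  then show "c - b \<ge> pi * d" using 1 by linarith
qed

lemma chord_less: "norm v < 2"
  using sides(3,4) caps(2,5) L by linarith

text \<open>
  This is the barrier: if one of the arcs of \<open>K\<close> had length exactly \<open>\<pi>\<close>, the chord would have length at
  least 2, for which the ring is too short.
\<close>

lemma strict_order: "t + pi < t'" "t' < t + s - pi" "a < b" "b < c" "c < e" "e < a + L"
proof -
  have "t' - t \<noteq> pi" using chord_ge chord_less by auto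
  moreover have "t' - t \<noteq> s - pi"
  proof
    assume "t' - t = s - pi"
    then have eq: "t + s = t' + pi" by simp
    interpret rot: clasp s L d K A t' "t + s" c e "a + L" "b + L"
      by unfold_locales (use K A d s L far clasped_rotate[OF K A clasped] in auto)
    have "rot.v = - v" unfolding rot.v_def v_def by (simp add: constrained_loopD(2)[OF K])
    then have "norm v \<ge> 2 * sin ((t + s - t') / 2)" using rot.chord_ge by simp
    then show False using eq chord_less by simp
  qed
  ultimately show "t + pi < t'" "t' < t + s - pi" using order by (auto simp: \<delta>_def)
  show "a < b" "c < e" using sides(3,4) v_bounds by linarith+
  have "pi * d > 0" using d pi_gt_zero by simp
  then show "b < c" "e < a + L" using caps(2,5) by linarith+
qed

text \<open>
  All lower bounds for the parts of the ring add up to almost its length, so each is almost attained.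
\<close>

lemma excess: "b - a - norm v \<le> \<delta>\<^sup>2 / 2" "e - c - norm v \<le> \<delta>\<^sup>2 / 2" "(r - d)\<^sup>2 / (2 * (r + d)) \<le> \<delta>\<^sup>2 / 2"
    "(r' - d)\<^sup>2 / (2 * (r' + d)) \<le> \<delta>\<^sup>2 / 2"
  using sides(3,4) caps L chord_ge' by linarith+

lemma r_le: "r \<le> d + 1/1000" "r' \<le> d + 1/1000"
proof -
  have "y \<le> d + 1/1000" if y: "y \<ge> d" "(y - d)\<^sup>2 / (2 * (y + d)) \<le> \<delta>\<^sup>2 / 2" for y
  proof (rule ccontr)
    assume "\<not> ?thesis"
    then have z: "y - d > 1/1000" by simp
    have "\<delta>\<^sup>2 \<le> (1/100000)\<^sup>2" using \<delta> by (intro power_mono)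
    then have "(y - d)\<^sup>2 / (2 * (y + d)) \<le> 1 / 10^10" using y(2) by (simp add: power2_eq_square)
    then have "(y - d)\<^sup>2 \<le> 2 * (y + d) / 10^10" using y(1) d by (simp add: field_simps)
    also have "\<dots> \<le> 2 * ((y - d) + 4) / 10^10" using d by simp
    finally have "(y - d) * (y - d) \<le> 2 * ((y - d) + 4) / 10^10" by (simp add: power2_eq_square)
    moreover have "(y - d) * (y - d) \<ge> (1/1000) * (y - d)" using z by (intro mult_right_mono) auto
    ultimately have "(1/1000) * (y - d) \<le> 2 * ((y - d) + 4) / 10^10" by linarith
    then show False using z by simp
  qed
  then show "r \<le> d + 1/1000" "r' \<le> d + 1/1000" using excess caps by blast+
qed

lemma strand_tangent:
  assumes "x \<in> {a..b}"
  shows "norm (tangent A x - u) \<le> 5/1000"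
proof -
  have d2: "\<delta>\<^sup>2 \<le> (1/100000)\<^sup>2" using \<delta> by (intro power_mono)
  have "tangent A x \<bullet> u \<ge> 1 - sqrt (2 * (\<delta>\<^sup>2 / 2))"
    by (rule nearly_straight[OF A norm_u _ _ _ _ assms])
       (use sides excess v_bounds d2 in \<open>auto simp: power2_eq_square\<close>)
  then have "tangent A x \<bullet> u \<ge> 1 - \<delta>" using \<delta> by simp
  then have "norm (tangent A x - u) \<le> sqrt (2 * \<delta>)"
    by (intro norm_diff_unit constrained_loopD(4)[OF A] norm_u)
  also have "\<dots> \<le> 5/1000" using \<delta> by (intro real_le_lsqrt) (auto simp: power2_eq_square)
  finally show ?thesis .
qed

lemma strand_tangent':
  assumes "x \<in> {c..e}"
  shows "norm (tangent A x + u) \<le> 5/1000"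
proof -
  have d2: "\<delta>\<^sup>2 \<le> (1/100000)\<^sup>2" using \<delta> by (intro power_mono)
  have "tangent A x \<bullet> (- u) \<ge> 1 - sqrt (2 * (\<delta>\<^sup>2 / 2))"
    by (rule nearly_straight[OF A _ _ _ _ _ assms])
       (use sides excess v_bounds d2 norm_u in \<open>auto simp: power2_eq_square\<close>)
  then have "tangent A x \<bullet> (- u) \<ge> 1 - \<delta>" using \<delta> by simp
  then have "norm (tangent A x - (- u)) \<le> sqrt (2 * \<delta>)"
    using norm_u by (intro norm_diff_unit constrained_loopD(4)[OF A]) auto
  also have "\<dots> \<le> 5/1000" using \<delta> by (intro real_le_lsqrt) (auto simp: power2_eq_square)
  finally show ?thesis by simp
qed

lemma strand_point: "norm (A (b - 1) - (A b - u)) \<le> 5/1000"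
proof -
  have "norm ((A b - b *\<^sub>R u) - (A (b - 1) - (b - 1) *\<^sub>R u)) \<le> 5/1000 * (b - (b - 1))"
  proof (rule lipschitz_finite_exceptions[of "{}"])
    show "continuous_on {b - 1..b} (\<lambda>x. A x - x *\<^sub>R u)"
      by (intro continuous_intros constrained_loop_continuous[OF A])
    fix x assume "b - 1 < x" "x < b"
    then have "x \<in> {a..b}" using sides v_bounds by auto
    then show "\<exists>D. ((\<lambda>x. A x - x *\<^sub>R u) has_vector_derivative D) (at x) \<and> norm D \<le> 5/1000"
      by (intro exI[of _ "tangent A x - u"] conjI strand_tangent)
         (auto intro!: derivative_eq_intros constrained_loopD(3)[OF A])
  qed auto
  moreover have "(A b - b *\<^sub>R u) - (A (b - 1) - (b - 1) *\<^sub>R u) = - (A (b - 1) - (A b - u))"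
    by (simp add: algebra_simps)
  ultimately show ?thesis using norm_minus_cancel[of "A (b - 1) - (A b - u)"] by simp
qed

lemma strand_point': "norm (A (c + 1) - (A c - u)) \<le> 5/1000"
proof -
  have "norm ((A (c + 1) + (c + 1) *\<^sub>R u) - (A c + c *\<^sub>R u)) \<le> 5/1000 * ((c + 1) - c)"
  proof (rule lipschitz_finite_exceptions[of "{}"])
    show "continuous_on {c..c + 1} (\<lambda>x. A x + x *\<^sub>R u)"
      by (intro continuous_intros constrained_loop_continuous[OF A])
    fix x assume "c < x" "x < c + 1"
    then have "x \<in> {c..e}" using sides v_bounds by auto
    then show "\<exists>D. ((\<lambda>x. A x + x *\<^sub>R u) has_vector_derivative D) (at x) \<and> norm D \<le> 5/1000"
      by (intro exI[of _ "tangent A x + u"] conjI strand_tangent')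
         (auto intro!: derivative_eq_intros constrained_loopD(3)[OF A])
  qed auto
  moreover have "(A (c + 1) + (c + 1) *\<^sub>R u) - (A c + c *\<^sub>R u) = A (c + 1) - (A c - u)"
    by (simp add: algebra_simps)
  ultimately show ?thesis by simp
qed

text \<open>
  Both arcs of \<open>K\<close> consist of a half turn, along which the tangent at \<open>t'\<close> gains nothing in total for the
  unit circle and hence loses nothing here, and of a rest of length at most \<open>\<delta>\<close>.  As the arcs lead from
  opposite sides, the chord is almost orthogonal to the tangent.
\<close>

lemma tangent_inner_u: "\<bar>tangent K t' \<bullet> u\<bar> \<le> 6/1000000"
proof -
  have lower: "(K y - K x) \<bullet> tangent K t' \<ge> x - y" if "x \<le> y" for x y
    using norm_cauchy_schwarz[of "K x - K y" "tangent K t'"] constrained_loop_lipschitz[OF K, of x y] that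
      constrained_loopD(4)[OF K, of t'] by (simp add: inner_diff_left)
  have half: "(K (x + pi) - K x) \<bullet> tangent K t' \<ge> 0" if "x = t' \<or> x = t' - pi" for x
  proof -
    have "(K (x + pi) - K x) \<bullet> tangent K t' \<ge> sin (x + pi - t') - sin (x - t')"
    proof (rule curve_inner_increment[where T = "tangent K"])
      show "((\<lambda>y. sin (y - t')) has_real_derivative cos (y - t')) (at y)" for y
        by (auto intro!: derivative_eq_intros)
      show "tangent K y \<bullet> tangent K t' \<ge> cos (y - t')" if "y \<in> {x..x + pi}" for y
        by (rule tangent_inner_ge_cos[OF K]) (use that \<open>x = t' \<or> x = t' - pi\<close> in auto)
    qed (use constrained_loopD(3)[OF K] in auto)
    then show ?thesis using that by auto
  qed
  have "v = (K t' - K (t' - pi)) + (K (t' - pi) - K t)" by (simp add: v_def)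
  then have 1: "v \<bullet> tangent K t' \<ge> - \<delta>"
    using half[of "t' - pi"] lower[of t "t' - pi"] order(1,2)
    by (simp only: inner_add_left) simp
  have "- v = (K (t + s) - K (t' + pi)) + (K (t' + pi) - K t')"
    by (simp add: v_def constrained_loopD(2)[OF K])
  then have "(- v) \<bullet> tangent K t' = (K (t + s) - K (t' + pi)) \<bullet> tangent K t' + (K (t' + pi) - K t') \<bullet> tangent K t'"
    by (simp only: inner_add_left)
  then have 2: "v \<bullet> tangent K t' \<le> \<delta>"
    using half[of t'] lower[of "t' + pi" "t + s"] order strict_order by (simp add: \<delta>_def)
  have "\<bar>v \<bullet> tangent K t'\<bar> \<le> \<delta>" using 1 2 by linarith
  moreover have "\<bar>v \<bullet> tangent K t'\<bar> = norm v * \<bar>tangent K t' \<bullet> u\<bar>"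
    by (subst v_eq) (simp add: inner_commute abs_mult)
  moreover have "norm v * \<bar>tangent K t' \<bullet> u\<bar> \<ge> 199/100 * \<bar>tangent K t' \<bullet> u\<bar>"
    using v_bounds by (intro mult_right_mono) auto
  ultimately show ?thesis using \<delta> by linarith
qed

text \<open>
  Beyond \<open>K t'\<close> the curve follows the circle with diameter \<open>v\<close>: the components of the tangent along
  \<open>tangent K t'\<close> and \<open>- u\<close> are bounded below by those of the circle, and a unit vector cannot exceed both.
\<close>

lemma quarter_tangent:
  assumes "x \<in> {0..pi/2}"
  shows "norm (tangent K (t' + x) - (cos x *\<^sub>R tangent K t' - sin x *\<^sub>R u)) \<le> 6/1000"
proof -
  have sc: "0 \<le> sin x" "0 \<le> cos x" using assms by (auto intro!: sin_ge_zero cos_ge_zero)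
  let ?X = "tangent K (t' + x)" and ?T = "tangent K t'"
  have n: "?X \<bullet> ?X = 1" "?T \<bullet> ?T = 1" "u \<bullet> u = 1"
    using constrained_loopD(4)[OF K] norm_u by (auto simp: norm_eq_1)
  have XT: "?X \<bullet> ?T \<ge> cos x"
    using tangent_inner_ge_cos[OF K, of "t' + x" t'] assms by auto
  have "(K (t' + pi) - K t') \<bullet> ?X \<ge> sin (t' + pi - (t' + x)) - sin (t' - (t' + x))"
  proof (rule curve_inner_increment[where T = "tangent K"])
    show "((\<lambda>y. sin (y - (t' + x))) has_real_derivative cos (y - (t' + x))) (at y)" for y
      by (auto intro!: derivative_eq_intros)
    show "tangent K y \<bullet> ?X \<ge> cos (y - (t' + x))" if "y \<in> {t'..t' + pi}" for y
      by (rule tangent_inner_ge_cos[OF K]) (use that assms in auto)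
  qed (use constrained_loopD(3)[OF K] in auto)
  then have 1: "(K (t' + pi) - K t') \<bullet> ?X \<ge> 2 * sin x" by (simp add: sin_diff)
  have 2: "(K (t + s) - K (t' + pi)) \<bullet> ?X \<ge> - \<delta>"
    using norm_cauchy_schwarz[of "K (t' + pi) - K (t + s)" ?X] constrained_loop_lipschitz[OF K, of "t' + pi" "t + s"]
      constrained_loopD(4)[OF K, of "t' + x"] order strict_order by (simp add: inner_diff_left \<delta>_def)
  have "- v = (K (t + s) - K (t' + pi)) + (K (t' + pi) - K t')"
    by (simp add: v_def constrained_loopD(2)[OF K])
  then have "(- v) \<bullet> ?X = (K (t + s) - K (t' + pi)) \<bullet> ?X + (K (t' + pi) - K t') \<bullet> ?X"
    by (simp only: inner_add_left)
  then have "(- v) \<bullet> ?X \<ge> 2 * sin x - \<delta>" using 1 2 by linarith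
  moreover have "v \<bullet> ?X = norm v * (?X \<bullet> u)"
    by (subst v_eq) (simp add: inner_commute)
  ultimately have "norm v * (- (?X \<bullet> u)) \<ge> 2 * sin x - \<delta>" by simp
  moreover have "norm v * (- (?X \<bullet> u)) \<le> 2 * (- (?X \<bullet> u)) + \<delta>"
  proof -
    have "(2 - norm v) * (?X \<bullet> u) \<le> (2 - norm v) * 1"
      using chord_less norm_cauchy_schwarz[of ?X u] constrained_loopD(4)[OF K] norm_u
      by (intro mult_left_mono) auto
    also have "\<dots> \<le> \<delta>" using chord_ge' \<delta> mult_right_mono[of \<delta> 1 \<delta>] by (simp add: power2_eq_square)
    finally show ?thesis by (simp add: algebra_simps)
  qed
  ultimately have Xu: "- (?X \<bullet> u) \<ge> sin x - \<delta>" by linarith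
  let ?Y = "cos x *\<^sub>R ?T - sin x *\<^sub>R u"
  have "?X \<bullet> ?Y = cos x * (?X \<bullet> ?T) + sin x * (- (?X \<bullet> u))" by (simp add: inner_diff_right)
  also have "\<dots> \<ge> cos x * cos x + sin x * (sin x - \<delta>)"
    using sc XT Xu by (intro add_mono mult_left_mono) auto
  finally have "?X \<bullet> ?Y \<ge> 1 - \<delta> * sin x"
    using sin_cos_squared_add[of x] by (simp add: power2_eq_square algebra_simps)
  moreover have "\<delta> * sin x \<le> \<delta> * 1" using \<delta> by (intro mult_left_mono) auto
  ultimately have XY: "?X \<bullet> ?Y \<ge> 1 - \<delta>" by linarith
  have "?Y \<bullet> ?Y = cos x * cos x + sin x * sin x - 2 * (cos x * sin x * (?T \<bullet> u))"
    by (simp add: inner_diff_left inner_diff_right n inner_commute algebra_simps)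
  moreover have "cos x * cos x + sin x * sin x = 1" using sin_cos_squared_add[of x] by (simp add: power2_eq_square)
  moreover have "\<bar>cos x * sin x * (?T \<bullet> u)\<bar> \<le> 1 * 1 * (6/1000000)"
    unfolding abs_mult using tangent_inner_u by (intro mult_mono) auto
  ultimately have YY: "?Y \<bullet> ?Y \<le> 1 + 12/1000000" by linarith
  have "(norm (?X - ?Y))\<^sup>2 = ?X \<bullet> ?X + ?Y \<bullet> ?Y - 2 * (?X \<bullet> ?Y)"
    unfolding power2_norm_eq_inner by (simp add: inner_diff_left inner_diff_right inner_commute)
  also have "\<dots> \<le> (6/1000)\<^sup>2" using n(1) YY XY \<delta> by (simp add: power2_eq_square)
  finally show ?thesis by (rule power2_le_imp_le) simp
qed

lemma quarter_point: "norm (K (t' + pi/2) - (K t' + tangent K t' - u)) \<le> 12/1000"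
proof -
  let ?g = "\<lambda>x. K (t' + x) - (sin x *\<^sub>R tangent K t' + cos x *\<^sub>R u)"
  have "norm (?g (pi/2) - ?g 0) \<le> 6/1000 * (pi/2 - 0)"
  proof (rule lipschitz_finite_exceptions[of "{}"])
    show "continuous_on {0..pi/2} ?g"
      by (intro continuous_intros continuous_on_compose2[OF constrained_loop_continuous[OF K]]) auto
    fix x :: real assume x: "0 < x" "x < pi/2"
    have "((K \<circ> (\<lambda>x. t' + x)) has_vector_derivative (1 *\<^sub>R tangent K (t' + x))) (at x)"
      by (intro vector_diff_chain_at) (auto intro!: derivative_eq_intros constrained_loopD(3)[OF K])
    then have "(?g has_vector_derivative (tangent K (t' + x) - (cos x *\<^sub>R tangent K t' - sin x *\<^sub>R u))) (at x)"
      by (auto intro!: derivative_eq_intros simp: o_def)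
    then show "\<exists>D. (?g has_vector_derivative D) (at x) \<and> norm D \<le> 6/1000"
      using quarter_tangent[of x] x by auto
  qed auto
  also have "6/1000 * (pi/2 - 0) \<le> 12/1000" using pi_less_4 by simp
  also have "?g (pi/2) - ?g 0 = K (t' + pi/2) - (K t' + tangent K t' - u)" by simp
  finally show ?thesis .
qed

definition "\<beta> = (A b - K t') /\<^sub>R r"
definition "w = cross3 \<beta> u"

lemma r_pos: "r > 0" "r' > 0"
  using caps d by linarith+

lemma b_eq: "A b - K t' = r *\<^sub>R \<beta>" and norm_\<beta>: "norm \<beta> = 1" and \<beta>_u: "\<beta> \<bullet> u = 0"
  using r_pos planes' by (simp_all add: \<beta>_def r_def[symmetric])

lemma c_eq: "A c - K t' = - (r' *\<^sub>R \<beta>)"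
proof -
  have "(A b - K t') \<bullet> (- (A c - K t')) = norm (A b - K t') * norm (- (A c - K t'))"
    using antipodal(2) by (simp only: inner_minus_right norm_minus_cancel minus_minus)
  then have "r *\<^sub>R (- (A c - K t')) = r' *\<^sub>R (A b - K t')"
    unfolding norm_cauchy_schwarz_eq r_def r'_def by (simp add: norm_minus_commute)
  then have "(1 / r) *\<^sub>R (r *\<^sub>R (A c - K t')) = (1 / r) *\<^sub>R (- (r' *\<^sub>R (r *\<^sub>R \<beta>)))"
    unfolding b_eq by (metis minus_minus scaleR_minus_right)
  then show ?thesis using r_pos by simp
qed

text \<open>
  Up to small errors, the strands contain the points \<open>K t' + d \<beta> - u\<close> and \<open>K t' - d \<beta> - u\<close>, whereas \<open>K\<close>
  passes through \<open>K t' + T - u\<close> with \<open>T = tangent K t'\<close>.  Their distances are at least \<open>d\<close>, which for unit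
  vectors means that \<open>2 d |T \<bullet> \<beta>|\<close> is at most about 1.
\<close>

lemma tangent_inner_\<beta>: "\<bar>tangent K t' \<bullet> \<beta>\<bar> \<le> 55/100"
proof -
  let ?T = "tangent K t'"
  have bound: "?T \<bullet> z \<le> 55/100"
    if z: "norm z = 1" and \<rho>: "d \<le> \<rho>" "\<rho> \<le> d + 1/1000" and x: "norm (A x - (K t' + \<rho> *\<^sub>R z - u)) \<le> 5/1000" for z \<rho> x
  proof -
    let ?e1 = "A x - (K t' + \<rho> *\<^sub>R z - u)" and ?e2 = "K (t' + pi/2) - (K t' + ?T - u)"
    have "\<rho> *\<^sub>R z - ?T = (A x - K (t' + pi/2)) - ?e1 + ?e2" by simp
    then have "norm (A x - K (t' + pi/2)) \<le> norm (\<rho> *\<^sub>R z - ?T) + norm ?e1 + norm ?e2"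
      by (smt (verit) add_diff_cancel diff_add_cancel norm_triangle_ineq norm_triangle_ineq4 norm_minus_commute)
    then have ge: "norm (\<rho> *\<^sub>R z - ?T) \<ge> d - 17/1000" using far[of x "t' + pi/2"] x quarter_point by linarith
    have "(norm (\<rho> *\<^sub>R z - ?T))\<^sup>2 = \<rho>\<^sup>2 + 1 - 2 * \<rho> * (?T \<bullet> z)"
      using z constrained_loopD(4)[OF K, of t']
      by (simp add: norm_diff_sq power_mult_distrib inner_commute)
    moreover have "(d - 17/1000)\<^sup>2 \<le> (norm (\<rho> *\<^sub>R z - ?T))\<^sup>2" using ge d by (intro power_mono) auto
    moreover have "\<rho>\<^sup>2 \<le> (d + 1/1000)\<^sup>2" using \<rho> d by (intro power_mono) auto
    ultimately have "2 * \<rho> * (?T \<bullet> z) \<le> (d + 1/1000)\<^sup>2 + 1 - (d - 17/1000)\<^sup>2" by linarith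
    also have "\<dots> = 1 + 36/1000 * d - 288/1000000" by (simp add: power2_eq_square algebra_simps)
    also have "\<dots> \<le> 1 + 72/1000" using d by simp
    finally have le: "2 * \<rho> * (?T \<bullet> z) \<le> 1072/1000" by simp
    show ?thesis
    proof (rule ccontr)
      assume "\<not> ?thesis"
      then have "2 * \<rho> * (?T \<bullet> z) \<ge> 2 * 1 * (55/100)" using \<rho> d by (intro mult_mono) auto
      then show False using le by simp
    qed
  qed
  have "?T \<bullet> \<beta> \<le> 55/100"
  proof (rule bound[OF norm_\<beta> caps(3) r_le(1)])
    have "A b = K t' + r *\<^sub>R \<beta>" using b_eq by (simp add: algebra_simps)
    then show "norm (A (b - 1) - (K t' + r *\<^sub>R \<beta> - u)) \<le> 5/1000" using strand_point by simp
  qed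
  moreover have "?T \<bullet> (- \<beta>) \<le> 55/100"
  proof (rule bound[OF _ caps(4) r_le(2)])
    have "A c = K t' + r' *\<^sub>R (- \<beta>)" using c_eq by (simp add: algebra_simps)
    then show "norm (A (c + 1) - (K t' + r' *\<^sub>R (- \<beta>) - u)) \<le> 5/1000" using strand_point' by simp
  qed (simp add: norm_\<beta>)
  ultimately show ?thesis by simp
qed

lemma norm_w: "norm w = 1" and w_u: "w \<bullet> u = 0"
proof -
  have "(norm w)\<^sup>2 = 1" using norm_cross_dot[of \<beta> u] norm_\<beta> norm_u \<beta>_u by (simp add: w_def)
  then show "norm w = 1" by (simp add: power2_eq_1_iff) (smt (verit) norm_ge_zero)
  show "w \<bullet> u = 0" by (simp add: w_def dot_cross_self)
qed

lemma tangent_inner_w: "\<bar>tangent K t' \<bullet> w\<bar> \<ge> 8/10"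
proof -
  let ?T = "tangent K t'"
  have T: "norm ?T = 1" by (rule constrained_loopD(4)[OF K])
  have "cross3 ?T w = (?T \<bullet> u) *\<^sub>R \<beta> - (?T \<bullet> \<beta>) *\<^sub>R u"
    by (simp add: w_def Lagrange)
  then have "(norm (cross3 ?T w))\<^sup>2 = (?T \<bullet> u)\<^sup>2 + (?T \<bullet> \<beta>)\<^sup>2"
    using norm_\<beta> norm_u \<beta>_u
    by (simp add: norm_diff_sq power_mult_distrib)
  moreover have "(norm (cross3 ?T w))\<^sup>2 + (?T \<bullet> w)\<^sup>2 = 1"
    using norm_cross_dot[of ?T w] T norm_w by simp
  moreover have "(?T \<bullet> u)\<^sup>2 \<le> (6/1000000)\<^sup>2"
    using power_mono[OF tangent_inner_u, of 2] by simp
  moreover have "(?T \<bullet> \<beta>)\<^sup>2 \<le> (55/100)\<^sup>2"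
    using power_mono[OF tangent_inner_\<beta>, of 2] by simp
  ultimately have "(8/10)\<^sup>2 \<le> (?T \<bullet> w)\<^sup>2" by (simp add: power2_eq_square)
  then show ?thesis by (simp add: abs_le_square_iff[symmetric])
qed

text \<open>
  The linearised clasp equations at \<open>t'\<close>: the strands are almost parallel to the chord, so moving
  along them hardly moves the points \<open>A b\<close> and \<open>A c\<close> transversally, whereas \<open>K\<close> crosses the plane
  spanned by the chord and the segment from \<open>A b\<close> to \<open>A c\<close> at a definite angle.
\<close>

lemma linearised_clasp:
  fixes \<tau> \<tau>' hb hc :: real
  defines "\<delta>v \<equiv> \<tau>' *\<^sub>R tangent K t' - \<tau> *\<^sub>R tangent K t"
  assumes b: "(A b - K t') \<bullet> \<delta>v + (hb *\<^sub>R tangent A b - \<tau>' *\<^sub>R tangent K t') \<bullet> v = 0"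
    and c: "(A c - K t') \<bullet> \<delta>v + (hc *\<^sub>R tangent A c - \<tau>' *\<^sub>R tangent K t') \<bullet> v = 0"
    and bc: "v \<bullet> (cross3 (A b - K t') (hc *\<^sub>R tangent A c - \<tau>' *\<^sub>R tangent K t') +
        cross3 (hb *\<^sub>R tangent A b - \<tau>' *\<^sub>R tangent K t') (A c - K t')) +
      \<delta>v \<bullet> cross3 (A b - K t') (A c - K t') = 0"
  shows "\<bar>hb\<bar> \<le> 3 * (\<bar>\<tau>\<bar> + \<bar>\<tau>'\<bar>)" "\<bar>hc\<bar> \<le> 3 * (\<bar>\<tau>\<bar> + \<bar>\<tau>'\<bar>)"
    "\<bar>\<tau>'\<bar> \<le> 1/10 * (\<bar>\<tau>\<bar> + \<bar>\<tau>'\<bar>)"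
proof -
  let ?S = "\<bar>\<tau>\<bar> + \<bar>\<tau>'\<bar>" and ?T = "tangent K t'"
  have S0: "0 \<le> ?S" by simp
  have \<delta>v: "norm \<delta>v \<le> ?S"
    unfolding \<delta>v_def using norm_triangle_ineq4[of "\<tau>' *\<^sub>R ?T" "\<tau> *\<^sub>R tangent K t"]
    by (simp add: constrained_loopD(4)[OF K])
  have Tv: "\<bar>?T \<bullet> v\<bar> \<le> 2 * (6/1000000)"
  proof -
    have "\<bar>?T \<bullet> v\<bar> = norm v * \<bar>?T \<bullet> u\<bar>" by (subst v_eq) (simp add: abs_mult)
    also have "\<dots> \<le> 2 * (6/1000000)" using chord_less tangent_inner_u by (intro mult_mono) auto
    finally show ?thesis .
  qed
  have arith: "x \<le> 3 * S" if "x \<le> S * (2 * (6/1000000)) + 2001/1000 * S" "0 \<le> S" for x S :: real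
    using that by simp
  have small: "\<bar>h\<bar> \<le> 3 * ?S"
    if X: "norm X \<le> 2001/1000" and Y: "norm (Y - \<sigma> *\<^sub>R u) \<le> 5/1000" and \<sigma>: "\<bar>\<sigma>\<bar> = 1"
      and eq: "X \<bullet> \<delta>v + (h *\<^sub>R Y - \<tau>' *\<^sub>R ?T) \<bullet> v = 0" for X Y \<sigma> h
  proof -
    have "u \<bullet> v = norm v" by (subst v_eq) (use norm_u in \<open>simp add: norm_eq_1\<close>)
    then have "Y \<bullet> v = (Y - \<sigma> *\<^sub>R u) \<bullet> v + \<sigma> * norm v" by (simp add: inner_diff_left)
    moreover have "\<bar>(Y - \<sigma> *\<^sub>R u) \<bullet> v\<bar> \<le> 5/1000 * 2"
      using Cauchy_Schwarz_ineq2[of "Y - \<sigma> *\<^sub>R u" v] mult_mono[OF Y less_imp_le[OF chord_less]] by simp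
    moreover have "\<bar>\<sigma> * norm v\<bar> \<ge> 199/100" using \<sigma> v_bounds by (simp add: abs_mult)
    ultimately have Yv: "\<bar>Y \<bullet> v\<bar> \<ge> 19/10" by linarith
    have "h * (Y \<bullet> v) = \<tau>' * (?T \<bullet> v) - X \<bullet> \<delta>v" using eq by (simp add: inner_diff_left)
    then have "\<bar>h\<bar> * \<bar>Y \<bullet> v\<bar> \<le> \<bar>\<tau>'\<bar> * \<bar>?T \<bullet> v\<bar> + \<bar>X \<bullet> \<delta>v\<bar>"
      by (metis abs_mult abs_triangle_ineq4)
    also have "\<dots> \<le> ?S * (2 * (6/1000000)) + 2001/1000 * ?S"
      using Tv Cauchy_Schwarz_ineq2[of X \<delta>v] mult_mono[OF X \<delta>v]
      by (intro add_mono mult_mono) (auto intro: order_trans)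
    finally have "\<bar>h\<bar> * \<bar>Y \<bullet> v\<bar> \<le> 3 * ?S" using arith S0 by blast
    moreover have "\<bar>h\<bar> * 1 \<le> \<bar>h\<bar> * \<bar>Y \<bullet> v\<bar>" using Yv by (intro mult_left_mono) auto
    ultimately show ?thesis by linarith
  qed
  have Yb: "norm (tangent A b - 1 *\<^sub>R u) \<le> 5/1000" using strand_tangent[of b] order by simp
  have Yc: "norm (tangent A c - (-1) *\<^sub>R u) \<le> 5/1000" using strand_tangent'[of c] order by simp
  show hb: "\<bar>hb\<bar> \<le> 3 * ?S"
    by (rule small[OF _ Yb _ b]) (use r_le d in \<open>simp_all add: r_def[symmetric]\<close>)
  show hc: "\<bar>hc\<bar> \<le> 3 * ?S"
    by (rule small[OF _ Yc _ c]) (use r_le d in \<open>simp_all add: r'_def[symmetric]\<close>)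
  let ?X = "hb *\<^sub>R tangent A b - \<tau>' *\<^sub>R ?T" and ?Y = "hc *\<^sub>R tangent A c - \<tau>' *\<^sub>R ?T"
  have par: "cross3 (A b - K t') (A c - K t') = 0"
    unfolding b_eq c_eq by (simp add: cross_mult_left cross_mult_right)
  have tri: "u \<bullet> cross3 \<beta> z = - (z \<bullet> w)" "u \<bullet> cross3 z \<beta> = z \<bullet> w" for z
  proof -
    show "u \<bullet> cross3 z \<beta> = z \<bullet> w" unfolding w_def by (simp add: cross3_simps)
    then show "u \<bullet> cross3 \<beta> z = - (z \<bullet> w)" using cross_skew[of \<beta> z] by simp
  qed
  have "norm v * (- r * (?Y \<bullet> w) - r' * (?X \<bullet> w)) = 0"
  proof -
    have "v \<bullet> (cross3 (r *\<^sub>R \<beta>) ?Y + cross3 ?X (- (r' *\<^sub>R \<beta>))) = 0"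
      using bc par unfolding b_eq c_eq by simp
    then have "norm v * (u \<bullet> (cross3 (r *\<^sub>R \<beta>) ?Y + cross3 ?X (- (r' *\<^sub>R \<beta>)))) = 0"
      by (subst (asm) v_eq) (simp only: inner_scaleR_left)
    moreover have "u \<bullet> (cross3 (r *\<^sub>R \<beta>) ?Y + cross3 ?X (- (r' *\<^sub>R \<beta>))) = - r * (?Y \<bullet> w) - r' * (?X \<bullet> w)"
      unfolding inner_add_right cross_minus_right inner_minus_right cross_mult_left cross_mult_right
        inner_scaleR_right tri by simp
    ultimately show ?thesis by simp
  qed
  then have "r * (?Y \<bullet> w) + r' * (?X \<bullet> w) = 0" using v_bounds by auto
  then have eq: "(r + r') * (\<tau>' * (?T \<bullet> w)) = r' * (hb * (tangent A b \<bullet> w)) + r * (hc * (tangent A c \<bullet> w))"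
    by (simp add: inner_diff_left algebra_simps)
  have uw: "u \<bullet> w = 0" using w_u by (simp add: inner_commute)
  have tb: "\<bar>tangent A b \<bullet> w\<bar> \<le> 5/1000"
  proof -
    have "tangent A b \<bullet> w = (tangent A b - 1 *\<^sub>R u) \<bullet> w" by (simp add: inner_diff_left inner_add_left uw)
    also have "\<bar>\<dots>\<bar> \<le> norm (tangent A b - 1 *\<^sub>R u) * norm w" by (rule Cauchy_Schwarz_ineq2)
    finally show ?thesis using Yb norm_w by simp
  qed
  have tc: "\<bar>tangent A c \<bullet> w\<bar> \<le> 5/1000"
  proof -
    have "tangent A c \<bullet> w = (tangent A c - (-1) *\<^sub>R u) \<bullet> w" by (simp add: inner_diff_left inner_add_left uw)
    also have "\<bar>\<dots>\<bar> \<le> norm (tangent A c - (-1) *\<^sub>R u) * norm w" by (rule Cauchy_Schwarz_ineq2)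
    finally show ?thesis using Yc norm_w by simp
  qed
  have "(r + r') * (\<bar>\<tau>'\<bar> * \<bar>?T \<bullet> w\<bar>) = \<bar>(r + r') * (\<tau>' * (?T \<bullet> w))\<bar>"
    using r_pos by (simp add: abs_mult)
  also have "\<dots> \<le> r' * (\<bar>hb\<bar> * \<bar>tangent A b \<bullet> w\<bar>) + r * (\<bar>hc\<bar> * \<bar>tangent A c \<bullet> w\<bar>)"
    unfolding eq using r_pos abs_triangle_ineq[of "r' * (hb * (tangent A b \<bullet> w))" "r * (hc * (tangent A c \<bullet> w))"]
    by (simp add: abs_mult)
  also have "\<dots> \<le> r' * (3 * ?S * (5/1000)) + r * (3 * ?S * (5/1000))"
    using r_pos hb hc tb tc S0 by (intro add_mono mult_left_mono mult_mono) auto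
  also have "\<dots> = (r + r') * (15/1000 * ?S)" by (simp add: algebra_simps)
  finally have "\<bar>\<tau>'\<bar> * \<bar>?T \<bullet> w\<bar> \<le> 15/1000 * ?S" using r_pos by simp
  moreover have "\<bar>\<tau>'\<bar> * (8/10) \<le> \<bar>\<tau>'\<bar> * \<bar>?T \<bullet> w\<bar>" using tangent_inner_w by (intro mult_left_mono) auto
  ultimately have "\<bar>\<tau>'\<bar> * (8/10) \<le> 15/1000 * ?S" by (rule order_trans[rotated])
  then show "\<bar>\<tau>'\<bar> \<le> 1/10 * ?S" using S0 by simp
qed

end

section \<open>Clasps persist under thin isotopies\<close>

lemma (in clasp) rotated: "clasp s L d K A t' (t + s) c e (a + L) (b + L)"
  by unfold_locales (use K A d s L far clasped_rotate[OF K A clasped] in auto)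

text \<open>
  With \<open>g\<close> the inverse of the derivative, the map \<open>x \<mapsto> x - g (G x)\<close> sends a small ball around \<open>x0\<close> to
  itself, and its fixed points are the zeros of \<open>G\<close>.
\<close>

lemma zero_persists:
  fixes F :: "'a::euclidean_space \<Rightarrow> 'a"
  assumes F: "(F has_derivative F') (at x0)" "F x0 = 0" "inj F'" and \<epsilon>: "\<epsilon> > 0"
  obtains r \<eta> where "0 < r" "r \<le> \<epsilon>" "0 < \<eta>"
    "\<And>G. continuous_on (cball x0 r) G \<Longrightarrow> (\<And>x. x \<in> cball x0 r \<Longrightarrow> norm (G x - F x) \<le> \<eta>)
      \<Longrightarrow> \<exists>x\<in>cball x0 r. G x = 0"
proof -
  have lin: "linear F'" using F(1) has_derivative_linear by blast
  obtain g where g: "linear g" "g \<circ> F' = id"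
    using linear_injective_left_inverse[OF lin F(3)] by blast
  have surj: "surj F'" using linear_injective_imp_surjective[OF lin F(3)] by blast
  have g0: "y = 0" if "g y = 0" for y
  proof -
    obtain x where x: "y = F' x" using surj by blast
    then have "x = g y" using g(2) by (metis comp_apply id_apply)
    then show ?thesis using that x linear_0[OF lin] by simp
  qed
  obtain B where B: "B > 0" "\<And>y. norm (g y) \<le> B * norm y"
    using linear_bounded_pos[OF g(1)] by blast
  have "1 / (2 * B) > 0" using B by simp
  then obtain d where d: "d > 0"
    "\<And>y. norm (y - x0) < d \<Longrightarrow> norm (F y - F x0 - F' (y - x0)) \<le> 1 / (2 * B) * norm (y - x0)"
    using F(1) unfolding has_derivative_at_alt by meson
  define r where "r = min \<epsilon> (d / 2)"
  define \<eta> where "\<eta> = r / (2 * B)"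
  have r: "0 < r" "r \<le> \<epsilon>" "r < d" using \<epsilon> d(1) by (auto simp: r_def min_def)
  show ?thesis
  proof (rule that[OF r(1,2)])
    show "0 < \<eta>" using r B by (simp add: \<eta>_def)
    fix G assume G: "continuous_on (cball x0 r) G" "\<And>x. x \<in> cball x0 r \<Longrightarrow> norm (G x - F x) \<le> \<eta>"
    define h where "h = (\<lambda>x. x - g (G x))"
    have "continuous_on (cball x0 r) h"
      unfolding h_def using G(1) linear_continuous_on_compose[OF G(1) g(1)] by (intro continuous_intros)
    moreover have "h x \<in> cball x0 r" if x: "x \<in> cball x0 r" for x
    proof -
      have nx: "norm (x - x0) \<le> r" using x by (simp add: dist_norm norm_minus_commute)
      have "g (F' (x - x0)) = x - x0" using g(2) by (metis comp_apply id_apply)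
      then have "h x - x0 = - g (F x - F x0 - F' (x - x0)) - g (G x - F x)"
        using F(2) linear_diff[OF g(1)] by (simp add: h_def)
      then have "norm (h x - x0) \<le> norm (g (F x - F x0 - F' (x - x0))) + norm (g (G x - F x))"
        by (metis norm_minus_cancel norm_triangle_ineq4)
      also have "norm (g (F x - F x0 - F' (x - x0))) \<le> B * (1 / (2 * B) * norm (x - x0))"
        using B(2)[of "F x - F x0 - F' (x - x0)"] d(2)[of x] nx r B(1) by (smt (verit) mult_left_mono)
      also have "norm (g (G x - F x)) \<le> B * \<eta>"
        using B(2)[of "G x - F x"] G(2)[OF x] B(1) by (smt (verit) mult_left_mono)
      also have "B * (1 / (2 * B) * norm (x - x0)) + B * \<eta> \<le> r"
        using nx B(1) by (simp add: \<eta>_def)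
      finally show ?thesis by (simp add: dist_norm norm_minus_commute)
    qed
    ultimately obtain x where x: "x \<in> cball x0 r" "h x = x"
      using brouwer[of "cball x0 r" h] r by (auto simp: compact_cball convex_cball)
    then have "g (G x) = 0" by (simp add: h_def)
    then show "\<exists>x\<in>cball x0 r. G x = 0" using x(1) g0 by blast
  qed
qed

lemma has_derivative_cross3:
  assumes "(f has_derivative f') (at x)" "(g has_derivative g') (at x)"
  shows "((\<lambda>x. cross3 (f x) (g x)) has_derivative (\<lambda>h. cross3 (f x) (g' h) + cross3 (f' h) (g x))) (at x)"
proof -
  have "bounded_bilinear cross3" using bilinear_cross bilinear_conv_bounded_bilinear by blast
  from bounded_bilinear.FDERIV[OF this assms] show ?thesis .
qed

lemma has_derivative_curve:
  assumes "constrained_loop 1 s \<gamma>" "(f has_derivative f') (at x)"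
  shows "((\<lambda>x. \<gamma> (f x)) has_derivative (\<lambda>h. f' h *\<^sub>R tangent \<gamma> (f x))) (at x)"
proof -
  have "(\<gamma> has_derivative (\<lambda>h. h *\<^sub>R tangent \<gamma> (f x))) (at (f x))"
    using constrained_loopD(3)[OF assms(1)] by (simp add: has_vector_derivative_def)
  from has_derivative_compose[OF assms(2) this] show ?thesis .
qed

definition clasp_map_deriv :: "curve \<Rightarrow> curve \<Rightarrow> real \<times> real \<times> real \<times> real \<times> real \<times> real
    \<Rightarrow> real \<times> real \<times> real \<times> real \<times> real \<times> real \<Rightarrow> real \<times> real \<times> real \<times> real \<times> real \<times> real"
  where "clasp_map_deriv K A = (\<lambda>(t, t', a, b, c, e) (\<tau>, \<tau>', ha, hb, hc, he).
    ((A a - K t) \<bullet> (\<tau>' *\<^sub>R tangent K t' - \<tau> *\<^sub>R tangent K t)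
        + (ha *\<^sub>R tangent A a - \<tau> *\<^sub>R tangent K t) \<bullet> (K t' - K t),
     (A b - K t') \<bullet> (\<tau>' *\<^sub>R tangent K t' - \<tau> *\<^sub>R tangent K t)
        + (hb *\<^sub>R tangent A b - \<tau>' *\<^sub>R tangent K t') \<bullet> (K t' - K t),
     (A c - K t') \<bullet> (\<tau>' *\<^sub>R tangent K t' - \<tau> *\<^sub>R tangent K t)
        + (hc *\<^sub>R tangent A c - \<tau>' *\<^sub>R tangent K t') \<bullet> (K t' - K t),
     (A e - K t) \<bullet> (\<tau>' *\<^sub>R tangent K t' - \<tau> *\<^sub>R tangent K t)
        + (he *\<^sub>R tangent A e - \<tau> *\<^sub>R tangent K t) \<bullet> (K t' - K t),
     (K t' - K t) \<bullet> (cross3 (A a - K t) (he *\<^sub>R tangent A e - \<tau> *\<^sub>R tangent K t)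
        + cross3 (ha *\<^sub>R tangent A a - \<tau> *\<^sub>R tangent K t) (A e - K t))
        + (\<tau>' *\<^sub>R tangent K t' - \<tau> *\<^sub>R tangent K t) \<bullet> cross3 (A a - K t) (A e - K t),
     (K t' - K t) \<bullet> (cross3 (A b - K t') (hc *\<^sub>R tangent A c - \<tau>' *\<^sub>R tangent K t')
        + cross3 (hb *\<^sub>R tangent A b - \<tau>' *\<^sub>R tangent K t') (A c - K t'))
        + (\<tau>' *\<^sub>R tangent K t' - \<tau> *\<^sub>R tangent K t) \<bullet> cross3 (A b - K t') (A c - K t')))"

lemma clasp_map_derivative:
  assumes K: "constrained_loop 1 s K" and A: "constrained_loop 1 L A"
  shows "(clasp_map K A has_derivative clasp_map_deriv K A (t, t', a, b, c, e)) (at (t, t', a, b, c, e))"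
    (is "(_ has_derivative ?D) (at ?x)")
proof -
  let ?f = "\<lambda>x. ((A (fst (snd (snd x))) - K (fst x)) \<bullet> (K (fst (snd x)) - K (fst x)),
     (A (fst (snd (snd (snd x)))) - K (fst (snd x))) \<bullet> (K (fst (snd x)) - K (fst x)),
     (A (fst (snd (snd (snd (snd x))))) - K (fst (snd x))) \<bullet> (K (fst (snd x)) - K (fst x)),
     (A (snd (snd (snd (snd (snd x))))) - K (fst x)) \<bullet> (K (fst (snd x)) - K (fst x)),
     (K (fst (snd x)) - K (fst x)) \<bullet> cross3 (A (fst (snd (snd x))) - K (fst x)) (A (snd (snd (snd (snd (snd x))))) - K (fst x)),
     (K (fst (snd x)) - K (fst x)) \<bullet> cross3 (A (fst (snd (snd (snd x)))) - K (fst (snd x)))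
        (A (fst (snd (snd (snd (snd x))))) - K (fst (snd x))))"
  have "clasp_map K A = ?f" by (auto simp: clasp_map_def fun_eq_iff)
  moreover have "(?f has_derivative ?D) (at ?x)"
  proof -
    have proj: "bounded_linear (\<lambda>x :: real \<times> real \<times> real \<times> real \<times> real \<times> real. fst x)" "bounded_linear (\<lambda>x :: real \<times> real \<times> real \<times> real \<times> real \<times> real. fst (snd x))"
      "bounded_linear (\<lambda>x :: real \<times> real \<times> real \<times> real \<times> real \<times> real. fst (snd (snd x)))"
      "bounded_linear (\<lambda>x :: real \<times> real \<times> real \<times> real \<times> real \<times> real. fst (snd (snd (snd x))))"
      "bounded_linear (\<lambda>x :: real \<times> real \<times> real \<times> real \<times> real \<times> real. fst (snd (snd (snd (snd x)))))"
      "bounded_linear (\<lambda>x :: real \<times> real \<times> real \<times> real \<times> real \<times> real. snd (snd (snd (snd (snd x)))))"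
      by (intro bounded_linear_fst_comp bounded_linear_snd_comp bounded_linear_ident)+
    note D = bounded_linear_imp_has_derivative
    have p: "((\<lambda>x. K (fst x)) has_derivative (\<lambda>h. (fst h) *\<^sub>R tangent K t)) (at ?x)"
      using has_derivative_curve[OF K D[OF proj(1)], of ?x] by simp
    have q: "((\<lambda>x. K (fst (snd x))) has_derivative (\<lambda>h. (fst (snd h)) *\<^sub>R tangent K t')) (at ?x)"
      using has_derivative_curve[OF K D[OF proj(2)], of ?x] by simp
    have a: "((\<lambda>x. A (fst (snd (snd x)))) has_derivative (\<lambda>h. (fst (snd (snd h))) *\<^sub>R tangent A a)) (at ?x)"
      using has_derivative_curve[OF A D[OF proj(3)], of ?x] by simp
    have b: "((\<lambda>x. A (fst (snd (snd (snd x))))) has_derivative (\<lambda>h. (fst (snd (snd (snd h)))) *\<^sub>R tangent A b)) (at ?x)"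
      using has_derivative_curve[OF A D[OF proj(4)], of ?x] by simp
    have c: "((\<lambda>x. A (fst (snd (snd (snd (snd x)))))) has_derivative (\<lambda>h. (fst (snd (snd (snd (snd h))))) *\<^sub>R tangent A c)) (at ?x)"
      using has_derivative_curve[OF A D[OF proj(5)], of ?x] by simp
    have e: "((\<lambda>x. A (snd (snd (snd (snd (snd x)))))) has_derivative (\<lambda>h. (snd (snd (snd (snd (snd h))))) *\<^sub>R tangent A e)) (at ?x)"
      using has_derivative_curve[OF A D[OF proj(6)], of ?x] by simp
    note v = has_derivative_diff[OF q p]
    note ap = has_derivative_diff[OF a p] and bq = has_derivative_diff[OF b q]
      and cq = has_derivative_diff[OF c q] and ep = has_derivative_diff[OF e p]
    show ?thesis
      by (rule has_derivative_eq_rhs[OF has_derivative_Pair[OF has_derivative_inner[OF ap v]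
            has_derivative_Pair[OF has_derivative_inner[OF bq v] has_derivative_Pair[OF has_derivative_inner[OF cq v]
            has_derivative_Pair[OF has_derivative_inner[OF ep v]
            has_derivative_Pair[OF has_derivative_inner[OF v has_derivative_cross3[OF ap ep]]
              has_derivative_inner[OF v has_derivative_cross3[OF bq cq]]]]]]]])
         (simp add: clasp_map_deriv_def fun_eq_iff split_beta)
  qed
  ultimately show ?thesis by simp
qed

text \<open>
  Applied at both ends of the clasp, \<open>linearised_clasp\<close> bounds each of \<open>\<tau>\<close> and \<open>\<tau>'\<close> by a tenth of
  the sum of their absolute values.
\<close>

lemma (in clasp) clasp_map_nondegenerate:
  obtains D where "(clasp_map K A has_derivative D) (at (t, t', a, b, c, e))" "inj D"
proof (rule that[OF clasp_map_derivative[OF K A]])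
  let ?D = "clasp_map_deriv K A (t, t', a, b, c, e)"
  have lin: "linear ?D" by (rule has_derivative_linear[OF clasp_map_derivative[OF K A]])
  show "inj ?D"
    unfolding linear_injective_0[OF lin]
  proof (intro allI impI)
    fix x assume D0: "?D x = 0"
    obtain \<tau> \<tau>' ha hb hc he where x: "x = (\<tau>, \<tau>', ha, hb, hc, he)" by (metis prod.exhaust)
    let ?w = "\<tau>' *\<^sub>R tangent K t' - \<tau> *\<^sub>R tangent K t"
    have eqs: "(A a - K t) \<bullet> ?w + (ha *\<^sub>R tangent A a - \<tau> *\<^sub>R tangent K t) \<bullet> v = 0"
      "(A b - K t') \<bullet> ?w + (hb *\<^sub>R tangent A b - \<tau>' *\<^sub>R tangent K t') \<bullet> v = 0"
      "(A c - K t') \<bullet> ?w + (hc *\<^sub>R tangent A c - \<tau>' *\<^sub>R tangent K t') \<bullet> v = 0"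
      "(A e - K t) \<bullet> ?w + (he *\<^sub>R tangent A e - \<tau> *\<^sub>R tangent K t) \<bullet> v = 0"
      "v \<bullet> (cross3 (A a - K t) (he *\<^sub>R tangent A e - \<tau> *\<^sub>R tangent K t)
        + cross3 (ha *\<^sub>R tangent A a - \<tau> *\<^sub>R tangent K t) (A e - K t))
        + ?w \<bullet> cross3 (A a - K t) (A e - K t) = 0"
      "v \<bullet> (cross3 (A b - K t') (hc *\<^sub>R tangent A c - \<tau>' *\<^sub>R tangent K t')
        + cross3 (hb *\<^sub>R tangent A b - \<tau>' *\<^sub>R tangent K t') (A c - K t'))
        + ?w \<bullet> cross3 (A b - K t') (A c - K t') = 0"
      using D0 unfolding x v_def clasp_map_deriv_def zero_prod_def prod.case prod.inject by blast+
    note near_t' = linearised_clasp[OF eqs(2,3,6)]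
    interpret rot: clasp s L d K A t' "t + s" c e "a + L" "b + L" by (rule rotated)
    have per: "K (t + s) = K t" "A (a + L) = A a" "tangent K (t + s) = tangent K t"
      "tangent A (a + L) = tangent A a" "rot.v = - v"
      by (simp_all add: constrained_loopD(2)[OF K] constrained_loopD(2)[OF A] tangent_periodic[OF K]
          tangent_periodic[OF A] rot.v_def v_def)
    have neg: "\<tau> *\<^sub>R tangent K t - \<tau>' *\<^sub>R tangent K t' = - ?w" by simp
    have sw: "- v \<bullet> (cross3 x y' + cross3 x' y) + - w' \<bullet> cross3 x y =
        v \<bullet> (cross3 y x' + cross3 y' x) + w' \<bullet> cross3 y x" for x y x' y' w' :: "real^3"
      using cross_skew[of x y'] cross_skew[of x' y] cross_skew[of x y]
      by (simp add: inner_add_right algebra_simps)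
    have near_t: "\<bar>he\<bar> \<le> 3 * (\<bar>\<tau>'\<bar> + \<bar>\<tau>\<bar>)" "\<bar>ha\<bar> \<le> 3 * (\<bar>\<tau>'\<bar> + \<bar>\<tau>\<bar>)" "\<bar>\<tau>\<bar> \<le> 1/10 * (\<bar>\<tau>'\<bar> + \<bar>\<tau>\<bar>)"
    proof -
      have 1: "(A e - K (t + s)) \<bullet> (\<tau> *\<^sub>R tangent K (t + s) - \<tau>' *\<^sub>R tangent K t')
          + (he *\<^sub>R tangent A e - \<tau> *\<^sub>R tangent K (t + s)) \<bullet> rot.v = 0"
        unfolding per neg inner_minus_right using eqs(4) by linarith
      have 2: "(A (a + L) - K (t + s)) \<bullet> (\<tau> *\<^sub>R tangent K (t + s) - \<tau>' *\<^sub>R tangent K t')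
          + (ha *\<^sub>R tangent A (a + L) - \<tau> *\<^sub>R tangent K (t + s)) \<bullet> rot.v = 0"
        unfolding per neg inner_minus_right using eqs(1) by linarith
      have 3: "rot.v \<bullet> (cross3 (A e - K (t + s)) (ha *\<^sub>R tangent A (a + L) - \<tau> *\<^sub>R tangent K (t + s))
          + cross3 (he *\<^sub>R tangent A e - \<tau> *\<^sub>R tangent K (t + s)) (A (a + L) - K (t + s)))
          + (\<tau> *\<^sub>R tangent K (t + s) - \<tau>' *\<^sub>R tangent K t') \<bullet> cross3 (A e - K (t + s)) (A (a + L) - K (t + s)) = 0"
        unfolding per neg sw by (rule eqs(5))
      show "\<bar>he\<bar> \<le> 3 * (\<bar>\<tau>'\<bar> + \<bar>\<tau>\<bar>)" "\<bar>ha\<bar> \<le> 3 * (\<bar>\<tau>'\<bar> + \<bar>\<tau>\<bar>)" "\<bar>\<tau>\<bar> \<le> 1/10 * (\<bar>\<tau>'\<bar> + \<bar>\<tau>\<bar>)"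
        by (rule rot.linearised_clasp[OF 1 2 3])+
    qed
    have "\<tau> = 0" "\<tau>' = 0" using near_t(3) near_t'(3) by auto
    then show "x = 0" using near_t near_t' by (simp add: x zero_prod_def)
  qed
qed

lemma thin_isotopy_continuous:
  assumes \<Gamma>: "thin_isotopy d n s \<Gamma>" and i: "i < n"
  shows "continuous_on ({0..1} \<times> UNIV) (\<lambda>z. \<Gamma> (fst z) i (snd z))"
  unfolding continuous_on_iff
proof (intro ballI allI impI)
  fix z :: "real \<times> real" and \<epsilon> :: real
  assume z: "z \<in> {0..1} \<times> UNIV" and \<epsilon>: "\<epsilon> > 0"
  obtain u x where zx: "z = (u, x)" "u \<in> {0..1}" using z by auto
  have "uniform_limit UNIV (\<lambda>v. \<Gamma> v i) (\<Gamma> u i) (at u within {0..1})"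
    using \<Gamma> i zx unfolding thin_isotopy_def by blast
  then have "\<forall>\<^sub>F v in at u within {0..1}. \<forall>y\<in>UNIV. dist (\<Gamma> v i y) (\<Gamma> u i y) < \<epsilon> / 2"
    using \<epsilon> by (auto dest!: uniform_limitD[of _ _ _ _ "\<epsilon> / 2"])
  then obtain \<delta> where \<delta>: "\<delta> > 0"
    "\<And>v. v \<in> {0..1} \<Longrightarrow> v \<noteq> u \<Longrightarrow> dist v u < \<delta> \<Longrightarrow> dist (\<Gamma> v i x) (\<Gamma> u i x) < \<epsilon> / 2"
    unfolding eventually_at by blast
  show "\<exists>\<delta>>0. \<forall>z'\<in>{0..1} \<times> UNIV. dist z' z < \<delta> \<longrightarrow> dist (\<Gamma> (fst z') i (snd z')) (\<Gamma> (fst z) i (snd z)) < \<epsilon>"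
  proof (intro exI[of _ "min \<delta> (\<epsilon> / 2)"] conjI ballI impI)
    show "0 < min \<delta> (\<epsilon> / 2)" using \<delta>(1) \<epsilon> by simp
    fix z' :: "real \<times> real" assume z': "z' \<in> {0..1} \<times> UNIV" "dist z' z < min \<delta> (\<epsilon> / 2)"
    obtain v y where vy: "z' = (v, y)" "v \<in> {0..1}" using z' by auto
    have dv: "dist v u < \<delta>" and dy: "dist y x < \<epsilon> / 2"
      using z'(2) dist_fst_le[of z' z] dist_snd_le[of z' z] zx vy by auto
    have "constrained_loop 1 (s i) (\<Gamma> v i)"
      using \<Gamma> i vy unfolding thin_isotopy_def thin_link_def by blast
    then have "dist (\<Gamma> v i y) (\<Gamma> v i x) < \<epsilon> / 2"
      using constrained_loop_lipschitz[of "s i" "\<Gamma> v i" y x] dy by (simp add: dist_norm)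
    moreover have "dist (\<Gamma> v i x) (\<Gamma> u i x) < \<epsilon> / 2"
      using \<delta>(2)[OF vy(2)] dv \<epsilon> by (cases "v = u") auto
    ultimately show "dist (\<Gamma> (fst z') i (snd z')) (\<Gamma> (fst z) i (snd z)) < \<epsilon>"
      using dist_triangle_half_r[of "\<Gamma> v i x" "\<Gamma> v i y" \<epsilon> "\<Gamma> u i x"] zx vy by (simp add: dist_commute)
  qed
qed

lemma thin_link_far:
  assumes "thin_link d n s \<Gamma>" "i < n" "j < n" "i \<noteq> j"
  shows "norm (\<Gamma> i x - \<Gamma> j y) \<ge> d"
proof (rule ccontr)
  assume "\<not> ?thesis"
  then have lt: "norm (\<Gamma> i x - \<Gamma> j y) < d" by simp
  let ?m = "(1/2) *\<^sub>R (\<Gamma> i x + \<Gamma> j y)"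
  have "\<Gamma> i x - ?m = (1/2) *\<^sub>R (\<Gamma> i x - \<Gamma> j y)" "\<Gamma> j y - ?m = - ((1/2) *\<^sub>R (\<Gamma> i x - \<Gamma> j y))"
    by (simp_all add: vec_eq_iff field_simps)
  then have "dist (\<Gamma> i x) ?m < d / 2" "dist (\<Gamma> j y) ?m < d / 2"
    using lt by (simp_all add: dist_norm)
  then have "?m \<in> nbhd (d / 2) (range (\<Gamma> i)) \<inter> nbhd (d / 2) (range (\<Gamma> j))"
    unfolding nbhd_def by auto
  then show False using assms unfolding thin_link_def disjoint_family_on_def by blast
qed

text \<open>
  The set of times with a clasp is closed, because by periodicity the parameters can be taken in a
  compact box, and open by \<open>zero_persists\<close>; the unit interval is connected.
\<close>

lemma clasp_persists:
  fixes \<Gamma> :: "real \<Rightarrow> nat \<Rightarrow> curve" and s :: "nat \<Rightarrow> real"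
  assumes \<Gamma>: "thin_isotopy d 2 s \<Gamma>"
    and d: "1 \<le> d" "d < 2" and s0: "2 * pi \<le> s 0" "s 0 \<le> 2 * pi + 1/100000"
    and s1: "s 1 < 4 + 2 * pi * d"
    and start: "\<exists>X. clasped (s 0) (s 1) (\<Gamma> 0 0) (\<Gamma> 0 1) X"
    and u: "u \<in> {0..1}"
  shows "\<exists>X. clasped (s 0) (s 1) (\<Gamma> u 0) (\<Gamma> u 1) X"
proof -
  define P where "P = (\<lambda>u X. clasped (s 0) (s 1) (\<Gamma> u 0) (\<Gamma> u 1) X)"
  define U where "U = {u \<in> {0..1}. \<exists>X. P u X}"
  have link: "thin_link d 2 s (\<Gamma> u)" if "u \<in> {0..1}" for u
    using \<Gamma> that unfolding thin_isotopy_def by blast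
  have K: "constrained_loop 1 (s 0) (\<Gamma> u 0)" and A: "constrained_loop 1 (s 1) (\<Gamma> u 1)" if "u \<in> {0..1}" for u
    using link[OF that] unfolding thin_link_def by auto
  have spos: "0 < s 0" "0 < s 1" using K[of 0] A[of 0] constrained_loopD(1) by auto
  have cont: "continuous_on S (\<lambda>z. \<Gamma> (fst z) i (f z))"
    if "i < 2" "continuous_on S f" "S \<subseteq> {0..1} \<times> UNIV" for S :: "(real \<times> 'c::topological_space) set" and f i
  proof -
    have "continuous_on S (\<lambda>z. (fst z, f z))" using that by (intro continuous_intros)
    moreover have "(\<lambda>z. (fst z, f z)) ` S \<subseteq> {0..1} \<times> UNIV" using that by auto
    ultimately have "continuous_on S (\<lambda>z. \<Gamma> (fst (fst z, f z)) i (snd (fst z, f z)))"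
      by (rule continuous_on_compose2[OF thin_isotopy_continuous[OF \<Gamma> that(1)]])
    then show ?thesis by simp
  qed
  have cK: "continuous_on S (\<lambda>z. \<Gamma> (fst z) 0 (f z))" and cA: "continuous_on S (\<lambda>z. \<Gamma> (fst z) 1 (f z))"
    if "continuous_on S f" "S \<subseteq> {0..1} \<times> UNIV" for S :: "(real \<times> 'c::topological_space) set" and f
    using cont[OF _ that, of 0] cont[OF _ that, of 1] by auto
  let ?S = "{0..1} \<times> (UNIV :: (real \<times> real \<times> real \<times> real \<times> real \<times> real) set)"
  define M where "M = (\<lambda>z. clasp_map (\<Gamma> (fst z) 0) (\<Gamma> (fst z) 1) (snd z))"
  define I where "I = (\<lambda>z. case z of (u, t, t', a, b, c, e) \<Rightarrow>
      ((\<Gamma> u 1 a - \<Gamma> u 0 t) \<bullet> (\<Gamma> u 1 e - \<Gamma> u 0 t), (\<Gamma> u 1 b - \<Gamma> u 0 t') \<bullet> (\<Gamma> u 1 c - \<Gamma> u 0 t')))"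
  have cM: "continuous_on ?S M"
    unfolding M_def clasp_map_def split_beta
    by (intro continuous_intros continuous_on_cross cK cA subset_refl)
  have cI: "continuous_on ?S I"
    unfolding I_def split_beta by (intro continuous_intros cK cA subset_refl)
  define ordered where "ordered = {X. case X of (t, t', a, b, c, e) \<Rightarrow>
    t + pi \<le> t' \<and> t' \<le> t + s 0 - pi \<and> a \<le> b \<and> b \<le> c \<and> c \<le> e \<and> e \<le> a + s 1}"
  have PX: "P u X \<longleftrightarrow> X \<in> ordered \<and> M (u, X) = 0 \<and> I (u, X) \<in> {..0} \<times> {..0}" for u X
    by (cases X) (auto simp: P_def ordered_def M_def I_def clasped_def)
  have "closedin (top_of_set {0..1}) U"
  proof -
    define B where "B = {0..s 0} \<times> {0..2 * s 0} \<times> {0..s 1} \<times> {0..2 * s 1} \<times> {0..2 * s 1} \<times> {0..2 * s 1}"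
    have cB: "compact ({0..1::real} \<times> B)" unfolding B_def by (intro compact_Times compact_Icc)
    have cl_ordered: "closed ordered"
      unfolding ordered_def split_beta
      by (intro closed_Collect_conj closed_Collect_le continuous_intros)
    define Z where "Z = (({0..1} \<times> B) \<inter> M -` {0}) \<inter> (({0..1} \<times> B) \<inter> I -` ({..0} \<times> {..0})) \<inter> (UNIV \<times> ordered)"
    have ZX: "(u, X) \<in> Z \<longleftrightarrow> u \<in> {0..1} \<and> X \<in> B \<and> P u X" for u X
      unfolding Z_def PX by blast
    have "compact Z"
    proof -
      have sub: "{0..1} \<times> B \<subseteq> ?S" by auto
      have pre: "closed (({0..1} \<times> B) \<inter> M -` {0})" "closed (({0..1} \<times> B) \<inter> I -` ({..0} \<times> {..0}))"
        by (rule continuous_closed_preimage[OF continuous_on_subset[OF cM sub] compact_imp_closed[OF cB]], simp)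
           (rule continuous_closed_preimage[OF continuous_on_subset[OF cI sub] compact_imp_closed[OF cB]],
             intro closed_Times closed_atMost)
      have "closed ((UNIV :: real set) \<times> ordered)" by (intro closed_Times closed_UNIV cl_ordered)
      then have "closed Z" unfolding Z_def by (rule closed_Int[OF closed_Int[OF pre]])
      then have "compact (({0..1} \<times> B) \<inter> Z)" by (rule compact_Int_closed[OF cB])
      moreover have "({0..1} \<times> B) \<inter> Z = Z" by (auto simp: Z_def)
      ultimately show ?thesis by simp
    qed
    then have "compact (fst ` Z)" by (intro compact_continuous_image continuous_intros)
    moreover have "fst ` Z = U"
    proof (intro equalityI subsetI)
      fix u assume "u \<in> fst ` Z"
      then obtain X where "(u, X) \<in> Z" by (metis imageE prod.collapse)
      then show "u \<in> U" unfolding ZX U_def by blast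
    next
      fix u assume "u \<in> U"
      then obtain X where u: "u \<in> {0..1}" and X: "P u X" by (auto simp: U_def)
      obtain t t' a b c e where Xe: "X = (t, t', a, b, c, e)" by (metis prod.exhaust)
      define k where "k = - \<lfloor>t / s 0\<rfloor>"
      define l where "l = - \<lfloor>a / s 1\<rfloor>"
      have perK: "\<Gamma> u 0 (x + of_int k * s 0) = \<Gamma> u 0 x" for x
        by (rule periodic_int) (rule constrained_loopD(2)[OF K[OF u]])
      have perA: "\<Gamma> u 1 (x + of_int l * s 1) = \<Gamma> u 1 x" for x
        by (rule periodic_int) (rule constrained_loopD(2)[OF A[OF u]])
      let ?X = "(t + of_int k * s 0, t' + of_int k * s 0, a + of_int l * s 1, b + of_int l * s 1,
          c + of_int l * s 1, e + of_int l * s 1)"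
      have "P u ?X" using X unfolding P_def Xe clasped_def clasp_map_def prod.case perK perA by simp
      moreover have "?X \<in> B"
      proof -
        have 1: "0 \<le> t + of_int k * s 0" "t + of_int k * s 0 \<le> s 0"
          using floor_divide_lower[OF spos(1), of t] floor_divide_upper[OF spos(1), of t]
          by (simp_all add: k_def algebra_simps)
        have 2: "0 \<le> a + of_int l * s 1" "a + of_int l * s 1 \<le> s 1"
          using floor_divide_lower[OF spos(2), of a] floor_divide_upper[OF spos(2), of a]
          by (simp_all add: l_def algebra_simps)
        have "X \<in> ordered" using X PX by blast
        then have ord: "t + pi \<le> t'" "t' \<le> t + s 0 - pi" "a \<le> b" "b \<le> c" "c \<le> e" "e \<le> a + s 1"
          by (auto simp: Xe ordered_def)
        have "0 \<le> t' + of_int k * s 0" using 1(1) ord(1) pi_gt_zero by linarith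
        moreover have "t' + of_int k * s 0 \<le> 2 * s 0" using 1(2) ord(2) pi_gt_zero by linarith
        ultimately show ?thesis using 1 2 ord unfolding B_def by auto
      qed
      ultimately have "(u, ?X) \<in> Z" using u unfolding ZX by blast
      then show "u \<in> fst ` Z" by (metis fst_conv image_eqI)
    qed
    ultimately have "closed U" using compact_imp_closed by auto
    then show ?thesis by (intro closed_subset) (auto simp: U_def)
  qed
  moreover have "openin (top_of_set {0..1}) U"
    unfolding openin_euclidean_subtopology_iff
  proof (intro conjI ballI)
    show "U \<subseteq> {0..1}" by (auto simp: U_def)
    fix u0 assume "u0 \<in> U"
    then obtain X where u0: "u0 \<in> {0..1}" and X: "P u0 X" by (auto simp: U_def)
    obtain t t' a b c e where Xe: "X = (t, t', a, b, c, e)" by (metis prod.exhaust)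
    interpret clasp "s 0" "s 1" d "\<Gamma> u0 0" "\<Gamma> u0 1" t t' a b c e
    proof
      show "d \<le> norm (\<Gamma> u0 1 x - \<Gamma> u0 0 y)" for x y
        by (rule thin_link_far[OF link[OF u0]]) auto
    qed (use K[OF u0] A[OF u0] d s0 s1 X Xe P_def in auto)
    obtain D where D: "(clasp_map (\<Gamma> u0 0) (\<Gamma> u0 1) has_derivative D) (at X)" "inj D"
      using clasp_map_nondegenerate Xe by blast
    have zero: "clasp_map (\<Gamma> u0 0) (\<Gamma> u0 1) X = 0" using X by (simp add: P_def Xe clasped_def)
    define ordered_strict where "ordered_strict = {X. case X of (t, t', a, b, c, e) \<Rightarrow>
      t + pi < t' \<and> t' < t + s 0 - pi \<and> a < b \<and> b < c \<and> c < e \<and> e < a + s 1}"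
    have "open ordered_strict" unfolding ordered_strict_def split_beta
      by (intro open_Collect_conj open_Collect_less continuous_intros)
    moreover have "X \<in> ordered_strict" using strict_order by (simp add: ordered_strict_def Xe)
    ultimately obtain \<epsilon>1 where e1: "\<epsilon>1 > 0" "ball X \<epsilon>1 \<subseteq> ordered_strict" by (meson openE)
    have "I (u0, X) \<in> {..<0} \<times> {..<0}"
    proof -
      have "norm (\<Gamma> u0 1 x - \<Gamma> u0 0 y) > 0" for x y using far[of x y] d by linarith
      then show ?thesis using antipodal by (simp add: I_def Xe)
    qed
    moreover have "open ({..<0::real} \<times> {..<0::real})" by (intro open_Times) auto
    ultimately obtain \<rho> where rho: "\<rho> > 0" "ball (I (u0, X)) \<rho> \<subseteq> {..<0} \<times> {..<0}" by (meson openE)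
    obtain \<epsilon>2 where e2: "\<epsilon>2 > 0"
      "\<And>z. z \<in> ?S \<Longrightarrow> dist z (u0, X) < \<epsilon>2 \<Longrightarrow> dist (I z) (I (u0, X)) < \<rho>"
      using cI rho(1) u0 unfolding continuous_on_iff by (metis UNIV_I mem_Sigma_iff)
    define \<epsilon> where "\<epsilon> = min \<epsilon>1 \<epsilon>2 / 3"
    have eps: "\<epsilon> > 0" "\<epsilon> < \<epsilon>1" "2 * \<epsilon> < \<epsilon>2" using e1 e2 by (auto simp: \<epsilon>_def min_def)
    obtain r \<eta> where r: "0 < r" "r \<le> \<epsilon>" "0 < \<eta>"
      and pers: "\<And>G. continuous_on (cball X r) G \<Longrightarrow>
        (\<And>x. x \<in> cball X r \<Longrightarrow> norm (G x - clasp_map (\<Gamma> u0 0) (\<Gamma> u0 1) x) \<le> \<eta>) \<Longrightarrow> \<exists>x\<in>cball X r. G x = 0"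
      using zero_persists[OF D(1) zero D(2) eps(1)] by metis
    have "uniformly_continuous_on ({0..1} \<times> cball X r) M"
      by (intro compact_uniformly_continuous continuous_on_subset[OF cM] compact_Times compact_Icc compact_cball) auto
    then obtain \<delta>' where delta: "\<delta>' > 0"
      "\<And>z z'. z \<in> {0..1} \<times> cball X r \<Longrightarrow> z' \<in> {0..1} \<times> cball X r \<Longrightarrow> dist z' z < \<delta>' \<Longrightarrow> dist (M z') (M z) < \<eta>"
      unfolding uniformly_continuous_on_def using r(3) by metis
    show "\<exists>\<epsilon>>0. \<forall>u\<in>{0..1}. dist u u0 < \<epsilon> \<longrightarrow> u \<in> U"
    proof (intro exI[of _ "min \<delta>' \<epsilon>"] conjI ballI impI)
      show "0 < min \<delta>' \<epsilon>" using delta eps by simp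
      fix u assume u: "u \<in> {0..1}" "dist u u0 < min \<delta>' \<epsilon>"
      have "\<exists>x\<in>cball X r. clasp_map (\<Gamma> u 0) (\<Gamma> u 1) x = 0"
      proof (rule pers)
        have "continuous_on (cball X r) (\<lambda>x. M (u, x))"
          by (rule continuous_on_compose2[OF cM]) (use u in \<open>auto intro!: continuous_intros\<close>)
        then show "continuous_on (cball X r) (clasp_map (\<Gamma> u 0) (\<Gamma> u 1))" by (simp add: M_def)
        fix x assume x: "x \<in> cball X r"
        have "dist (u, x) (u0, x) < \<delta>'" using u by (simp add: dist_Pair_Pair)
        then have "dist (M (u, x)) (M (u0, x)) < \<eta>" using delta(2)[of "(u0, x)" "(u, x)"] u u0 x by auto
        then show "norm (clasp_map (\<Gamma> u 0) (\<Gamma> u 1) x - clasp_map (\<Gamma> u0 0) (\<Gamma> u0 1) x) \<le> \<eta>"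
          by (simp add: M_def dist_norm)
      qed
      then obtain Y where Y: "Y \<in> cball X r" "clasp_map (\<Gamma> u 0) (\<Gamma> u 1) Y = 0" by blast
      have dY: "dist Y X \<le> \<epsilon>" using Y(1) r by (simp add: dist_commute)
      then have "Y \<in> ordered_strict" using e1(2) eps by (auto simp: dist_commute)
      then have Y_ordered: "Y \<in> ordered" by (auto simp: ordered_def ordered_strict_def)
      have "dist (u, Y) (u0, X) \<le> dist u u0 + dist Y X"
        unfolding dist_Pair_Pair by (rule sqrt_sum_squares_le_sum) auto
      then have "dist (u, Y) (u0, X) < \<epsilon>2" using u dY eps by simp
      then have "dist (I (u, Y)) (I (u0, X)) < \<rho>" using e2(2)[of "(u, Y)"] u by auto
      then have "I (u, Y) \<in> ball (I (u0, X)) \<rho>" by (simp add: dist_commute)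
      then have "I (u, Y) \<in> {..<0} \<times> {..<0}" using rho(2) by blast
      then have "P u Y" using PX Y_ordered Y(2) by (auto simp: M_def)
      then show "u \<in> U" using u unfolding U_def by blast
    qed
  qed
  moreover have "U \<noteq> {}"
  proof -
    have "0 \<in> U" using start by (simp add: U_def P_def)
    then show ?thesis by blast
  qed
  moreover have "connected {0..1::real}" by simp
  ultimately have "U = {0..1}" using connected_clopen by blast
  then show ?thesis using u unfolding U_def P_def by blast
qed

text \<open>
  At a clasp the distance of the components is less than 3, so neighbourhoods of radius 3 meet.
\<close>

lemma clasped_not_disentangled:
  assumes d: "1 \<le> d" "d < 2" and s0: "2 * pi \<le> s 0" "s 0 \<le> 2 * pi + 1/100000"
    and s1: "s 1 < 4 + 2 * pi * d" and start: "clasped (s 0) (s 1) (L 0) (L 1) X"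
  shows "\<not> disentangled_by_thin_isotopy d 2 s L"
proof
  assume "disentangled_by_thin_isotopy d 2 s L"
  then have "\<exists>\<Gamma>. thin_isotopy d 2 s \<Gamma> \<and> (\<forall>i<2. \<Gamma> 0 i = L i) \<and>
      disjoint_family_on (\<lambda>i. nbhd 3 (range (\<Gamma> 1 i))) {..<2}"
    unfolding disentangled_by_thin_isotopy_def by (metis zero_less_numeral)
  then obtain \<Gamma> where \<Gamma>: "thin_isotopy d 2 s \<Gamma>" "\<And>i. i < 2 \<Longrightarrow> \<Gamma> 0 i = L i"
    and disj: "disjoint_family_on (\<lambda>i. nbhd 3 (range (\<Gamma> 1 i))) {..<2}" by blast
  have "\<exists>X. clasped (s 0) (s 1) (\<Gamma> 0 0) (\<Gamma> 0 1) X"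
    using start \<Gamma>(2)[of 0] \<Gamma>(2)[of 1] by (intro exI[of _ X]) simp
  from clasp_persists[OF \<Gamma>(1) d s0 s1 this, of 1]
  obtain X where X: "clasped (s 0) (s 1) (\<Gamma> 1 0) (\<Gamma> 1 1) X" by auto
  obtain t t' a b c e where Xe: "X = (t, t', a, b, c, e)" by (metis prod.exhaust)
  have link: "thin_link d 2 s (\<Gamma> 1)" using \<Gamma>(1) unfolding thin_isotopy_def by simp
  interpret clasp "s 0" "s 1" d "\<Gamma> 1 0" "\<Gamma> 1 1" t t' a b c e
  proof
    show "constrained_loop 1 (s 0) (\<Gamma> 1 0)" "constrained_loop 1 (s 1) (\<Gamma> 1 1)"
      using link unfolding thin_link_def by auto
    show "d \<le> norm (\<Gamma> 1 1 x - \<Gamma> 1 0 y)" for x y by (rule thin_link_far[OF link]) auto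
  qed (use d s0 s1 X Xe in auto)
  have "dist (\<Gamma> 1 1 b) (\<Gamma> 1 0 t') < 3" using r_le(1)[unfolded r_def] d unfolding dist_norm by linarith
  then have "\<Gamma> 1 0 t' \<in> nbhd 3 (range (\<Gamma> 1 0)) \<inter> nbhd 3 (range (\<Gamma> 1 1))"
    unfolding nbhd_def by (auto intro: exI[of _ t'] exI[of _ b])
  moreover have "nbhd 3 (range (\<Gamma> 1 0)) \<inter> nbhd 3 (range (\<Gamma> 1 1)) = {}"
    using disj unfolding disjoint_family_on_def by (metis lessThan_iff one_less_numeral_iff semiring_norm(76) zero_less_numeral zero_neq_one)
  ultimately show False by blast
qed

section \<open>Centrally symmetric loops made of two arcs\<close>

lemma has_vector_derivative_glue:
  fixes p q :: "real \<Rightarrow> 'a::real_normed_vector"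
  assumes "(p has_vector_derivative D) (at a)" "(q has_vector_derivative D) (at a)" "p a = q a"
  shows "((\<lambda>x. if x \<le> a then p x else q x) has_vector_derivative D) (at a)"
proof -
  have "((\<lambda>x. if x \<in> {..a} then p x else q x) has_vector_derivative
      (if a \<in> {..a} then D else D)) (at a within UNIV)"
    by (rule has_vector_derivative_If_within_closures[where f' = "\<lambda>_. D" and g' = "\<lambda>_. D" and T = "{a<..}"])
       (use assms in \<open>auto intro: has_vector_derivative_at_within\<close>)
  then show ?thesis by simp
qed

text \<open>
  A centrally symmetric closed curve is determined by half a period; here that half consists of
  two smooth arcs, \<open>f\<^sub>1\<close> on \<open>[0, l]\<close> and \<open>f\<^sub>2\<close> on \<open>[l, h]\<close>.
\<close>

definition antiperiodic_ext :: "real \<Rightarrow> real \<Rightarrow> (real \<Rightarrow> 'a::real_vector) \<Rightarrow> (real \<Rightarrow> 'a) \<Rightarrow> real \<Rightarrow> 'a"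
  where "antiperiodic_ext h l f1 f2 t =
    (let n = \<lfloor>t / h\<rfloor>; \<tau> = t - of_int n * h
     in (if even n then 1 else -1) *\<^sub>R (if \<tau> \<le> l then f1 \<tau> else f2 \<tau>))"

lemma antiperiodic_ext_base:
  assumes "0 \<le> t" "t < h"
  shows "antiperiodic_ext h l f1 f2 t = (if t \<le> l then f1 t else f2 t)"
proof -
  have "\<lfloor>t / h\<rfloor> = 0" using assms by (simp add: floor_eq_iff)
  then show ?thesis by (simp add: antiperiodic_ext_def)
qed

lemma antiperiodic_ext_shift:
  assumes "h > 0"
  shows "antiperiodic_ext h l f1 f2 (t + of_int n * h) = (if even n then 1 else -1) *\<^sub>R antiperiodic_ext h l f1 f2 t"
proof -
  have "(t + of_int n * h) / h = t / h + of_int n" using assms by (simp add: field_simps)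
  then have "\<lfloor>(t + of_int n * h) / h\<rfloor> = \<lfloor>t / h\<rfloor> + n" by simp
  then show ?thesis by (simp add: antiperiodic_ext_def Let_def algebra_simps)
qed

lemma antiperiodic_ext_half: "h > 0 \<Longrightarrow> antiperiodic_ext h l f1 f2 (t + h) = - antiperiodic_ext h l f1 f2 t"
  using antiperiodic_ext_shift[of h l f1 f2 t 1] by simp

lemma antiperiodic_reduce:
  assumes "h > 0"
  obtains n :: int and \<tau> :: real where "t = \<tau> + of_int n * h" "0 \<le> \<tau>" "\<tau> < h"
proof (rule that)
  show "t = (t - of_int \<lfloor>t / h\<rfloor> * h) + of_int \<lfloor>t / h\<rfloor> * h" by simp
  show "0 \<le> t - of_int \<lfloor>t / h\<rfloor> * h" "t - of_int \<lfloor>t / h\<rfloor> * h < h"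
    using floor_divide_lower[OF assms, of t] floor_divide_upper[OF assms, of t] by (simp_all add: algebra_simps)
qed

lemma has_vector_derivative_shift:
  assumes "(f has_vector_derivative D) (at (t + c) within (\<lambda>x. x + c) ` S)"
  shows "((\<lambda>x. f (x + c)) has_vector_derivative D) (at t within S)"
proof -
  have "((f \<circ> (\<lambda>x. x + c)) has_vector_derivative (1 *\<^sub>R D)) (at t within S)"
    by (rule vector_diff_chain_within) (use assms in \<open>auto intro!: derivative_eq_intros\<close>)
  then show ?thesis by (simp add: o_def)
qed

locale two_arcs =
  fixes h l :: real and f1 f2 g1 g2 :: "real \<Rightarrow> 'a::real_normed_vector"
  assumes hl: "0 < l" "l < h"
    and f1: "\<And>x. (f1 has_vector_derivative g1 x) (at x)" and f2: "\<And>x. (f2 has_vector_derivative g2 x) (at x)"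
    and match: "f1 l = f2 l" "f2 h = - f1 0" and match': "g1 l = g2 l" "g2 h = - g1 0"
begin

abbreviation "F \<equiv> antiperiodic_ext h l f1 f2"
abbreviation "G \<equiv> antiperiodic_ext h l g1 g2"

lemma h_pos: "h > 0" using hl by simp

lemma base_derivative:
  assumes t: "0 \<le> t" "t < h"
  shows "(F has_vector_derivative G t) (at t)"
proof -
  have G: "G t = (if t \<le> l then g1 t else g2 t)" by (rule antiperiodic_ext_base[OF t])
  consider "t = 0" | "0 < t" "t < l" | "t = l" | "l < t" using t by linarith
  then show ?thesis
  proof cases
    case 1
    have q: "((\<lambda>x. - f2 (x + h)) has_vector_derivative g1 0) (at 0)"
    proof -
      have "((\<lambda>x. f2 (x + h)) has_vector_derivative g2 (0 + h)) (at 0)"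
        by (rule has_vector_derivative_shift) (use f2 in \<open>auto intro: has_vector_derivative_at_within\<close>)
      then show ?thesis using match' has_vector_derivative_minus by fastforce
    qed
    have "((\<lambda>x. if x \<le> 0 then - f2 (x + h) else f1 x) has_vector_derivative g1 0) (at 0)"
      by (rule has_vector_derivative_glue[OF q f1]) (simp add: match)
    moreover have "F x = (if x \<le> 0 then - f2 (x + h) else f1 x)" if "x \<in> {l - h<..<l}" for x
    proof (cases "x < 0")
      case True
      have "F x = - F (x + h)" using antiperiodic_ext_half[OF h_pos, of l f1 f2 x] by simp
      also have "F (x + h) = f2 (x + h)" using True that hl by (subst antiperiodic_ext_base) auto
      finally show ?thesis using True by simp
    next
      case False
      then have "F x = f1 x" using that hl by (subst antiperiodic_ext_base) auto
      then show ?thesis using False match by (cases "x = 0") auto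
    qed
    ultimately have "(F has_vector_derivative g1 0) (at 0)"
      using has_vector_derivative_transform_within_open[of _ "g1 0" 0 "{l - h<..<l}" F] hl by force
    then show ?thesis using 1 G hl by simp
  next
    case 2
    have "(F has_vector_derivative g1 t) (at t)"
      by (rule has_vector_derivative_transform_within_open[OF f1, where S = "{0<..<l}"])
         (use 2 hl in \<open>auto simp: antiperiodic_ext_base\<close>)
    then show ?thesis using 2 G by simp
  next
    case 3
    have "((\<lambda>x. if x \<le> l then f1 x else f2 x) has_vector_derivative g1 l) (at l)"
      by (rule has_vector_derivative_glue) (use f1[of l] f2[of l] match match' in simp_all)
    then have "(F has_vector_derivative g1 l) (at l)"
      by (rule has_vector_derivative_transform_within_open[where S = "{0<..<h}"])
         (use hl in \<open>auto simp: antiperiodic_ext_base\<close>)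
    then show ?thesis using 3 G by simp
  next
    case 4
    have "(F has_vector_derivative g2 t) (at t)"
      by (rule has_vector_derivative_transform_within_open[OF f2, where S = "{l<..<h}"])
         (use 4 t hl in \<open>auto simp: antiperiodic_ext_base\<close>)
    then show ?thesis using 4 G by simp
  qed
qed

lemma derivative: "(F has_vector_derivative G t) (at t)"
proof -
  obtain n \<tau> where t: "t = \<tau> + of_int n * h" "0 \<le> \<tau>" "\<tau> < h" using antiperiodic_reduce[OF h_pos] by blast
  define \<sigma> :: real where "\<sigma> = (if even n then 1 else -1)"
  have F: "\<sigma> *\<^sub>R F (x + - (of_int n * h)) = F x" for x
    using antiperiodic_ext_shift[OF h_pos, of l f1 f2 "x - of_int n * h" n] by (simp add: \<sigma>_def)
  have "((\<lambda>x. F (x + - (of_int n * h))) has_vector_derivative G \<tau>) (at t)"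
    by (rule has_vector_derivative_shift)
       (use base_derivative[OF t(2,3)] t(1) in \<open>auto intro: has_vector_derivative_at_within\<close>)
  then have "((\<lambda>x. \<sigma> *\<^sub>R F (x + - (of_int n * h))) has_vector_derivative \<sigma> *\<^sub>R G \<tau>) (at t)"
    by (auto intro!: derivative_eq_intros)
  moreover have "\<sigma> *\<^sub>R G \<tau> = G t"
    unfolding t(1) \<sigma>_def antiperiodic_ext_shift[OF h_pos] ..
  ultimately show ?thesis by (simp only: F)
qed

end

locale thin_arcs = two_arcs h l f1 f2 g1 g2 for h l :: real and f1 f2 g1 g2 :: "real \<Rightarrow> real^3" +
  fixes k1 k2 :: "real \<Rightarrow> real^3" and i j :: "real^3" and X :: real
  assumes g1: "\<And>x. (g1 has_vector_derivative k1 x) (at x)" and g2: "\<And>x. (g2 has_vector_derivative k2 x) (at x)"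
    and k: "continuous_on UNIV k1" "continuous_on UNIV k2"
    and unit: "\<And>x. norm (g1 x) = 1" "\<And>x. norm (g2 x) = 1"
    and curv: "\<And>x. norm (k1 x) \<le> 1" "\<And>x. norm (k2 x) \<le> 1"
    and X: "0 \<le> X" and left: "\<And>x. x \<in> {0..l} \<Longrightarrow> \<bar>f1 x \<bullet> i\<bar> \<le> X" "\<And>x. x \<in> {0..l} \<Longrightarrow> f1 x \<bullet> j > 0"
    and right: "\<And>x. x \<in> {l<..<h} \<Longrightarrow> f2 x \<bullet> i > X"
    and inj: "inj_on f1 {0..l}" "inj_on f2 {l<..<h}"
begin

lemma norm_G: "norm (G t) = 1"
  by (simp add: antiperiodic_ext_def Let_def unit)

lemma tangent_F: "tangent F = G"
  unfolding tangent_def[abs_def] using derivative vector_derivative_at by blast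

lemma inj_F: "inj_on F {0..<2 * h}"
proof (rule inj_onI)
  fix x y assume x: "x \<in> {0..<2 * h}" and y: "y \<in> {0..<2 * h}" and eq: "F x = F y"
  define side where "side = (\<lambda>z :: real^3. (\<bar>z \<bullet> i\<bar> \<le> X, if \<bar>z \<bullet> i\<bar> \<le> X then z \<bullet> j > 0 else z \<bullet> i > 0))"
  have cases: "(0 \<le> z \<and> z \<le> l \<and> F z = f1 z \<and> side (F z) = (True, True)) \<or>
      (l < z \<and> z < h \<and> F z = f2 z \<and> side (F z) = (False, True)) \<or>
      (h \<le> z \<and> z \<le> h + l \<and> F z = - f1 (z - h) \<and> side (F z) = (True, False)) \<or>
      (h + l < z \<and> z < 2 * h \<and> F z = - f2 (z - h) \<and> side (F z) = (False, False))" if z: "z \<in> {0..<2 * h}" for z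
  proof (cases "z < h")
    case True
    then have "F z = (if z \<le> l then f1 z else f2 z)" using z by (intro antiperiodic_ext_base) auto
    then show ?thesis using True z left[of z] right[of z] X by (cases "z \<le> l") (auto simp: side_def)
  next
    case False
    have "F z = - F (z - h)" using antiperiodic_ext_half[OF h_pos, of l f1 f2 "z - h"] by simp
    moreover have "F (z - h) = (if z - h \<le> l then f1 (z - h) else f2 (z - h))"
      using z False by (intro antiperiodic_ext_base) auto
    ultimately show ?thesis
      using False z left[of "z - h"] right[of "z - h"] X
      by (cases "z - h \<le> l") (auto simp: side_def less_imp_le not_less order.asym)
  qed
  have "side (F x) = side (F y)" using eq by simp
  moreover have "x = y" if "side (F x) = (True, True)" "side (F y) = (True, True)"
  proof (rule inj_onD[OF inj(1)])
    show "f1 x = f1 y" "x \<in> {0..l}" "y \<in> {0..l}" using cases[OF x] cases[OF y] that eq by auto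
  qed
  moreover have "x = y" if "side (F x) = (False, True)" "side (F y) = (False, True)"
  proof (rule inj_onD[OF inj(2)])
    show "f2 x = f2 y" "x \<in> {l<..<h}" "y \<in> {l<..<h}" using cases[OF x] cases[OF y] that eq by auto
  qed
  moreover have "x - h = y - h" if "side (F x) = (True, False)" "side (F y) = (True, False)"
  proof (rule inj_onD[OF inj(1)])
    show "f1 (x - h) = f1 (y - h)" "x - h \<in> {0..l}" "y - h \<in> {0..l}"
      using cases[OF x] cases[OF y] that eq by auto
  qed
  moreover have "x - h = y - h" if "side (F x) = (False, False)" "side (F y) = (False, False)"
  proof (rule inj_onD[OF inj(2)])
    show "f2 (x - h) = f2 (y - h)" "x - h \<in> {l<..<h}" "y - h \<in> {l<..<h}"
      using cases[OF x] cases[OF y] that eq by auto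
  qed
  ultimately show "x = y" by (cases "side (F x)") (metis (full_types) add_right_cancel diff_add_cancel)
qed

lemma piece_C1:
  assumes "open I" "t \<in> I" "\<And>x. x \<in> I \<Longrightarrow> G x = q x" "\<And>x. (q has_vector_derivative k x) (at x)" "continuous_on UNIV k"
  shows "G differentiable at t \<and> isCont (\<lambda>x. vector_derivative G (at x)) t"
proof -
  have d: "(G has_vector_derivative k x) (at x)" if "x \<in> I" for x
    by (rule has_vector_derivative_transform_within_open[OF assms(4) assms(1) that]) (use assms(3) in auto)
  have "isCont k t" using assms(5) by (simp add: continuous_on_eq_continuous_at)
  moreover have ev: "\<forall>\<^sub>F x in nhds t. k x = vector_derivative G (at x)"
    using assms(1,2) d vector_derivative_at by (fastforce simp: eventually_nhds)
  ultimately have "isCont (\<lambda>x. vector_derivative G (at x)) t" using isCont_cong[OF ev] by blast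
  then show ?thesis using d[OF assms(2)] differentiableI_vector by blast
qed

lemma isCont_G: "isCont G t"
proof -
  have g: "continuous_on S g1" "continuous_on S g2" for S
    using g1 g2 has_vector_derivative_continuous by (blast intro: continuous_at_imp_continuous_on)+
  have 1: "continuous_on {0..h} G"
  proof -
    have "continuous_on {0..h} (\<lambda>x. if x \<le> l then g1 x else g2 x)"
      by (rule continuous_on_cases_le) (auto intro: g continuous_intros simp: match')
    moreover have "(if x \<le> l then g1 x else g2 x) = G x" if "x \<in> {0..h}" for x
    proof (cases "x = h")
      case True
      have "G (0 + h) = - G 0" by (rule antiperiodic_ext_half[OF h_pos])
      moreover have "G 0 = g1 0" using hl by (subst antiperiodic_ext_base) auto
      ultimately show ?thesis using True hl match' by simp
    qed (use that in \<open>auto simp: antiperiodic_ext_base\<close>)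
    ultimately show ?thesis by (rule continuous_on_eq)
  qed
  have 2: "continuous_on {-h..0} G"
  proof -
    have "continuous_on {-h..0} (\<lambda>x. - G (x + h))"
      by (intro continuous_intros continuous_on_compose2[OF 1]) auto
    moreover have "- G (x + h) = G x" for x using antiperiodic_ext_half[OF h_pos, of l g1 g2 x] by simp
    ultimately show ?thesis by (simp only:)
  qed
  have "{-h..0} \<union> {0..h} = {-h..h}" using h_pos by auto
  then have 3: "continuous_on {-h..h} G" using continuous_on_closed_Un[OF _ _ 2 1] by simp
  obtain n \<tau> where t: "t = \<tau> + of_int n * h" "0 \<le> \<tau>" "\<tau> < h" using antiperiodic_reduce[OF h_pos] by blast
  have "isCont G \<tau>" by (rule continuous_on_interior[OF 3]) (use t h_pos in auto)
  then have "isCont G (t + - (of_int n * h))" using t(1) by simp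
  then have "isCont (\<lambda>x. G (x + - (of_int n * h))) t"
    by (rule isCont_o2[rotated]) (intro continuous_intros)
  then have "isCont (\<lambda>x. (if even n then 1 else -1) *\<^sub>R G (x + - (of_int n * h))) t"
    by (intro continuous_intros)
  moreover have "(if even n then 1 else -1) *\<^sub>R G (x + - (of_int n * h)) = G x" for x
    using antiperiodic_ext_shift[OF h_pos, of l g1 g2 "x - of_int n * h" n] by simp
  ultimately show ?thesis by (simp only:)
qed

lemma piecewise_C1_G: "G piecewise_C1_differentiable_on {0..2 * h}"
proof -
  let ?E = "{0, l, h, h + l, 2 * h}"
  have "G differentiable at t \<and> isCont (\<lambda>x. vector_derivative G (at x)) t" if t: "t \<in> {0..2 * h} - ?E" for t
  proof -
    have G2: "G x = - (if x - h \<le> l then g1 (x - h) else g2 (x - h))" if "h \<le> x" "x < 2 * h" for x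
    proof -
      have "G x = - G (x - h)" using antiperiodic_ext_half[OF h_pos, of l g1 g2 "x - h"] by simp
      then show ?thesis using that by (simp add: antiperiodic_ext_base)
    qed
    have neg: "((\<lambda>x. - q (x - h)) has_vector_derivative - k (x - h)) (at x)"
      if "\<And>x. (q has_vector_derivative k x) (at x)" for q k :: "real \<Rightarrow> real^3" and x
    proof -
      have "(q has_vector_derivative k (x - h)) (at (x + - h) within range (\<lambda>x. x + - h))"
        using has_vector_derivative_at_within[OF that[of "x - h"]] by simp
      from has_vector_derivative_minus[OF has_vector_derivative_shift[OF this]] show ?thesis by simp
    qed
    have negc: "continuous_on UNIV (\<lambda>x. - k (x - h))" if "continuous_on UNIV k" for k :: "real \<Rightarrow> real^3"
      by (intro continuous_intros continuous_on_compose2[OF that]) auto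
    consider "t \<in> {0<..<l}" | "t \<in> {l<..<h}" | "t \<in> {h<..<h + l}" | "t \<in> {h + l<..<2 * h}"
      using t by fastforce
    then show ?thesis
    proof cases
      case 1
      show ?thesis by (rule piece_C1[OF _ 1 _ g1 k(1)]) (use hl in \<open>auto simp: antiperiodic_ext_base\<close>)
    next
      case 2
      show ?thesis by (rule piece_C1[OF _ 2 _ g2 k(2)]) (use hl in \<open>auto simp: antiperiodic_ext_base\<close>)
    next
      case 3
      show ?thesis by (rule piece_C1[OF _ 3 _ neg[OF g1] negc[OF k(1)]]) (use hl in \<open>auto simp: G2\<close>)
    next
      case 4
      show ?thesis by (rule piece_C1[OF _ 4 _ neg[OF g2] negc[OF k(2)]]) (use hl in \<open>auto simp: G2\<close>)
    qed
  qed
  then have "G C1_differentiable_on {0..2 * h} - ?E"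
    unfolding C1_differentiable_on_eq by (blast intro: continuous_at_imp_continuous_on)
  then show ?thesis
    unfolding piecewise_C1_differentiable_on_def using isCont_G
    by (intro conjI exI[of _ ?E] continuous_at_imp_continuous_on) auto
qed

text \<open>
  At a junction of the arcs the second derivative may or may not exist; if it does, it agrees with the
  derivative from the right, which is always given by one of the two arcs.
\<close>

lemma curvature_le:
  assumes "(G has_vector_derivative D) (at t)"
  shows "norm D \<le> 1"
proof -
  obtain n \<tau> where t: "t = \<tau> + of_int n * h" "0 \<le> \<tau>" "\<tau> < h" using antiperiodic_reduce[OF h_pos] by blast
  define \<sigma> :: real where "\<sigma> = (if even n then 1 else -1)"
  have G: "G x = \<sigma> *\<^sub>R G (x - of_int n * h)" for x
    using antiperiodic_ext_shift[OF h_pos, of l g1 g2 "x - of_int n * h" n] by (simp add: \<sigma>_def)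
  have right_derivative: "norm D \<le> 1"
    if q: "(q has_vector_derivative k) (at \<tau>)" "norm k \<le> 1" and e: "\<tau> < \<epsilon>" "\<And>x. \<tau> \<le> x \<Longrightarrow> x < \<epsilon> \<Longrightarrow> G x = q x" for q k \<epsilon>
  proof -
    let ?I = "{t..(t + (\<epsilon> + of_int n * h)) / 2}"
    have lt: "t < (t + (\<epsilon> + of_int n * h)) / 2" using e t(1) by simp
    have "((\<lambda>x. q (x + - (of_int n * h))) has_vector_derivative k) (at t within ?I)"
      by (rule has_vector_derivative_shift) (use q t in \<open>auto intro: has_vector_derivative_at_within\<close>)
    then have "((\<lambda>x. \<sigma> *\<^sub>R q (x + - (of_int n * h))) has_vector_derivative \<sigma> *\<^sub>R k) (at t within ?I)"
      by (auto intro!: derivative_eq_intros)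
    moreover have "G x = \<sigma> *\<^sub>R q (x + - (of_int n * h))" if "x \<in> ?I" for x
    proof -
      have "2 * x \<le> t + (\<epsilon> + of_int n * h)" "t \<le> x" using that by auto
      then have "\<tau> \<le> x - of_int n * h" "x - of_int n * h < \<epsilon>" using t(1) e(1) by linarith+
      then show ?thesis using e(2) by (subst G) simp
    qed
    moreover have tI: "t \<in> ?I" using lt by simp
    ultimately have "(G has_vector_derivative \<sigma> *\<^sub>R k) (at t within ?I)"
      using has_vector_derivative_transform[of t ?I G "\<lambda>x. \<sigma> *\<^sub>R q (x + - (of_int n * h))"] by blast
    moreover have "at t within ?I \<noteq> bot"
      unfolding at_within_Icc_at_right[OF lt] using trivial_limit_at_right_real[of t] by simp
    ultimately have "D = \<sigma> *\<^sub>R k"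
      using vector_derivative_unique_within[OF _ has_vector_derivative_at_within[OF assms]] by blast
    then show ?thesis using q(2) by (auto simp: \<sigma>_def)
  qed
  show ?thesis
  proof (cases "\<tau> < l")
    case True
    show ?thesis
      by (rule right_derivative[OF g1 curv(1) True]) (use t hl in \<open>auto simp: antiperiodic_ext_base\<close>)
  next
    case False
    have "G x = g2 x" if "\<tau> \<le> x" "x < h" for x
      using that False hl match'(1) by (cases "x = l") (auto simp: antiperiodic_ext_base)
    then show ?thesis by (rule right_derivative[OF g2 curv(2) t(3)])
  qed
qed

theorem constrained: "constrained_loop 1 (2 * h) F"
  unfolding constrained_loop_def tangent_F
proof (intro conjI allI impI)
  show "0 < 2 * h" using h_pos by simp
  show "F (t + 2 * h) = F t" for t
    using antiperiodic_ext_shift[OF h_pos, of l f1 f2 t 2] by simp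
  have "vector_derivative F (at x) = G x" for x using derivative vector_derivative_at by blast
  then show "F C1_differentiable_on UNIV"
    unfolding C1_differentiable_on_eq using derivative isCont_G
    by (auto intro: differentiableI_vector continuous_at_imp_continuous_on)
qed (use inj_F norm_G piecewise_C1_G curvature_le in auto)

end

section \<open>Stadiums and dumbbells\<close>

lemma norm_orthonormal_pair:
  fixes i j :: "'a::real_inner"
  assumes "i \<bullet> i = 1" "j \<bullet> j = 1" "i \<bullet> j = 0"
  shows "norm (a *\<^sub>R i + b *\<^sub>R j) = sqrt (a\<^sup>2 + b\<^sup>2)"
  unfolding norm_eq_sqrt_inner using assms
  by (simp add: inner_add_left inner_add_right inner_commute power2_eq_square)

lemma sin_gt_minus_sin:
  assumes "- \<alpha> < \<beta>" "\<beta> < pi + \<alpha>" "0 \<le> \<alpha>" "\<alpha> < pi / 2"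
  shows "sin \<beta> > - sin \<alpha>"
proof (cases "\<beta> \<le> pi / 2")
  case True
  then have "sin (- \<alpha>) < sin \<beta>" using assms by (intro sin_monotone_2pi) auto
  then show ?thesis by simp
next
  case False
  then have "sin (- \<alpha>) < sin (pi - \<beta>)" using assms by (intro sin_monotone_2pi) auto
  then show ?thesis by simp
qed

lemma has_vector_derivative_pair:
  assumes "(x has_real_derivative x') (at t)" "(y has_real_derivative y') (at t)"
  shows "((\<lambda>t. x t *\<^sub>R i + y t *\<^sub>R j) has_vector_derivative x' *\<^sub>R i + y' *\<^sub>R j) (at t)"
  using assms by (auto intro!: derivative_eq_intros simp: has_real_derivative_iff_has_vector_derivative)

text \<open>
  Half of the curve runs along the graph \<open>(x, y)\<close> from \<open>(-X, \<rho> cos \<alpha>)\<close> to \<open>(X, \<rho> cos \<alpha>)\<close> and then around a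
  circular cap of radius \<open>\<rho>\<close> and centre \<open>\<kappa>\<close>; with \<open>\<alpha> = 0\<close> and a straight graph this is a stadium, with
  \<open>\<alpha> > 0\<close> and a concave graph a dumbbell.
\<close>

locale capped_loop =
  fixes i j :: "real^3" and l \<kappa> \<rho> \<alpha> :: real and x y x' y' x'' y'' N :: "real \<Rightarrow> real"
  assumes ij: "i \<bullet> i = 1" "j \<bullet> j = 1" "i \<bullet> j = 0"
    and l: "0 < l" and \<rho>: "1 \<le> \<rho>" and \<alpha>: "0 \<le> \<alpha>" "\<alpha> < pi / 2" and X0: "0 \<le> \<kappa> - \<rho> * sin \<alpha>"
    and dx: "\<And>t. (x has_real_derivative x' t) (at t)" "\<And>t. (x' has_real_derivative x'' t) (at t)"
    and dy: "\<And>t. (y has_real_derivative y' t) (at t)" "\<And>t. (y' has_real_derivative y'' t) (at t)"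
    and cont: "continuous_on UNIV x''" "continuous_on UNIV y''"
    and unit1: "\<And>t. (x' t)\<^sup>2 + (y' t)\<^sup>2 = 1" and curv1: "\<And>t. (x'' t)\<^sup>2 + (y'' t)\<^sup>2 \<le> 1"
    and start: "x 0 = - (\<kappa> - \<rho> * sin \<alpha>)" "y 0 = \<rho> * cos \<alpha>" "x' 0 = cos \<alpha>" "y' 0 = - sin \<alpha>"
    and finish: "x l = \<kappa> - \<rho> * sin \<alpha>" "y l = \<rho> * cos \<alpha>" "x' l = cos \<alpha>" "y' l = sin \<alpha>"
    and bound: "\<And>t. t \<in> {0..l} \<Longrightarrow> \<bar>x t\<bar> \<le> \<kappa> - \<rho> * sin \<alpha>" and ypos: "\<And>t. t \<in> {0..l} \<Longrightarrow> y t > 0"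
    and inj_x: "inj_on x {0..l}"
    and graph: "\<And>t. t \<in> {0..l} \<Longrightarrow> y t = N (x t)" and even_N: "\<And>u. N (- u) = N u"
    and cont_N: "continuous_on {- (\<kappa> - \<rho> * sin \<alpha>)..\<kappa> - \<rho> * sin \<alpha>} N"
begin

definition "X = \<kappa> - \<rho> * sin \<alpha>"
definition "R = \<kappa> + \<rho>"
definition "h = l + \<rho> * (pi + 2 * \<alpha>)"
definition "\<beta> t = (t - l) / \<rho> - \<alpha>"
definition "f1 t = x t *\<^sub>R i + y t *\<^sub>R j"
definition "f2 t = (\<kappa> + \<rho> * sin (\<beta> t)) *\<^sub>R i + (\<rho> * cos (\<beta> t)) *\<^sub>R j"
definition "g1 t = x' t *\<^sub>R i + y' t *\<^sub>R j"
definition "g2 t = cos (\<beta> t) *\<^sub>R i + (- sin (\<beta> t)) *\<^sub>R j"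
definition "k1 t = x'' t *\<^sub>R i + y'' t *\<^sub>R j"
definition "k2 t = (- sin (\<beta> t) / \<rho>) *\<^sub>R i + (- cos (\<beta> t) / \<rho>) *\<^sub>R j"

lemma coordinates: "(a *\<^sub>R i + b *\<^sub>R j) \<bullet> i = a" "(a *\<^sub>R i + b *\<^sub>R j) \<bullet> j = b"
  using ij inner_commute[of j i] by (simp_all add: inner_add_left)

lemma continuous_x: "continuous_on S x"
  using dx(1) DERIV_isCont by (blast intro: continuous_at_imp_continuous_on)

lemma \<beta>_deriv: "(\<beta> has_real_derivative 1 / \<rho>) (at t)"
  unfolding \<beta>_def[abs_def] using \<rho> by (auto intro!: derivative_eq_intros)

lemma \<beta>_ends: "\<beta> l = - \<alpha>" "\<beta> h = pi + \<alpha>"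
  using \<rho> by (simp_all add: \<beta>_def h_def field_simps)

lemma \<beta>_range: "t \<in> {l<..<h} \<longleftrightarrow> \<beta> t \<in> {- \<alpha><..<pi + \<alpha>}"
  using \<rho> by (auto simp: \<beta>_def h_def field_simps)

lemma cos_\<alpha>: "cos \<alpha> > 0" using \<alpha> by (intro cos_gt_zero_pi) auto

lemma sin_\<alpha>: "0 \<le> sin \<alpha>" "sin \<alpha> < 1"
proof -
  show "0 \<le> sin \<alpha>" using \<alpha> by (intro sin_ge_zero) auto
  have "sin \<alpha> < sin (pi / 2)" using \<alpha> by (intro sin_monotone_2pi) auto
  then show "sin \<alpha> < 1" by simp
qed

lemma l_less_h: "l < h" using \<rho> \<alpha> by (simp add: h_def add_pos_nonneg)

lemma \<beta>_dist: "t \<in> {l<..<h} \<Longrightarrow> t' \<in> {l<..<h} \<Longrightarrow> sin (\<beta> t) = sin (\<beta> t') \<Longrightarrow> cos (\<beta> t) = cos (\<beta> t') \<Longrightarrow> t = t'"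
proof -
  assume t: "t \<in> {l<..<h}" "t' \<in> {l<..<h}" and eq: "sin (\<beta> t) = sin (\<beta> t')" "cos (\<beta> t) = cos (\<beta> t')"
  then obtain n :: int where n: "\<beta> t = \<beta> t' + 2 * pi * of_int n" using sin_cos_eq_iff by metis
  have "\<bar>\<beta> t - \<beta> t'\<bar> < 2 * pi" using t unfolding \<beta>_range using \<alpha> by auto
  then have "\<bar>2 * pi * of_int n\<bar> < 2 * pi" using n by simp
  then have "\<bar>of_int n :: real\<bar> < 1" by (simp add: abs_mult)
  then have "n = 0" by linarith
  then have "\<beta> t = \<beta> t'" using n by simp
  then show ?thesis using \<rho> by (simp add: \<beta>_def)
qed

sublocale thin_arcs h l f1 f2 g1 g2 k1 k2 i j X
proof
  show "0 < l" "l < h" by (rule l, rule l_less_h)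
  show "(f1 has_vector_derivative g1 t) (at t)" "(g1 has_vector_derivative k1 t) (at t)" for t
    unfolding f1_def[abs_def] g1_def[abs_def] k1_def using dx dy by (auto intro!: has_vector_derivative_pair)
  show "(f2 has_vector_derivative g2 t) (at t)" for t
    unfolding f2_def[abs_def] g2_def using \<rho>
    by (intro has_vector_derivative_pair) (auto intro!: derivative_eq_intros \<beta>_deriv)
  show "(g2 has_vector_derivative k2 t) (at t)" for t
    unfolding g2_def[abs_def] k2_def using \<rho>
    by (intro has_vector_derivative_pair) (auto intro!: derivative_eq_intros \<beta>_deriv)
  show "f1 l = f2 l" "f2 h = - f1 0" "g1 l = g2 l" "g2 h = - g1 0"
    by (simp_all add: f1_def f2_def g1_def g2_def \<beta>_ends start finish algebra_simps)
  have "continuous_on UNIV \<beta>" using \<beta>_deriv DERIV_isCont continuous_at_imp_continuous_on by blast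
  then show "continuous_on UNIV k1" "continuous_on UNIV k2"
    unfolding k1_def[abs_def] k2_def[abs_def] using \<rho> cont by (auto intro!: continuous_intros)
  show "norm (g1 t) = 1" "norm (g2 t) = 1" for t
    by (simp_all only: g1_def g2_def norm_orthonormal_pair[OF ij] unit1) simp_all
  show "norm (k1 t) \<le> 1" for t
    using curv1[of t] by (simp add: k1_def norm_orthonormal_pair[OF ij])
  show "norm (k2 t) \<le> 1" for t
  proof -
    have "(- sin (\<beta> t) / \<rho>)\<^sup>2 + (- cos (\<beta> t) / \<rho>)\<^sup>2 = ((sin (\<beta> t))\<^sup>2 + (cos (\<beta> t))\<^sup>2) / \<rho>\<^sup>2"
      by (simp only: power_divide power2_minus add_divide_distrib)
    also have "\<dots> \<le> 1" using one_le_power[OF \<rho>, of 2] by (simp add: divide_le_eq_1)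
    finally show ?thesis by (simp only: k2_def norm_orthonormal_pair[OF ij]) simp
  qed
  show "0 \<le> X" using X0 by (simp add: X_def)
  show "\<bar>f1 t \<bullet> i\<bar> \<le> X" "f1 t \<bullet> j > 0" if "t \<in> {0..l}" for t
    using bound[OF that] ypos[OF that] by (simp_all add: f1_def X_def coordinates)
  show "f2 t \<bullet> i > X" if "t \<in> {l<..<h}" for t
  proof -
    have "sin (\<beta> t) > - sin \<alpha>" using that \<alpha> unfolding \<beta>_range by (intro sin_gt_minus_sin) auto
    then have "\<rho> * sin (\<beta> t) > \<rho> * (- sin \<alpha>)" using \<rho> by (intro mult_strict_left_mono) auto
    then show ?thesis by (simp add: f2_def X_def coordinates)
  qed
  show "inj_on f1 {0..l}"
  proof (rule inj_onI)
    fix t t' assume t: "t \<in> {0..l}" "t' \<in> {0..l}" and "f1 t = f1 t'"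
    then have "f1 t \<bullet> i = f1 t' \<bullet> i" by simp
    then have "x t = x t'" by (simp only: f1_def coordinates)
    then show "t = t'" using inj_onD[OF inj_x] t by blast
  qed
  show "inj_on f2 {l<..<h}"
  proof (rule inj_onI)
    fix t t' assume t: "t \<in> {l<..<h}" "t' \<in> {l<..<h}" and "f2 t = f2 t'"
    then have "f2 t \<bullet> i = f2 t' \<bullet> i" "f2 t \<bullet> j = f2 t' \<bullet> j" by simp_all
    then have "\<rho> * sin (\<beta> t) = \<rho> * sin (\<beta> t')" "\<rho> * cos (\<beta> t) = \<rho> * cos (\<beta> t')"
      unfolding f2_def coordinates by simp_all
    then show "t = t'" using \<rho> by (intro \<beta>_dist[OF t]) simp_all
  qed
qed

lemma X_less_R: "X < R" and R_pos: "R > 0"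
proof -
  have "0 \<le> \<rho> * sin \<alpha>" using \<rho> sin_\<alpha> by simp
  then show "X < R" "R > 0" using \<rho> X0 by (simp_all add: X_def R_def)
qed

lemma on_profile:
  obtains u w where "F t = u *\<^sub>R i + w *\<^sub>R j" "\<bar>u\<bar> \<le> X" "\<bar>w\<bar> = N u"
  | u w where "F t = u *\<^sub>R i + w *\<^sub>R j" "X < \<bar>u\<bar>" "w\<^sup>2 + (\<bar>u\<bar> - \<kappa>)\<^sup>2 = \<rho>\<^sup>2"
proof -
  obtain n \<tau> where t: "t = \<tau> + of_int n * h" "0 \<le> \<tau>" "\<tau> < h" using antiperiodic_reduce[OF h_pos] by blast
  define \<sigma> :: real where "\<sigma> = (if even n then 1 else -1)"
  have Ft: "F t = \<sigma> *\<^sub>R F \<tau>" unfolding t(1) \<sigma>_def by (rule antiperiodic_ext_shift[OF h_pos])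
  have \<sigma>: "\<sigma> = 1 \<or> \<sigma> = -1" by (auto simp: \<sigma>_def)
  show thesis
  proof (cases "\<tau> \<le> l")
    case True
    then have \<tau>: "\<tau> \<in> {0..l}" using t by auto
    have "F \<tau> = f1 \<tau>" using True t by (simp add: antiperiodic_ext_base)
    then have "F t = (\<sigma> * x \<tau>) *\<^sub>R i + (\<sigma> * y \<tau>) *\<^sub>R j" using Ft by (simp add: f1_def scaleR_add_right)
    moreover have "\<bar>\<sigma> * x \<tau>\<bar> \<le> X" using bound[OF \<tau>] \<sigma> by (auto simp: X_def)
    moreover have "\<bar>\<sigma> * y \<tau>\<bar> = N (\<sigma> * x \<tau>)" using graph[OF \<tau>] ypos[OF \<tau>] \<sigma> even_N by auto
    ultimately show thesis by (rule that(1))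
  next
    case False
    then have \<tau>: "\<tau> \<in> {l<..<h}" using t by auto
    have "F \<tau> = f2 \<tau>" using False t by (simp add: antiperiodic_ext_base)
    then have "F t = (\<sigma> * (\<kappa> + \<rho> * sin (\<beta> \<tau>))) *\<^sub>R i + (\<sigma> * (\<rho> * cos (\<beta> \<tau>))) *\<^sub>R j"
      using Ft by (simp add: f2_def scaleR_add_right)
    moreover have gt: "\<kappa> + \<rho> * sin (\<beta> \<tau>) > X"
      using right[OF \<tau>] by (simp add: f2_def coordinates)
    then have "X < \<bar>\<sigma> * (\<kappa> + \<rho> * sin (\<beta> \<tau>))\<bar>" using \<sigma> by auto
    moreover have "(\<sigma> * (\<rho> * cos (\<beta> \<tau>)))\<^sup>2 + (\<bar>\<sigma> * (\<kappa> + \<rho> * sin (\<beta> \<tau>))\<bar> - \<kappa>)\<^sup>2 = \<rho>\<^sup>2"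
    proof -
      have "\<bar>\<sigma> * (\<kappa> + \<rho> * sin (\<beta> \<tau>))\<bar> - \<kappa> = \<rho> * sin (\<beta> \<tau>)" using gt X0 \<sigma> by (auto simp: X_def)
      moreover have "\<sigma>\<^sup>2 = 1" using \<sigma> by auto
      ultimately have "(\<sigma> * (\<rho> * cos (\<beta> \<tau>)))\<^sup>2 + (\<bar>\<sigma> * (\<kappa> + \<rho> * sin (\<beta> \<tau>))\<bar> - \<kappa>)\<^sup>2
          = \<rho>\<^sup>2 * ((cos (\<beta> \<tau>))\<^sup>2 + (sin (\<beta> \<tau>))\<^sup>2)" by (simp only: power_mult_distrib distrib_left mult_1)
      then show ?thesis by simp
    qed
    ultimately show thesis by (rule that(2))
  qed
qed

lemma profile_on:
  assumes "(\<bar>u\<bar> \<le> X \<and> \<bar>w\<bar> = N u) \<or> (X < \<bar>u\<bar> \<and> w\<^sup>2 + (\<bar>u\<bar> - \<kappa>)\<^sup>2 = \<rho>\<^sup>2)"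
  shows "u *\<^sub>R i + w *\<^sub>R j \<in> range F"
proof -
  have neg: "- z \<in> range F" if "z \<in> range F" for z
  proof -
    obtain t where "z = F t" using \<open>z \<in> range F\<close> by blast
    then have "- z = F (t + h)" by (simp add: antiperiodic_ext_half[OF h_pos])
    then show ?thesis by (metis rangeI)
  qed
  have graph_pt: "v *\<^sub>R i + N v *\<^sub>R j \<in> range F" if v: "\<bar>v\<bar> \<le> X" for v
  proof -
    have "\<exists>t. 0 \<le> t \<and> t \<le> l \<and> x t = v"
      by (rule IVT') (use v l start finish continuous_x in \<open>auto simp: X_def\<close>)
    then obtain t where t: "t \<in> {0..l}" "x t = v" by auto
    have "F t = f1 t" using t l_less_h by (simp add: antiperiodic_ext_base)
    also have "\<dots> = v *\<^sub>R i + N v *\<^sub>R j" using graph[OF t(1)] t by (simp add: f1_def)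
    finally show ?thesis by (metis rangeI)
  qed
  have cap_pt: "v *\<^sub>R i + z *\<^sub>R j \<in> range F" if v: "X < v" "z\<^sup>2 + (v - \<kappa>)\<^sup>2 = \<rho>\<^sup>2" for v z
  proof -
    define \<sigma> where "\<sigma> = (v - \<kappa>) / \<rho>"
    have sq: "(z / \<rho>)\<^sup>2 + \<sigma>\<^sup>2 = 1" using v \<rho> by (simp add: \<sigma>_def power_divide add_divide_distrib[symmetric])
    then have "\<sigma>\<^sup>2 \<le> 1" by (smt (verit) zero_le_power2)
    then have s1: "-1 \<le> \<sigma>" "\<sigma> \<le> 1" by (auto simp: abs_square_le_1 abs_le_iff)
    have s2: "\<sigma> > - sin \<alpha>" using v(1) \<rho> by (simp add: \<sigma>_def X_def field_simps)
    have as: "- \<alpha> < arcsin \<sigma>" "arcsin \<sigma> \<le> pi / 2"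
    proof -
      show "arcsin \<sigma> \<le> pi / 2" using s1 arcsin_bounded by blast
      have "arcsin (sin (- \<alpha>)) < arcsin \<sigma>" using s1 s2 sin_\<alpha> by (intro arcsin_less_arcsin) auto
      then show "- \<alpha> < arcsin \<sigma>" using \<alpha> by (subst (asm) arcsin_sin) auto
    qed
    define b where "b = (if z \<ge> 0 then arcsin \<sigma> else pi - arcsin \<sigma>)"
    have b: "- \<alpha> < b" "b < pi + \<alpha>" using as \<alpha> pi_gt_zero by (auto simp: b_def)
    have sb: "sin b = \<sigma>" using s1 by (simp add: b_def)
    have "\<bar>z / \<rho>\<bar> = sqrt (1 - \<sigma>\<^sup>2)" using sq by (metis add_diff_cancel_right' real_sqrt_abs)
    then have cb: "cos b = z / \<rho>" using s1 \<rho> by (auto simp: b_def cos_arcsin)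
    define t where "t = l + \<rho> * (b + \<alpha>)"
    have bt: "\<beta> t = b" using \<rho> by (simp add: \<beta>_def t_def)
    then have t: "t \<in> {l<..<h}" using b unfolding \<beta>_range by simp
    have "F t = f2 t" using t l by (simp add: antiperiodic_ext_base)
    also have "\<dots> = v *\<^sub>R i + z *\<^sub>R j" using \<rho> by (simp add: f2_def bt sb cb) (simp add: \<sigma>_def)
    finally show ?thesis by (metis rangeI)
  qed
  show ?thesis
  proof (cases "\<bar>u\<bar> \<le> X")
    case True
    then have "w = N u \<or> w = - N u" using assms by auto
    then show ?thesis
      using graph_pt[of u] neg[OF graph_pt[of "- u"]] True even_N[of u] by auto
  next
    case False
    show ?thesis
    proof (cases "u \<ge> 0")
      case True
      then show ?thesis using False assms by (intro cap_pt) auto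
    next
      case neg': False
      have "(- u) *\<^sub>R i + (- w) *\<^sub>R j \<in> range F" using False neg' assms by (intro cap_pt) auto
      from neg[OF this] show ?thesis by (simp add: add.commute)
    qed
  qed
qed

lemma N_pos: "\<bar>u\<bar> \<le> X \<Longrightarrow> N u > 0"
proof -
  assume u: "\<bar>u\<bar> \<le> X"
  have "\<exists>t. 0 \<le> t \<and> t \<le> l \<and> x t = u"
    by (rule IVT') (use u l start finish continuous_x in \<open>auto simp: X_def\<close>)
  then obtain t where "t \<in> {0..l}" "x t = u" by auto
  then show ?thesis using graph[of t] ypos[of t] by simp
qed

text \<open>
  The graph of the half circle of radius \<open>R\<close> over \<open>[-R, R]\<close> is the profile of the curve, multiplied by \<open>a\<close>.
  At the ends \<open>R\<close> and \<open>-R\<close>, where both heights vanish, \<open>a\<close> stays positive and continuous because the common factor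
  \<open>R - |u|\<close> of their squares cancels.
\<close>

lemma scaling_to_circle:
  obtains a where "continuous_on UNIV a" "\<And>u. a u > (0::real)"
    "range F = {u *\<^sub>R i + w *\<^sub>R j | u w. u\<^sup>2 + (a u * w)\<^sup>2 = R\<^sup>2}"
proof -
  define p where "p u = sqrt (R\<^sup>2 - u\<^sup>2) / N u" for u
  define q where "q u = sqrt ((R + min \<bar>u\<bar> R) / (\<rho> - \<kappa> + min \<bar>u\<bar> R))" for u
  define a where "a u = (if \<bar>u\<bar> \<le> X then p u else q u)" for u
  have X0: "0 \<le> X" by (rule X)
  have dpos: "\<rho> - \<kappa> + v > 0" if "v \<ge> X" for v
  proof -
    have "\<rho> * sin \<alpha> < \<rho> * 1" using \<rho> sin_\<alpha> by (intro mult_strict_left_mono) auto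
    then show ?thesis using that by (simp add: X_def)
  qed
  have less: "R\<^sup>2 - u\<^sup>2 > 0" if "\<bar>u\<bar> \<le> X" for u
  proof -
    have "\<bar>u\<bar> < R" using that X_less_R by simp
    then have "\<bar>u\<bar>\<^sup>2 < R\<^sup>2" by (intro power_strict_mono) auto
    then show ?thesis by simp
  qed
  have minge: "min \<bar>u\<bar> R \<ge> X" if "X \<le> \<bar>u\<bar>" for u using that X_less_R by simp
  have q_pos: "q u > 0" if "X \<le> \<bar>u\<bar>" for u
    using dpos[OF minge[OF that]] R_pos X0 minge[OF that] by (simp add: q_def)
  have a_pos: "a u > 0" for u
    using less[of u] N_pos[of u] q_pos[of u] by (auto simp: a_def p_def)
  have pq: "p u = q u" if u: "\<bar>u\<bar> = X" for u
  proof -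
    have Nu: "N u = \<rho> * cos \<alpha>"
      using u graph[of l] finish l even_N[of u] by (auto simp: X_def abs_if split: if_splits)
    have "(R\<^sup>2 - u\<^sup>2) / (\<rho> * cos \<alpha>)\<^sup>2 = (R + X) / (\<rho> - \<kappa> + X)"
    proof -
      have "R\<^sup>2 - u\<^sup>2 = (R + X) * (R - X)" using u by (metis power2_abs square_diff_square_factored power2_eq_square)
      moreover have "(\<rho> * cos \<alpha>)\<^sup>2 = (R - X) * (\<rho> - \<kappa> + X)"
        unfolding R_def X_def power_mult_distrib cos_squared_eq by (simp add: algebra_simps power2_eq_square)
      ultimately show ?thesis using X_less_R by simp
    qed
    then have "sqrt ((R\<^sup>2 - u\<^sup>2) / (\<rho> * cos \<alpha>)\<^sup>2) = q u" using u X_less_R by (simp add: q_def)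
    then show ?thesis using \<rho> cos_\<alpha> by (simp add: p_def Nu real_sqrt_divide)
  qed
  have cont_a: "continuous_on UNIV a"
  proof -
    have "continuous_on {u. \<bar>u\<bar> \<le> X} p"
    proof -
      have "{u. \<bar>u\<bar> \<le> X} = {- X..X}" by auto
      then have "continuous_on {u. \<bar>u\<bar> \<le> X} N" using cont_N by (simp add: X_def)
      moreover have "\<forall>u\<in>{u. \<bar>u\<bar> \<le> X}. N u \<noteq> 0" using N_pos by fastforce
      ultimately show ?thesis unfolding p_def[abs_def] by (intro continuous_intros) auto
    qed
    moreover have "continuous_on {u. X \<le> \<bar>u\<bar>} q"
      unfolding q_def[abs_def] using dpos minge by (intro continuous_intros) (auto simp: less_imp_neq[symmetric])
    ultimately have "continuous_on UNIV (\<lambda>u. if \<bar>u\<bar> \<le> X then p u else q u)"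
      by (intro continuous_on_cases_le) (auto intro!: continuous_intros simp: pq)
    then show ?thesis by (simp add: a_def[abs_def])
  qed
  have char: "u\<^sup>2 + (a u * w)\<^sup>2 = R\<^sup>2 \<longleftrightarrow>
      (\<bar>u\<bar> \<le> X \<and> \<bar>w\<bar> = N u) \<or> (X < \<bar>u\<bar> \<and> w\<^sup>2 + (\<bar>u\<bar> - \<kappa>)\<^sup>2 = \<rho>\<^sup>2)" for u w
  proof (cases "\<bar>u\<bar> \<le> X")
    case True
    have a2: "(a u * w)\<^sup>2 = (R\<^sup>2 - u\<^sup>2) * (w / N u)\<^sup>2"
      using True less[OF True] by (simp add: a_def p_def power_mult_distrib power_divide)
    have "u\<^sup>2 + (a u * w)\<^sup>2 = R\<^sup>2 \<longleftrightarrow> (a u * w)\<^sup>2 = (R\<^sup>2 - u\<^sup>2) * 1" by auto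
    also have "\<dots> \<longleftrightarrow> (w / N u)\<^sup>2 = 1" unfolding a2 mult_cancel_left using less[OF True] by auto
    also have "\<dots> \<longleftrightarrow> w\<^sup>2 = (N u)\<^sup>2" using N_pos[OF True] by (auto simp: power_divide)
    also have "\<dots> \<longleftrightarrow> \<bar>w\<bar> = N u" using N_pos[OF True] by (metis abs_of_pos power2_abs power2_eq_iff_nonneg abs_ge_zero)
    finally show ?thesis using True by simp
  next
    case False
    then have u: "X \<le> \<bar>u\<bar>" by simp
    define v where "v = min \<bar>u\<bar> R"
    have v: "\<rho> - \<kappa> + v > 0" "R + v > 0" using dpos[OF minge[OF u]] minge[OF u] X0 R_pos by (auto simp: v_def)
    have "(q u)\<^sup>2 = (R + v) / (\<rho> - \<kappa> + v)" using v by (simp add: q_def v_def[symmetric])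
    then have a2: "(a u * w)\<^sup>2 = (R + v) / (\<rho> - \<kappa> + v) * w\<^sup>2" using False by (simp add: a_def power_mult_distrib)
    show ?thesis
    proof (cases "\<bar>u\<bar> \<le> R")
      case True
      then have vu: "v = \<bar>u\<bar>" by (simp add: v_def)
      have "R\<^sup>2 - u\<^sup>2 = (R + v) * (R - v)"
        unfolding vu by (simp add: algebra_simps power2_eq_square)
      then have "u\<^sup>2 + (a u * w)\<^sup>2 = R\<^sup>2 \<longleftrightarrow> (a u * w)\<^sup>2 = (R + v) * (R - v)" by auto
      also have "\<dots> \<longleftrightarrow> (R + v) * (w\<^sup>2 / (\<rho> - \<kappa> + v)) = (R + v) * (R - v)"
        unfolding a2 by simp
      also have "\<dots> \<longleftrightarrow> w\<^sup>2 / (\<rho> - \<kappa> + v) = R - v" unfolding mult_cancel_left using v by auto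
      also have "\<dots> \<longleftrightarrow> w\<^sup>2 = (R - v) * (\<rho> - \<kappa> + v)" using v by (simp add: field_simps)
      also have "\<dots> \<longleftrightarrow> w\<^sup>2 + (\<bar>u\<bar> - \<kappa>)\<^sup>2 = \<rho>\<^sup>2"
        unfolding vu R_def by (auto simp: algebra_simps power2_eq_square)
      finally show ?thesis using False by simp
    next
      case gt: False
      then have "R\<^sup>2 < \<bar>u\<bar>\<^sup>2" using R_pos by (intro power_strict_mono) auto
      then have "R\<^sup>2 < u\<^sup>2" by simp
      moreover have "0 \<le> (a u * w)\<^sup>2" by simp
      ultimately have 1: "u\<^sup>2 + (a u * w)\<^sup>2 \<noteq> R\<^sup>2" by linarith
      have "\<rho>\<^sup>2 < (\<bar>u\<bar> - \<kappa>)\<^sup>2" using gt \<rho> by (intro power_strict_mono) (auto simp: R_def)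
      moreover have "0 \<le> w\<^sup>2" by simp
      ultimately have "w\<^sup>2 + (\<bar>u\<bar> - \<kappa>)\<^sup>2 \<noteq> \<rho>\<^sup>2" by linarith
      then show ?thesis using 1 False by simp
    qed
  qed
  have "range F = {u *\<^sub>R i + w *\<^sub>R j | u w. u\<^sup>2 + (a u * w)\<^sup>2 = R\<^sup>2}"
  proof (intro equalityI subsetI)
    fix z assume "z \<in> range F"
    then obtain t where "z = F t" by blast
    then have "\<exists>u w. z = u *\<^sub>R i + w *\<^sub>R j \<and> u\<^sup>2 + (a u * w)\<^sup>2 = R\<^sup>2"
      unfolding char by (cases rule: on_profile[of t]) blast+
    then show "z \<in> {u *\<^sub>R i + w *\<^sub>R j | u w. u\<^sup>2 + (a u * w)\<^sup>2 = R\<^sup>2}" by blast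
  next
    fix z assume "z \<in> {u *\<^sub>R i + w *\<^sub>R j | u w. u\<^sup>2 + (a u * w)\<^sup>2 = R\<^sup>2}"
    then show "z \<in> range F" using profile_on char by blast
  qed
  then show thesis using that cont_a a_pos by blast
qed

lemma abs_height_le:
  assumes "\<And>u. \<bar>u\<bar> \<le> X \<Longrightarrow> N u \<le> \<rho>"
  shows "\<bar>F t \<bullet> j\<bar> \<le> \<rho>"
proof (cases rule: on_profile[of t])
  case (1 u w)
  then show ?thesis using assms[of u] by (simp add: coordinates)
next
  case (2 u w)
  moreover have "0 \<le> (\<bar>u\<bar> - \<kappa>)\<^sup>2" by simp
  ultimately have "w\<^sup>2 \<le> \<rho>\<^sup>2" by linarith
  then have "\<bar>w\<bar> \<le> \<rho>" using \<rho> by (metis abs_le_square_iff abs_of_nonneg order_trans zero_le_one)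
  then show ?thesis using 2(1) by (simp add: coordinates)
qed

end

section \<open>Ambient isotopies\<close>

text \<open>
  In contrast to isotopy of sets, this notion keeps track of the map, so that one isotopy can be
  applied to the link and to its components.
\<close>

definition isotopic_to_id :: "(real ^ 3 \<Rightarrow> real ^ 3) \<Rightarrow> bool"
  where "isotopic_to_id F \<longleftrightarrow>
    (\<exists>H :: real \<Rightarrow> real ^ 3 \<Rightarrow> real ^ 3.
       continuous_on ({0..1} \<times> UNIV) (\<lambda>(t, x). H t x) \<and>
       (\<forall>t\<in>{0..1}. \<exists>G. homeomorphism UNIV UNIV (H t) G) \<and>
       (\<forall>x. H 0 x = x) \<and> H 1 = F)"

lemma ambient_isotopic_image: "isotopic_to_id F \<Longrightarrow> ambient_isotopic S (F ` S)"
  unfolding isotopic_to_id_def ambient_isotopic_def by metis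

lemma isotopic_to_id_comp:
  assumes "isotopic_to_id F" "isotopic_to_id F'"
  shows "isotopic_to_id (F' \<circ> F)"
proof -
  obtain H where H: "continuous_on ({0..1} \<times> UNIV) (\<lambda>(t, x). H t x)"
    "\<And>t. t \<in> {0..1::real} \<Longrightarrow> \<exists>G. homeomorphism UNIV UNIV (H t) G" "\<And>x. H 0 x = x" "H 1 = F"
    using assms(1) unfolding isotopic_to_id_def by blast
  obtain H' where H': "continuous_on ({0..1} \<times> UNIV) (\<lambda>(t, x). H' t x)"
    "\<And>t. t \<in> {0..1::real} \<Longrightarrow> \<exists>G. homeomorphism UNIV UNIV (H' t) G" "\<And>x. H' 0 x = x" "H' 1 = F'"
    using assms(2) unfolding isotopic_to_id_def by blast
  have "continuous_on ({0..1} \<times> UNIV) (\<lambda>z. (case (fst z, case z of (t, x) \<Rightarrow> H t x) of (t, x) \<Rightarrow> H' t x))"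
    by (rule continuous_on_compose2[OF H'(1)]) (auto intro!: continuous_intros H(1))
  then have "continuous_on ({0..1} \<times> UNIV) (\<lambda>(t, x). H' t (H t x))"
    by (simp add: split_beta)
  moreover have "\<exists>G. homeomorphism UNIV UNIV (\<lambda>x. H' t (H t x)) G" if t: "t \<in> {0..1}" for t
    using H(2)[OF t] H'(2)[OF t] homeomorphism_compose[of UNIV UNIV "H t" _ UNIV "H' t"] by (auto simp: o_def)
  ultimately show ?thesis
    unfolding isotopic_to_id_def using H H' by (intro exI[of _ "\<lambda>t x. H' t (H t x)"]) (auto simp: o_def)
qed

text \<open>
  On each line in direction \<open>k\<close> such a map is affine and increasing, and so is its convex combination
  with the identity; this yields the isotopy and the inverse maps.
\<close>

lemma isotopic_to_id_axis:
  fixes a b :: "real ^ 3 \<Rightarrow> real" and k :: 3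
  assumes cont: "continuous_on UNIV a" "continuous_on UNIV b" and pos: "\<And>x. a x > 0"
    and indep: "\<And>x c. a (x + c *\<^sub>R axis k 1) = a x" "\<And>x c. b (x + c *\<^sub>R axis k 1) = b x"
  shows "isotopic_to_id (\<lambda>x. x + ((a x - 1) * x $ k + b x) *\<^sub>R axis k 1)"
proof -
  define H where "H t x = x + (t * ((a x - 1) * x $ k + b x)) *\<^sub>R axis k 1" for t x
  define G where "G t x = x + ((x $ k - t * b x) / (1 + t * (a x - 1)) - x $ k) *\<^sub>R axis k 1" for t x
  have den: "1 + t * (a x - 1) > 0" if t: "t \<in> {0..1}" for t x
  proof -
    have "1 + t * (a x - 1) = (1 - t) + t * a x" by (simp add: algebra_simps)
    also have "\<dots> > 0" using t pos[of x] by (cases "t = 0") (auto intro: add_nonneg_pos)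
    finally show ?thesis .
  qed
  have k: "(x + c *\<^sub>R axis k 1) $ k = x $ k + c" for x c by (simp add: axis_def)
  have GH: "G t (H t x) = x" if "t \<in> {0..1}" for t x
  proof -
    have "x $ k + t * ((a x - 1) * x $ k + b x) - t * b x = x $ k * (1 + t * (a x - 1))"
      by (simp add: algebra_simps)
    then show ?thesis using den[OF that, of x]
      by (simp add: G_def H_def indep k scaleR_left_distrib[symmetric])
  qed
  have HG: "H t (G t x) = x" if "t \<in> {0..1}" for t x
  proof -
    let ?c = "(x $ k - t * b x) / (1 + t * (a x - 1))"
    have "y + t * ((a x - 1) * y + b x) = y * (1 + t * (a x - 1)) + t * b x" for y by (simp add: algebra_simps)
    then have "?c + t * ((a x - 1) * ?c + b x) = ?c * (1 + t * (a x - 1)) + t * b x" .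
    also have "\<dots> = x $ k" using den[OF that, of x] by simp
    finally have "?c - x $ k + t * ((a x - 1) * ?c + b x) = 0" by simp
    then show ?thesis
      by (simp add: G_def H_def indep k add.assoc scaleR_left_distrib[symmetric])
  qed
  have comp: "continuous_on S (\<lambda>z. a (f z))" "continuous_on S (\<lambda>z. b (f z))"
    if "continuous_on S f" for S and f :: "'z::topological_space \<Rightarrow> real^3"
    by (rule continuous_on_compose2[OF cont(1) that], simp, rule continuous_on_compose2[OF cont(2) that], simp)
  have "continuous_on ({0..1} \<times> UNIV) (\<lambda>(t, x). H t x)"
    unfolding H_def split_beta by (intro continuous_intros comp)
  moreover have "homeomorphism UNIV UNIV (H t) (G t)" if t: "t \<in> {0..1}" for t
  proof -
    have "continuous_on UNIV (H t)" unfolding H_def[abs_def] by (intro continuous_intros comp)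
    moreover have "continuous_on UNIV (G t)"
      unfolding G_def[abs_def] using den[OF t] by (intro continuous_intros comp) (auto simp: less_imp_neq[symmetric])
    ultimately show ?thesis
      unfolding homeomorphism_def using GH[OF t] HG[OF t] by (auto simp: image_iff) (metis)+
  qed
  moreover have "\<forall>x. H 0 x = x" "H 1 = (\<lambda>x. x + ((a x - 1) * x $ k + b x) *\<^sub>R axis k 1)"
    by (simp_all add: H_def fun_eq_iff)
  ultimately show ?thesis unfolding isotopic_to_id_def by blast
qed

lemma flat_circle_vector:
  "flat_circle (vector [c, 0, 0]) = {vector [c + u, w, 0] | u w. u\<^sup>2 + w\<^sup>2 = 1}"
proof (intro equalityI subsetI)
  fix x :: "real^3" assume "x \<in> flat_circle (vector [c, 0, 0])"
  then have d: "dist (vector [c, 0, 0]) x = 1" and x3: "x $ 3 = 0" by (auto simp: flat_circle_def)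
  have "(dist (vector [c, 0, 0]) x)\<^sup>2 = (x $ 1 - c)\<^sup>2 + (x $ 2)\<^sup>2"
    unfolding dist_norm power2_norm_eq_inner inner_vec_def using x3 by (simp add: sum_3 power2_eq_square algebra_simps)
  then have "(x $ 1 - c)\<^sup>2 + (x $ 2)\<^sup>2 = 1" using d by simp
  moreover have "x = vector [c + (x $ 1 - c), x $ 2, 0]" using x3 by (simp add: vec_eq_iff forall_3)
  ultimately show "x \<in> {vector [c + u, w, 0] | u w. u\<^sup>2 + w\<^sup>2 = 1}" by blast
next
  fix x :: "real^3" assume "x \<in> {vector [c + u, w, 0] | u w. u\<^sup>2 + w\<^sup>2 = 1}"
  then obtain u w where x: "x = vector [c + u, w, 0]" "u\<^sup>2 + w\<^sup>2 = 1" by blast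
  have "(dist (vector [c, 0, 0]) x)\<^sup>2 = 1"
    unfolding dist_norm power2_norm_eq_inner inner_vec_def x(1) using x(2) by (simp add: sum_3 power2_eq_square)
  then have "dist (vector [c, 0, 0]) x = 1" by (metis norm_ge_zero dist_norm power2_eq_iff_nonneg one_power2 zero_le_one)
  then show "x \<in> flat_circle (vector [c, 0, 0])" using x by (simp add: flat_circle_def)
qed

text \<open>
  The dumbbell lies in the plane \<open>x\<^sub>3 = 0\<close> and the ring in the plane \<open>x\<^sub>1 = 0\<close>, so scaling \<open>x\<^sub>3\<close> or \<open>x\<^sub>1\<close>
  affects only one of them.  Five maps are composed: the dumbbell is scaled to width 2; the ring is scaled to a round circle;
  the region outside the unit disc of the \<open>(x\<^sub>2, x\<^sub>3)\<close> plane, which contains the ring but not the dumbbell, is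
  sheared in direction \<open>x\<^sub>1\<close>, which moves the ring away and tilts it; a shear in direction \<open>x\<^sub>3\<close> flattens the ring;
  and a scaling of \<open>x\<^sub>2\<close> that depends on \<open>x\<^sub>1\<close> makes both components unit circles.
\<close>

lemma unlink_perpendicular:
  fixes aK aA :: "real \<Rightarrow> real" and RK RA :: real
  assumes aK: "continuous_on UNIV aK" "\<And>u. aK u > 0" and aA: "continuous_on UNIV aA" "\<And>u. aA u > 0"
    and RK: "RK > 0" and RA: "RA > 1"
    and low: "\<And>u w. u\<^sup>2 + (aK u * w)\<^sup>2 = RK\<^sup>2 \<Longrightarrow> w\<^sup>2 \<le> 1"
  obtains F where "isotopic_to_id F"
    "F ` {vector [u, w, 0] | u w. u\<^sup>2 + (aK u * w)\<^sup>2 = RK\<^sup>2} = flat_circle (vector [0, 0, 0])"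
    "F ` {vector [0, u, w] | u w. u\<^sup>2 + (aA u * w)\<^sup>2 = RA\<^sup>2} = flat_circle (vector [3, 0, 0])"
proof -
  have compose: "continuous_on UNIV (\<lambda>x. f (g x))" if "continuous_on UNIV f" "continuous_on UNIV g"
    for f :: "real \<Rightarrow> real" and g :: "real^3 \<Rightarrow> real"
    by (rule continuous_on_compose2[OF that(1,2)]) simp
  define cl where "cl u = max 0 (min 1 u)" for u :: real
  have cl: "continuous_on UNIV cl" "0 \<le> cl u" "cl u \<le> 1" for u
    unfolding cl_def[abs_def] by (auto intro!: continuous_intros)
  define b3 where "b3 x = cl (((x $ 2)\<^sup>2 + (x $ 3)\<^sup>2 - 1) / (RA\<^sup>2 - 1)) * (3 + x $ 3 / RA)" for x :: "real^3"
  define b4 where "b4 x = - (cl (x $ 1 - 1) * RA * (x $ 1 - 3))" for x :: "real^3"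
  define a5 where "a5 x = (1 - cl (x $ 1 - 1)) * (aK (RK * x $ 1) / RK) + cl (x $ 1 - 1) / RA" for x :: "real^3"
  define F1 where "F1 x = x + ((1 / RK - 1) * x $ 1 + 0) *\<^sub>R axis 1 1" for x :: "real^3"
  define F2 where "F2 x = x + ((aA (x $ 2) - 1) * x $ 3 + 0) *\<^sub>R axis 3 1" for x :: "real^3"
  define F3 where "F3 x = x + ((1 - 1) * x $ 1 + b3 x) *\<^sub>R axis 1 1" for x :: "real^3"
  define F4 where "F4 x = x + ((1 - 1) * x $ 3 + b4 x) *\<^sub>R axis 3 1" for x :: "real^3"
  define F5 where "F5 x = x + ((a5 x - 1) * x $ 2 + 0) *\<^sub>R axis 2 1" for x :: "real^3"
  have RA2: "RA\<^sup>2 - 1 > 0" using RA by (simp add: one_less_power)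
  then have nz: "RA\<^sup>2 - 1 \<noteq> 0" "RA \<noteq> 0" using RA by linarith+
  have a5_pos: "a5 x > 0" for x
  proof (cases "cl (x $ 1 - 1) = 1")
    case False
    then have "(1 - cl (x $ 1 - 1)) * (aK (RK * x $ 1) / RK) > 0"
      using cl(3)[of "x $ 1 - 1"] aK(2) RK by (intro mult_pos_pos divide_pos_pos) auto
    moreover have "cl (x $ 1 - 1) / RA \<ge> 0" using cl(2) RA by simp
    ultimately show ?thesis by (simp add: a5_def)
  qed (use RA in \<open>simp add: a5_def\<close>)
  note ci = continuous_intros compose[OF cl(1)] compose[OF aK(1)] compose[OF aA(1)]
  have i1: "isotopic_to_id F1" unfolding F1_def[abs_def]
    by (rule isotopic_to_id_axis) (use RK in auto)
  have i2: "isotopic_to_id F2" unfolding F2_def[abs_def]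
    by (rule isotopic_to_id_axis) (use aA(2) in \<open>auto intro!: ci simp: axis_def\<close>)
  have i3: "isotopic_to_id F3" unfolding F3_def[abs_def]
  proof (rule isotopic_to_id_axis)
    show "continuous_on UNIV b3" unfolding b3_def[abs_def] by (intro ci) (use nz in simp_all)
  qed (auto simp: b3_def axis_def)
  have i4: "isotopic_to_id F4" unfolding F4_def[abs_def]
  proof (rule isotopic_to_id_axis)
    show "continuous_on UNIV b4" unfolding b4_def[abs_def] by (intro ci)
  qed (auto simp: b4_def axis_def)
  have i5: "isotopic_to_id F5" unfolding F5_def[abs_def]
  proof (rule isotopic_to_id_axis)
    show "continuous_on UNIV a5" unfolding a5_def[abs_def] using RA RK by (intro ci) auto
  qed (use a5_pos in \<open>auto simp: a5_def axis_def\<close>)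
  have v: "F1 (vector [x, y, z]) = vector [x / RK, y, z]"
    "F2 (vector [x, y, z]) = vector [x, y, aA y * z]"
    "F3 (vector [x, y, z]) = vector [x + cl ((y\<^sup>2 + z\<^sup>2 - 1) / (RA\<^sup>2 - 1)) * (3 + z / RA), y, z]"
    "F4 (vector [x, y, z]) = vector [x, y, z - cl (x - 1) * RA * (x - 3)]"
    "F5 (vector [x, y, z]) = vector [x, ((1 - cl (x - 1)) * (aK (RK * x) / RK) + cl (x - 1) / RA) * y, z]" for x y z
    by (simp_all add: F1_def F2_def F3_def F4_def F5_def b3_def b4_def a5_def vec_eq_iff forall_3 axis_def algebra_simps)
  define F where "F = F5 \<circ> (F4 \<circ> (F3 \<circ> (F2 \<circ> F1)))"
  have "isotopic_to_id F" unfolding F_def by (intro isotopic_to_id_comp i1 i2 i3 i4 i5)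
  moreover have FK: "F (vector [u, w, 0]) = vector [0 + u / RK, aK u * w / RK, 0]"
    if uw: "u\<^sup>2 + (aK u * w)\<^sup>2 = RK\<^sup>2" for u w
  proof -
    have "u\<^sup>2 \<le> RK\<^sup>2" using uw by (smt (verit) zero_le_power2)
    then have "u \<le> RK" using RK by (smt (verit) power2_le_imp_le)
    then have "u / RK \<le> 1" using RK by (simp add: divide_le_eq_1)
    then have 1: "cl (u / RK - 1) = 0" by (simp add: cl_def)
    have "(w\<^sup>2 - 1) / (RA\<^sup>2 - 1) \<le> 0" using low[OF uw] RA2 by (simp add: divide_nonpos_pos)
    then have 2: "cl ((w\<^sup>2 - 1) / (RA\<^sup>2 - 1)) = 0" by (simp add: cl_def)
    show ?thesis using RK by (simp add: F_def v 1 2)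
  qed
  have FA: "F (vector [0, u, w]) = vector [3 + aA u * w / RA, u / RA, 0]"
    if uw: "u\<^sup>2 + (aA u * w)\<^sup>2 = RA\<^sup>2" for u w
  proof -
    have "(aA u * w)\<^sup>2 \<le> RA\<^sup>2" using uw by (smt (verit) zero_le_power2)
    then have "\<bar>aA u * w\<bar> \<le> RA" using abs_le_square_iff[of "aA u * w" RA] RA by simp
    then have "aA u * w / RA \<ge> -1" using RA by (simp add: field_simps)
    then have 1: "cl (2 + aA u * w / RA) = 1" by (simp add: cl_def)
    have 2: "cl ((u\<^sup>2 + (aA u * w)\<^sup>2 - 1) / (RA\<^sup>2 - 1)) = 1" using uw RA2 by (simp add: cl_def)
    show ?thesis using RA by (simp add: F_def v 1 2)
  qed
  have "F ` {vector [u, w, 0] | u w. u\<^sup>2 + (aK u * w)\<^sup>2 = RK\<^sup>2} = flat_circle (vector [0, 0, 0])"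
  proof (unfold flat_circle_vector, intro equalityI subsetI)
    fix z assume "z \<in> F ` {vector [u, w, 0] | u w. u\<^sup>2 + (aK u * w)\<^sup>2 = RK\<^sup>2}"
    then obtain u w where uw: "u\<^sup>2 + (aK u * w)\<^sup>2 = RK\<^sup>2" "z = vector [0 + u / RK, aK u * w / RK, 0]"
      using FK by blast
    moreover have "(u / RK)\<^sup>2 + (aK u * w / RK)\<^sup>2 = 1"
      using uw(1) RK by (simp only: power_divide add_divide_distrib[symmetric]) simp
    ultimately show "z \<in> {vector [0 + u, w, 0] | u w. u\<^sup>2 + w\<^sup>2 = 1}" by blast
  next
    fix z :: "real^3" assume "z \<in> {vector [0 + u, w, 0] | u w. u\<^sup>2 + w\<^sup>2 = 1}"
    then obtain u w where uw: "u\<^sup>2 + w\<^sup>2 = 1" "z = vector [0 + u, w, 0]" by blast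
    let ?u = "RK * u" and ?w = "RK * w / aK (RK * u)"
    have nz: "aK ?u \<noteq> 0" using aK(2)[of ?u] by simp
    have "aK ?u * ?w = RK * w" using nz by simp
    then have eq: "?u\<^sup>2 + (aK ?u * ?w)\<^sup>2 = RK\<^sup>2"
      using uw(1) by (simp only: power_mult_distrib distrib_left[symmetric] mult_1_right)
    have "F (vector [?u, ?w, 0]) = z"
      unfolding FK[OF eq] uw(2) using RK nz by simp
    then show "z \<in> F ` {vector [u, w, 0] | u w. u\<^sup>2 + (aK u * w)\<^sup>2 = RK\<^sup>2}" using eq by blast
  qed
  moreover have "F ` {vector [0, u, w] | u w. u\<^sup>2 + (aA u * w)\<^sup>2 = RA\<^sup>2} = flat_circle (vector [3, 0, 0])"
  proof (unfold flat_circle_vector, intro equalityI subsetI)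
    fix z assume "z \<in> F ` {vector [0, u, w] | u w. u\<^sup>2 + (aA u * w)\<^sup>2 = RA\<^sup>2}"
    then obtain u w where uw: "u\<^sup>2 + (aA u * w)\<^sup>2 = RA\<^sup>2" "z = vector [3 + aA u * w / RA, u / RA, 0]"
      using FA by blast
    moreover have "(aA u * w / RA)\<^sup>2 + (u / RA)\<^sup>2 = 1"
      using uw(1) RA by (simp only: power_divide add_divide_distrib[symmetric] add.commute) simp
    ultimately show "z \<in> {vector [3 + u, w, 0] | u w. u\<^sup>2 + w\<^sup>2 = 1}" by blast
  next
    fix z :: "real^3" assume "z \<in> {vector [3 + u, w, 0] | u w. u\<^sup>2 + w\<^sup>2 = 1}"
    then obtain u w where uw: "u\<^sup>2 + w\<^sup>2 = 1" "z = vector [3 + u, w, 0]" by blast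
    let ?u = "RA * w" and ?w = "RA * u / aA (RA * w)"
    have nz: "aA ?u \<noteq> 0" using aA(2)[of ?u] by simp
    have "aA ?u * ?w = RA * u" using nz by simp
    then have eq: "?u\<^sup>2 + (aA ?u * ?w)\<^sup>2 = RA\<^sup>2"
      using uw(1) by (simp only: power_mult_distrib distrib_left[symmetric] add.commute mult_1_right)
    have "F (vector [0, ?u, ?w]) = z"
      unfolding FA[OF eq] uw(2) using RA nz by simp
    then show "z \<in> F ` {vector [0, u, w] | u w. u\<^sup>2 + (aA u * w)\<^sup>2 = RA\<^sup>2}" using eq by blast
  qed
  ultimately show thesis using that by blast
qed

lemma unknot_shifted_circle: "isotopic_to_id F \<Longrightarrow> F ` S = flat_circle (vector [c, 0, 0]) \<Longrightarrow> unknot S"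
proof -
  assume F: "isotopic_to_id F" "F ` S = flat_circle (vector [c, 0, 0])"
  define T where "T x = x + ((1 - 1) * x $ 1 + (- c)) *\<^sub>R axis 1 1" for x :: "real^3"
  have T: "isotopic_to_id T" unfolding T_def[abs_def] by (rule isotopic_to_id_axis) auto
  have Tv: "T (vector [c + u, w, 0]) = vector [0 + u, w, 0]" for u w
    by (simp add: T_def vec_eq_iff forall_3 axis_def)
  have "(T \<circ> F) ` S = T ` flat_circle (vector [c, 0, 0])" using F(2) by (simp only: image_comp[symmetric])
  also have "\<dots> = flat_circle (vector [0, 0, 0])"
    unfolding flat_circle_vector using Tv by (auto simp: image_iff) (metis Tv add_0)+
  also have "vector [0, 0, 0] = (0 :: real^3)" by (simp add: vec_eq_iff forall_3)
  finally show "unknot S"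
    using ambient_isotopic_image[OF isotopic_to_id_comp[OF F(1) T], of S] by (simp add: unknot_def)
qed

section \<open>The gordian unlink\<close>

lemma R1_ge_1:
  assumes "constrained_loop 1 s \<gamma>"
  shows "R1 \<gamma> \<ge> 1"
proof -
  let ?A = "{ereal (norm a) | a t. (tangent \<gamma> has_vector_derivative a) (at t)}"
  have le: "max_curvature \<gamma> \<le> 1"
    unfolding max_curvature_def using assms by (auto intro!: Sup_least simp: constrained_loop_def)
  obtain S where S: "finite S" "tangent \<gamma> C1_differentiable_on ({0..s} - S)"
    using assms unfolding constrained_loop_def piecewise_C1_differentiable_on_def by auto
  have "infinite {0..s}" using constrained_loopD(1)[OF assms] by (simp add: infinite_Icc_iff)
  then have "infinite ({0..s} - S)" using S(1) by simp
  then obtain t where "t \<in> {0..s} - S" by (metis finite.emptyI ex_in_conv)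
  then obtain a where "(tangent \<gamma> has_vector_derivative a) (at t)"
    using S(2) unfolding C1_differentiable_on_def by blast
  then have "ereal (norm a) \<le> max_curvature \<gamma>" unfolding max_curvature_def by (intro Sup_upper) blast
  then have ge: "0 \<le> max_curvature \<gamma>" by (meson ereal_less_eq(5) norm_ge_zero order_trans)
  show ?thesis
  proof (cases "max_curvature \<gamma>")
    case (real m)
    then have "0 \<le> m" "m \<le> 1" using le ge by (auto simp: one_ereal_def zero_ereal_def)
    then show ?thesis unfolding R1_def real
      by (cases "m = 0") (auto simp: one_ereal_def zero_ereal_def[symmetric] divide_ereal_def field_simps)
  qed (use le ge in auto)
qed

lemma thickness_radius_ge:
  assumes \<gamma>: "constrained_loop 1 s \<gamma>" and d: "d \<le> 2"
    and chord: "\<And>a b. \<gamma> a \<noteq> \<gamma> b \<Longrightarrow> (\<gamma> a - \<gamma> b) \<bullet> tangent \<gamma> a = 0 \<Longrightarrow> (\<gamma> a - \<gamma> b) \<bullet> tangent \<gamma> b = 0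
      \<Longrightarrow> norm (\<gamma> a - \<gamma> b) \<ge> d"
  shows "thickness_radius \<gamma> \<ge> ereal (d / 2)"
proof -
  have "ereal (d / 2) \<le> 1" using d by (simp add: one_ereal_def)
  then have 1: "ereal (d / 2) \<le> R1 \<gamma>" using R1_ge_1[OF \<gamma>] by (rule order_trans)
  have "ereal d \<le> R2 \<gamma>"
    unfolding R2_def using chord by (intro Inf_greatest) (auto simp: orthogonal_def)
  then have "ereal d / 2 \<le> R2 \<gamma> / 2" by (intro ereal_divide_right_mono) auto
  then show ?thesis using 1 by (simp add: thickness_radius_def)
qed

text \<open>
  Along an arc shorter than \<open>\<pi>\<close> the curve keeps moving forward with respect to the initial tangent.
  So a chord that is orthogonal to both tangents cuts the curve into two arcs of length at least \<open>\<pi>\<close>.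
\<close>

lemma near_circle_chord:
  assumes K: "constrained_loop 1 s K" and s: "s \<le> 2 * pi + \<delta>" "0 \<le> \<delta>" "\<delta> \<le> 1"
    and ne: "K a \<noteq> K b" and orth: "(K a - K b) \<bullet> tangent K a = 0" "(K a - K b) \<bullet> tangent K b = 0"
  shows "norm (K a - K b) \<ge> 2 - \<delta>\<^sup>2 / 4"
proof -
  have short: "(K (x + y) - K x) \<bullet> tangent K x > 0" if "0 < y" "y < pi" for x y
  proof -
    have "(K (x + y) - K x) \<bullet> tangent K x \<ge> sin (x + y - x) - sin (x - x)"
    proof (rule curve_inner_increment[where T = "tangent K"])
      show "((\<lambda>z. sin (z - x)) has_real_derivative cos (z - x)) (at z)" for z
        by (auto intro!: derivative_eq_intros)
      show "tangent K z \<bullet> tangent K x \<ge> cos (z - x)" if "z \<in> {x..x + y}" for z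
        by (rule tangent_inner_ge_cos[OF K]) (use that \<open>y < pi\<close> in auto)
    qed (use that constrained_loopD(3)[OF K] in auto)
    moreover have "sin y > 0" using that by (rule sin_gt_zero)
    ultimately show ?thesis by simp
  qed
  obtain n \<tau> where n: "b - a = \<tau> + of_int n * s" "0 \<le> \<tau>" "\<tau> < s"
    using antiperiodic_reduce[OF constrained_loopD(1)[OF K]] by blast
  have b: "K b = K (a + \<tau>)" "tangent K b = tangent K (a + \<tau>)"
    using periodic_int[of K s "a + \<tau>" n, OF constrained_loopD(2)[OF K]]
      periodic_int[of "tangent K" s "a + \<tau>" n, OF tangent_periodic[OF K]] n(1) by (simp_all add: algebra_simps)
  have "\<tau> \<noteq> 0" using ne b by auto
  moreover have "\<not> (0 < \<tau> \<and> \<tau> < pi)"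
    using short[of \<tau> a] orth(1) b by (auto simp: inner_diff_left)
  moreover have "\<not> s - \<tau> < pi"
  proof
    assume "s - \<tau> < pi"
    then have "(K (a + \<tau> + (s - \<tau>)) - K (a + \<tau>)) \<bullet> tangent K (a + \<tau>) > 0" using n by (intro short) auto
    then show False using orth(2) b constrained_loopD(2)[OF K, of a] by simp
  qed
  ultimately have "a + pi \<le> a + \<tau>" "a + \<tau> \<le> a + pi + \<delta>" using n s by linarith+
  then have "norm (K (a + \<tau>) - K a) \<ge> 2 - \<delta>\<^sup>2 / 4" by (rule chord_ge_near_diameter[OF K _ _ s(3)])
  then show ?thesis using b by (simp add: norm_minus_commute)
qed

lemma axis_inner: "axis k (1::real) \<bullet> axis k' 1 = (if k = k' then 1 else 0)"
  by (simp add: inner_axis_axis)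

lemma dumbbell:
  assumes \<phi>: "0 < \<phi>" "\<phi> \<le> 1/2"
  shows "capped_loop (axis 1 1) (axis 2 1) (2 * \<phi>) (2 * sin \<phi>) 1 \<phi>
    (\<lambda>t. sin (t - \<phi>)) (\<lambda>t. 2 * cos \<phi> - cos (t - \<phi>)) (\<lambda>t. cos (t - \<phi>)) (\<lambda>t. sin (t - \<phi>))
    (\<lambda>t. - sin (t - \<phi>)) (\<lambda>t. cos (t - \<phi>)) (\<lambda>u. 2 * cos \<phi> - sqrt (1 - u\<^sup>2))"
proof
  have pi: "\<phi> < pi / 2" using \<phi> pi_ge_two by linarith
  then show "\<phi> < pi / 2" .
  have s0: "sin \<phi> \<ge> 0" using \<phi> pi by (intro sin_ge_zero) auto
  have "\<phi>\<^sup>2 \<le> (1/2)\<^sup>2" using \<phi> by (intro power_mono) auto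
  then have c: "cos \<phi> > 1/2" using cos_ge_quadratic[of \<phi>] by (simp add: power2_eq_square)
  show "0 \<le> 2 * sin \<phi> - 1 * sin \<phi>" using s0 by simp
  fix t assume t: "t \<in> {0..2 * \<phi>}"
  have "sin (t - \<phi>) \<le> sin \<phi>" "sin (- \<phi>) \<le> sin (t - \<phi>)"
    by (rule sin_monotone_2pi_le; use t pi \<phi> in simp)+
  then show "\<bar>sin (t - \<phi>)\<bar> \<le> 2 * sin \<phi> - 1 * sin \<phi>" by simp
  show "0 < 2 * cos \<phi> - cos (t - \<phi>)" using c cos_le_one[of "t - \<phi>"] by linarith
  have "cos (t - \<phi>) \<ge> 0" using t pi by (intro cos_ge_zero) auto
  then show "2 * cos \<phi> - cos (t - \<phi>) = 2 * cos \<phi> - sqrt (1 - (sin (t - \<phi>))\<^sup>2)"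
    by (simp add: cos_squared_eq[symmetric])
next
  have pi: "\<phi> < pi / 2" using \<phi> pi_ge_two by linarith
  show "inj_on (\<lambda>t. sin (t - \<phi>)) {0..2 * \<phi>}"
  proof (rule inj_onI)
    fix x y assume xy: "x \<in> {0..2 * \<phi>}" "y \<in> {0..2 * \<phi>}" and eq: "sin (x - \<phi>) = sin (y - \<phi>)"
    have "x - \<phi> = y - \<phi>" by (rule sin_inj_pi[OF _ _ _ _ eq]; use pi xy in simp)
    then show "x = y" by simp
  qed
qed (use \<phi> in \<open>auto intro!: derivative_eq_intros continuous_intros simp: axis_inner\<close>)

lemma stadium:
  assumes m: "0 < m" and d: "1 \<le> d"
  shows "capped_loop (axis 2 1) (axis 3 1) (2 * m) m d 0
    (\<lambda>t. t - m) (\<lambda>_. d) (\<lambda>_. 1) (\<lambda>_. 0) (\<lambda>_. 0) (\<lambda>_. 0) (\<lambda>_. d)"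
  by unfold_locales (use assms in \<open>auto intro!: derivative_eq_intros continuous_intros simp: axis_inner inj_on_def\<close>)

locale stadium_loop =
  fixes m d :: real
  assumes m: "0 < m" and d: "1 \<le> d"
begin

sublocale capped_loop "axis 2 1" "axis 3 1" "2 * m" m d 0
    "\<lambda>t. t - m" "\<lambda>_. d" "\<lambda>_. 1" "\<lambda>_. 0" "\<lambda>_. 0" "\<lambda>_. 0" "\<lambda>_. d"
  by (rule stadium[OF m d])

text \<open>
  Every point is the sum of a point \<open>\<eta>\<close> of the core segment and \<open>d\<close> times a unit normal \<open>(p, q)\<close>;
  unless the normal is vertical, \<open>\<eta>\<close> is the end of the segment to which it points.
\<close>

lemma core_and_normal:
  obtains \<eta> p q where "F t = (\<eta> + d * p) *\<^sub>R axis 2 1 + (d * q) *\<^sub>R axis 3 1"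
    "G t = q *\<^sub>R axis 2 1 + (- p) *\<^sub>R axis 3 1" "p\<^sup>2 + q\<^sup>2 = 1" "\<bar>\<eta>\<bar> \<le> m"
    "p = 0 \<or> (p > 0 \<and> \<eta> = m) \<or> (p < 0 \<and> \<eta> = - m)"
proof -
  obtain n \<tau> where t: "t = \<tau> + of_int n * h" "0 \<le> \<tau>" "\<tau> < h" using antiperiodic_reduce[OF h_pos] by blast
  define \<sigma> :: real where "\<sigma> = (if even n then 1 else -1)"
  have Ft: "F t = \<sigma> *\<^sub>R F \<tau>" "G t = \<sigma> *\<^sub>R G \<tau>" unfolding t(1) \<sigma>_def by (rule antiperiodic_ext_shift[OF h_pos])+
  have \<sigma>: "\<sigma> = 1 \<or> \<sigma> = -1" by (auto simp: \<sigma>_def)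
  show thesis
  proof (cases "\<tau> \<le> 2 * m")
    case True
    have "F \<tau> = f1 \<tau>" "G \<tau> = g1 \<tau>" using True t by (simp_all add: antiperiodic_ext_base)
    then have "F t = (\<sigma> * (\<tau> - m) + d * 0) *\<^sub>R axis 2 1 + (d * \<sigma>) *\<^sub>R axis 3 1"
      "G t = \<sigma> *\<^sub>R axis 2 1 + (- 0) *\<^sub>R axis 3 1"
      using Ft by (simp_all add: f1_def g1_def scaleR_add_right mult.commute)
    then show thesis using \<sigma> True t by (intro that[of "\<sigma> * (\<tau> - m)" 0 \<sigma>]) auto
  next
    case False
    have base: "F \<tau> = f2 \<tau>" "G \<tau> = g2 \<tau>" using False t by (simp_all add: antiperiodic_ext_base)
    have eq: "F t = (\<sigma> * m + d * (\<sigma> * sin (\<beta> \<tau>))) *\<^sub>R axis 2 1 + (d * (\<sigma> * cos (\<beta> \<tau>))) *\<^sub>R axis 3 1"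
      "G t = (\<sigma> * cos (\<beta> \<tau>)) *\<^sub>R axis 2 1 + (- (\<sigma> * sin (\<beta> \<tau>))) *\<^sub>R axis 3 1"
      unfolding Ft base f2_def g2_def by (simp_all add: scaleR_add_right algebra_simps)
    have "\<tau> \<in> {2 * m<..<h}" using False t by auto
    then have "\<beta> \<tau> \<in> {- 0<..<pi + 0}" using \<beta>_range[of \<tau>] by blast
    then have "sin (\<beta> \<tau>) > 0" by (intro sin_gt_zero) auto
    moreover have "(\<sigma> * sin (\<beta> \<tau>))\<^sup>2 + (\<sigma> * cos (\<beta> \<tau>))\<^sup>2 = 1" using \<sigma> by auto
    ultimately show thesis using \<sigma> m by (intro that[OF eq]) auto
  qed
qed

text \<open>
  The two normals at the ends of such a chord are equal or opposite.  Equal normals have the same supporting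
  line, so the chord would vanish; opposite normals belong to parallel supporting lines at distance at least \<open>2 d\<close>.
\<close>

lemma double_normal_chord:
  assumes ne: "F a \<noteq> F b" and orth: "(F a - F b) \<bullet> G a = 0" "(F a - F b) \<bullet> G b = 0"
  shows "norm (F a - F b) \<ge> 2 * d"
proof -
  obtain \<eta> p q where 1: "F a = (\<eta> + d * p) *\<^sub>R axis 2 1 + (d * q) *\<^sub>R axis 3 1"
    "G a = q *\<^sub>R axis 2 1 + (- p) *\<^sub>R axis 3 1" "p\<^sup>2 + q\<^sup>2 = 1" "\<bar>\<eta>\<bar> \<le> m"
    "p = 0 \<or> (p > 0 \<and> \<eta> = m) \<or> (p < 0 \<and> \<eta> = - m)" by (rule core_and_normal)
  obtain \<eta>' p' q' where 2: "F b = (\<eta>' + d * p') *\<^sub>R axis 2 1 + (d * q') *\<^sub>R axis 3 1"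
    "G b = q' *\<^sub>R axis 2 1 + (- p') *\<^sub>R axis 3 1" "p'\<^sup>2 + q'\<^sup>2 = 1" "\<bar>\<eta>'\<bar> \<le> m"
    "p' = 0 \<or> (p' > 0 \<and> \<eta>' = m) \<or> (p' < 0 \<and> \<eta>' = - m)" by (rule core_and_normal)
  define w1 where "w1 = (\<eta> + d * p) - (\<eta>' + d * p')"
  define w2 where "w2 = d * q - d * q'"
  have w: "F a - F b = w1 *\<^sub>R axis 2 1 + w2 *\<^sub>R axis 3 1"
    by (simp add: 1 2 w1_def w2_def scaleR_left_diff_distrib scaleR_left_distrib)
  have ip: "(u *\<^sub>R axis 2 1 + v *\<^sub>R axis 3 1) \<bullet> (u' *\<^sub>R axis 2 1 + v' *\<^sub>R axis 3 1 :: real^3) = u * u' + v * v'"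
    for u v u' v' :: real by (simp add: inner_add_left inner_add_right axis_inner)
  have o1: "w1 * q = w2 * p" and o2: "w1 * q' = w2 * p'" using orth unfolding w 1(2) 2(2) ip by simp_all
  define \<mu> where "\<mu> = w1 * p + w2 * q"
  have "w1 = w1 * (p\<^sup>2 + q\<^sup>2)" using 1(3) by simp
  also have "\<dots> = \<mu> * p" using o1 by (simp add: \<mu>_def power2_eq_square algebra_simps)
  finally have w1: "w1 = \<mu> * p" .
  have "w2 = w2 * (p\<^sup>2 + q\<^sup>2)" using 1(3) by simp
  also have "\<dots> = \<mu> * q" using o1 by (simp add: \<mu>_def power2_eq_square algebra_simps)
  finally have w2: "w2 = \<mu> * q" .
  have nz: "\<mu> \<noteq> 0" using ne w w1 w2 by auto
  have cross: "p * q' = q * p'" using o2 nz unfolding w1 w2 by simp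
  define \<epsilon> where "\<epsilon> = p * p' + q * q'"
  have "p' = (p\<^sup>2 + q\<^sup>2) * p'" using 1(3) by simp
  also have "\<dots> = \<epsilon> * p" using cross by (simp add: \<epsilon>_def power2_eq_square algebra_simps)
  finally have p': "p' = \<epsilon> * p" .
  have "q' = (p\<^sup>2 + q\<^sup>2) * q'" using 1(3) by simp
  also have "\<dots> = \<epsilon> * q" using cross by (simp add: \<epsilon>_def power2_eq_square algebra_simps)
  finally have q': "q' = \<epsilon> * q" .
  have "\<epsilon>\<^sup>2 * (p\<^sup>2 + q\<^sup>2) = 1" using 2(3) unfolding p' q' by (simp add: power_mult_distrib distrib_left)
  then have \<epsilon>: "\<epsilon> = 1 \<or> \<epsilon> = -1" using 1(3) by (simp add: power2_eq_1_iff)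
  have "\<mu> = (\<eta> - \<eta>') * p + d * ((1 - \<epsilon>) * (p\<^sup>2 + q\<^sup>2))"
    unfolding \<mu>_def w1_def w2_def p' q' by (simp add: power2_eq_square algebra_simps)
  then have \<mu>: "\<mu> = (\<eta> - \<eta>') * p + d * (1 - \<epsilon>)" using 1(3) by simp
  have "\<epsilon> \<noteq> 1"
  proof
    assume "\<epsilon> = 1"
    then have "(\<eta> - \<eta>') * p = 0" using 1(5) 2(5) p' by auto
    then show False using \<mu> \<open>\<epsilon> = 1\<close> nz by simp
  qed
  then have e: "\<epsilon> = -1" using \<epsilon> by blast
  have "(\<eta> - \<eta>') * p \<ge> 0" using 1(4,5) 2(4) by (auto intro: mult_nonneg_nonneg mult_nonpos_nonpos)
  then have "\<mu> \<ge> 2 * d" using \<mu> e by simp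
  moreover have "norm (F a - F b) = sqrt (\<mu>\<^sup>2 * (p\<^sup>2 + q\<^sup>2))"
    unfolding w norm_eq_sqrt_inner ip w1 w2 by (simp add: power2_eq_square algebra_simps)
  ultimately show ?thesis using 1(3) by simp
qed

text \<open>
  A point on the core segment has distance at least \<open>d\<close> from the stadium; for a point beyond the end of the
  segment the nearest point of the stadium is the tip \<open>m + d\<close>.
\<close>

lemma far_from_plane_point:
  assumes "\<bar>y\<bar> > m \<Longrightarrow> x\<^sup>2 + (m + d - \<bar>y\<bar>)\<^sup>2 \<ge> d\<^sup>2"
  shows "norm (F t - (x *\<^sub>R axis 1 1 + y *\<^sub>R axis 2 1)) \<ge> d"
proof -
  obtain \<eta> p q where 1: "F t = (\<eta> + d * p) *\<^sub>R axis 2 1 + (d * q) *\<^sub>R axis 3 1" "p\<^sup>2 + q\<^sup>2 = 1" "\<bar>\<eta>\<bar> \<le> m"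
    "p = 0 \<or> (p > 0 \<and> \<eta> = m) \<or> (p < 0 \<and> \<eta> = - m)" by (rule core_and_normal)
  have "(norm (F t - (x *\<^sub>R axis 1 1 + y *\<^sub>R axis 2 1)))\<^sup>2 = x\<^sup>2 + (\<eta> + d * p - y)\<^sup>2 + (d * q)\<^sup>2"
    unfolding 1(1) power2_norm_eq_inner
    by (simp add: inner_add_left inner_add_right inner_diff_left inner_diff_right axis_inner power2_eq_square algebra_simps)
  also have "\<dots> = x\<^sup>2 + (\<eta> - y)\<^sup>2 + 2 * d * (p * (\<eta> - y)) + d\<^sup>2 * (p\<^sup>2 + q\<^sup>2)"
    by (simp add: power2_eq_square algebra_simps)
  finally have n: "(norm (F t - (x *\<^sub>R axis 1 1 + y *\<^sub>R axis 2 1)))\<^sup>2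
      = x\<^sup>2 + (\<eta> - y)\<^sup>2 + 2 * d * (p * (\<eta> - y)) + d\<^sup>2" using 1(2) by simp
  have p1: "\<bar>p\<bar> \<le> 1" using 1(2) by (metis abs_square_le_1 le_add_same_cancel1 zero_le_power2)
  have "x\<^sup>2 + (\<eta> - y)\<^sup>2 + 2 * d * (p * (\<eta> - y)) + d\<^sup>2 \<ge> d\<^sup>2"
  proof (cases "p * (\<eta> - y) \<ge> 0")
    case True
    then have "0 \<le> 2 * d * (p * (\<eta> - y))" using d by simp
    then show ?thesis by simp
  next
    case False
    then consider "p > 0" "\<eta> = m" "y > m" | "p < 0" "\<eta> = - m" "y < - m"
      using 1(4) by (auto simp: mult_less_0_iff not_le)
    then have y: "\<bar>y\<bar> > m \<and> (\<eta> - y)\<^sup>2 = (\<bar>y\<bar> - m)\<^sup>2 \<and> p * (\<eta> - y) = - \<bar>p\<bar> * (\<bar>y\<bar> - m)"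
    proof cases
      case 1
      then have "\<bar>y\<bar> = y" "\<bar>p\<bar> = p" using m by auto
      then show ?thesis using 1 by (simp add: power2_eq_square algebra_simps)
    next
      case 2
      then have "\<bar>y\<bar> = - y" "\<bar>p\<bar> = - p" using m by auto
      then show ?thesis using 2 by (simp add: power2_eq_square algebra_simps)
    qed
    then have y: "\<bar>y\<bar> > m" "(\<eta> - y)\<^sup>2 = (\<bar>y\<bar> - m)\<^sup>2" "p * (\<eta> - y) = - \<bar>p\<bar> * (\<bar>y\<bar> - m)" by auto
    have "\<bar>p\<bar> * (\<bar>y\<bar> - m) \<le> 1 * (\<bar>y\<bar> - m)" using p1 y(1) by (intro mult_right_mono) auto
    then have "d * (\<bar>p\<bar> * (\<bar>y\<bar> - m)) \<le> d * (\<bar>y\<bar> - m)" using d by simp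
    moreover have "x\<^sup>2 + (m + d - \<bar>y\<bar>)\<^sup>2 = x\<^sup>2 + (\<bar>y\<bar> - m)\<^sup>2 - 2 * (d * (\<bar>y\<bar> - m)) + d\<^sup>2"
      by (simp add: power2_eq_square algebra_simps)
    ultimately show ?thesis using assms[OF y(1)] unfolding y(2,3) by simp
  qed
  then have "d\<^sup>2 \<le> (norm (F t - (x *\<^sub>R axis 1 1 + y *\<^sub>R axis 2 1)))\<^sup>2" using n by simp
  then show ?thesis by (rule power2_le_imp_le) simp
qed

end

text \<open>
  The point \<open>Y\<close> on the axis of the waist has distance \<open>1 + d\<close> from the centres of the unit circle caps, hence
  distance at least \<open>d\<close> from the caps.  Since \<open>Y\<close> is not below the centre of curvature of the waist, the points of the
  waist nearest to it are the ends, which also lie on the caps.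
\<close>

lemma dumbbell_far_from_axis_point:
  assumes \<phi>: "0 < \<phi>" "\<phi> \<le> 1/2" and d: "1 \<le> d" and Y: "Y > 0" "Y\<^sup>2 = (1 + d)\<^sup>2 - 4 * (sin \<phi>)\<^sup>2"
    and pt: "(\<bar>x\<bar> \<le> sin \<phi> \<and> \<bar>y\<bar> = 2 * cos \<phi> - sqrt (1 - x\<^sup>2)) \<or> (y\<^sup>2 + (\<bar>x\<bar> - 2 * sin \<phi>)\<^sup>2 = 1)"
  shows "x\<^sup>2 + (Y - \<bar>y\<bar>)\<^sup>2 \<ge> d\<^sup>2"
proof -
  have pi: "\<phi> < pi / 2" using \<phi> pi_ge_two by linarith
  have sc: "sin \<phi> \<ge> 0" "cos \<phi> > 0" using \<phi> pi by (auto intro!: sin_ge_zero cos_gt_zero)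
  have cap: "z\<^sup>2 + (Y - w)\<^sup>2 \<ge> d\<^sup>2" if zw: "w\<^sup>2 + (z - 2 * sin \<phi>)\<^sup>2 = 1" for z w
  proof -
    let ?P = "norm (z, Y - w)" and ?Q = "norm (z - 2 * sin \<phi>, - w)"
    have "norm (2 * sin \<phi>, Y) = sqrt ((1 + d)\<^sup>2)" unfolding norm_Pair using Y by (simp add: power_mult_distrib)
    then have "1 + d = norm ((z, Y - w) - (z - 2 * sin \<phi>, - w))" using d by simp
    also have "\<dots> \<le> ?P + ?Q" by (rule norm_triangle_ineq4)
    also have "?Q = 1" unfolding norm_Pair using zw by (simp add: add.commute)
    finally have "d \<le> ?P" by simp
    then have "d\<^sup>2 \<le> ?P\<^sup>2" using d by (intro power_mono) auto
    then show ?thesis by (simp add: norm_Pair)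
  qed
  from pt show ?thesis
  proof
    assume n: "\<bar>x\<bar> \<le> sin \<phi> \<and> \<bar>y\<bar> = 2 * cos \<phi> - sqrt (1 - x\<^sup>2)"
    define C where "C = sqrt (1 - x\<^sup>2)"
    have "\<bar>x\<bar>\<^sup>2 \<le> (sin \<phi>)\<^sup>2" using n by (intro power_mono) auto
    then have x2: "x\<^sup>2 \<le> (sin \<phi>)\<^sup>2" by simp
    then have "(cos \<phi>)\<^sup>2 \<le> 1 - x\<^sup>2" by (simp add: cos_squared_eq)
    moreover from this have "0 \<le> 1 - x\<^sup>2" using zero_le_power2 order_trans by blast
    ultimately have C: "cos \<phi> \<le> C" "C\<^sup>2 = 1 - x\<^sup>2"
      unfolding C_def by (auto intro: real_le_rsqrt)
    have "(2 * cos \<phi>)\<^sup>2 \<le> Y\<^sup>2"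
    proof -
      have "(1 + d)\<^sup>2 \<ge> 2\<^sup>2" using d by (intro power_mono) auto
      then show ?thesis unfolding Y(2) by (simp add: power_mult_distrib cos_squared_eq)
    qed
    then have Yc: "2 * cos \<phi> \<le> Y" by (rule power2_le_imp_le) (use Y(1) in simp)
    have "d\<^sup>2 \<le> (sin \<phi>)\<^sup>2 + (Y - cos \<phi>)\<^sup>2"
    proof (rule cap)
      have "sin \<phi> - 2 * sin \<phi> = - sin \<phi>" by simp
      then show "(cos \<phi>)\<^sup>2 + (sin \<phi> - 2 * sin \<phi>)\<^sup>2 = 1" by simp
    qed
    also have "\<dots> = 1 + Y * (Y - 2 * cos \<phi>)"
      unfolding sin_squared_eq by (simp add: power2_eq_square algebra_simps)
    also have "\<dots> \<le> 1 + (Y - 2 * cos \<phi>)\<^sup>2 + 2 * ((Y - 2 * cos \<phi>) * C)"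
    proof -
      have "(Y - 2 * cos \<phi>) * cos \<phi> \<le> (Y - 2 * cos \<phi>) * C" using C(1) Yc by (intro mult_left_mono) auto
      then show ?thesis by (simp add: power2_eq_square algebra_simps)
    qed
    also have "\<dots> = x\<^sup>2 + (Y - \<bar>y\<bar>)\<^sup>2"
    proof -
      have "Y - \<bar>y\<bar> = (Y - 2 * cos \<phi>) + C" "x\<^sup>2 = 1 - C\<^sup>2" using n C(2) by (simp_all add: C_def)
      then show ?thesis by (simp only:) (simp add: power2_eq_square algebra_simps)
    qed
    finally show ?thesis .
  next
    assume "y\<^sup>2 + (\<bar>x\<bar> - 2 * sin \<phi>)\<^sup>2 = 1"
    then have "\<bar>x\<bar>\<^sup>2 + (Y - \<bar>y\<bar>)\<^sup>2 \<ge> d\<^sup>2" by (intro cap) simp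
    then show ?thesis by simp
  qed
qed

lemma disjoint_nbhd:
  assumes "\<And>x y. x \<in> A \<Longrightarrow> y \<in> B \<Longrightarrow> norm (x - y) \<ge> d"
  shows "nbhd (d / 2) A \<inter> nbhd (d / 2) B = {}"
proof (rule ccontr)
  assume "nbhd (d / 2) A \<inter> nbhd (d / 2) B \<noteq> {}"
  then obtain x y z where "x \<in> A" "y \<in> B" "dist x z < d / 2" "dist y z < d / 2"
    unfolding nbhd_def by auto
  then have "dist x y < d" using dist_triangle2[of x y z] by linarith
  then show False using assms \<open>x \<in> A\<close> \<open>y \<in> B\<close> by (fastforce simp: dist_norm)
qed

theorem mainTheorem1:
  fixes d :: real
  assumes "d \<in> {1..<2}"
  shows "\<exists>n s L. gordian_unlink d n s L \<and> (\<forall>i<n. constrained_loop 1 (s i) (L i))"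
proof -
  have d: "1 \<le> d" "d < 2" using assms by auto
  \<comment> \<open>The length of \<open>K\<close> will be \<open>2 \<pi> + 8 \<phi>\<close>; the second bound makes its thickness at least \<open>d\<close>.\<close>
  define \<phi> where "\<phi> = min (1 / 1000000) ((2 - d) / 16)"
  have \<phi>: "0 < \<phi>" "\<phi> \<le> 1 / 1000000" "16 * \<phi> \<le> 2 - d" using d by (auto simp: \<phi>_def min_def)
  have \<phi>': "\<phi> \<le> 1 / 2" using \<phi> by simp
  have sin\<phi>: "0 < sin \<phi>" "sin \<phi> \<le> \<phi>" "cos \<phi> < 1" "cos \<phi> > 1 / 2"
  proof -
    show "0 < sin \<phi>" using \<phi> pi_gt3 by (intro sin_gt_zero) auto
    then have "cos \<phi> \<noteq> 1" using cos_one_sin_zero[of \<phi>] by auto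
    then show "cos \<phi> < 1" by (simp add: less_le)
    show "sin \<phi> \<le> \<phi>" using \<phi> by (intro sin_x_le_x) auto
    have "\<phi>\<^sup>2 \<le> (1 / 2)\<^sup>2" using \<phi> by (intro power_mono) auto
    then show "cos \<phi> > 1 / 2" using cos_ge_quadratic[of \<phi>] by (simp add: power2_eq_square)
  qed
  have sin2: "4 * (sin \<phi>)\<^sup>2 \<le> 1"
  proof -
    have "(sin \<phi>)\<^sup>2 \<le> (1 / 2)\<^sup>2" using sin\<phi> \<phi>' by (intro power_mono) auto
    then show ?thesis by (simp add: power2_eq_square)
  qed
  \<comment> \<open>The tip of the ring, as close to \<open>K\<close> as the tubes permit; \<open>Y < 1 + d\<close> makes the ring too short to slip off.\<close>
  define Y where "Y = sqrt ((1 + d)\<^sup>2 - 4 * (sin \<phi>)\<^sup>2)"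
  have d_less: "d\<^sup>2 < (1 + d)\<^sup>2 - 4 * (sin \<phi>)\<^sup>2" using sin2 d by (simp add: power2_eq_square algebra_simps)
  have Y2: "Y\<^sup>2 = (1 + d)\<^sup>2 - 4 * (sin \<phi>)\<^sup>2"
    unfolding Y_def using d_less zero_le_power2[of d] by (intro real_sqrt_pow2) linarith
  have Y: "d < Y" "Y < 1 + d"
  proof -
    show "d < Y" unfolding Y_def using d_less by (intro real_less_rsqrt)
    have "Y\<^sup>2 < (1 + d)\<^sup>2" using Y2 sin\<phi> by simp
    then show "Y < 1 + d" by (rule power2_less_imp_less) (use d in simp)
  qed
  define m where "m = Y - d"
  have m: "0 < m" "m < 1" using Y by (auto simp: m_def)
  interpret K: capped_loop "axis 1 1" "axis 2 1" "2 * \<phi>" "2 * sin \<phi>" 1 \<phi>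
    "\<lambda>t. sin (t - \<phi>)" "\<lambda>t. 2 * cos \<phi> - cos (t - \<phi>)" "\<lambda>t. cos (t - \<phi>)" "\<lambda>t. sin (t - \<phi>)"
    "\<lambda>t. - sin (t - \<phi>)" "\<lambda>t. cos (t - \<phi>)" "\<lambda>u. 2 * cos \<phi> - sqrt (1 - u\<^sup>2)"
    by (rule dumbbell[OF \<phi>(1) \<phi>'])
  interpret A: stadium_loop m d by unfold_locales (use m d in auto)
  define K where "K = K.F"
  define A where "A = A.F"
  have hK: "K.h = pi + 4 * \<phi>" by (simp add: K.h_def)
  have hA: "A.h = 2 * m + pi * d" by (simp add: A.h_def)
  have KX: "K.X = sin \<phi>" by (simp add: K.X_def)
  define s where "s i = (if i = 0 then 2 * K.h else 2 * A.h)" for i :: nat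
  define L where "L i = (if i = 0 then K else A)" for i :: nat
  have cK: "constrained_loop 1 (2 * K.h) K" unfolding K_def by (rule K.constrained)
  have cA: "constrained_loop 1 (2 * A.h) A" unfolding A_def by (rule A.constrained)
  have two: "{..<2::nat} = {0, 1}" by auto
  have far: "norm (A x - K y) \<ge> d" for x y
  proof -
    have key: "norm (A x - (u *\<^sub>R axis 1 1 + w *\<^sub>R axis 2 1)) \<ge> d"
      if "(\<bar>u\<bar> \<le> sin \<phi> \<and> \<bar>w\<bar> = 2 * cos \<phi> - sqrt (1 - u\<^sup>2)) \<or> (w\<^sup>2 + (\<bar>u\<bar> - 2 * sin \<phi>)\<^sup>2 = 1)" for u w
    proof -
      have "u\<^sup>2 + (m + d - \<bar>w\<bar>)\<^sup>2 \<ge> d\<^sup>2"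
        using dumbbell_far_from_axis_point[OF \<phi>(1) \<phi>' d(1) _ Y2 that] Y d by (simp add: m_def)
      then show ?thesis unfolding A_def by (intro A.far_from_plane_point)
    qed
    show ?thesis
    proof (cases rule: K.on_profile[of y])
      case (1 u w)
      then show ?thesis using key[of u w] by (simp add: K_def KX)
    next
      case (2 u w)
      then show ?thesis using key[of u w] by (simp add: K_def)
    qed
  qed
  have thinK: "thickness_radius K \<ge> ereal (d / 2)"
  proof (rule thickness_radius_ge[OF cK])
    fix a b assume ne: "K a \<noteq> K b" and orth: "(K a - K b) \<bullet> tangent K a = 0" "(K a - K b) \<bullet> tangent K b = 0"
    have "2 - (8 * \<phi>)\<^sup>2 / 4 \<le> norm (K a - K b)"
      by (rule near_circle_chord[OF cK _ _ _ ne orth]) (use \<phi> in \<open>auto simp: hK\<close>)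
    moreover have "\<phi> * \<phi> \<le> \<phi> * 1" using \<phi> by (intro mult_left_mono) auto
    ultimately show "d \<le> norm (K a - K b)" using \<phi>(3) by (simp add: power2_eq_square)
  qed (use d in simp)
  have thinA: "thickness_radius A \<ge> ereal (d / 2)"
  proof (rule thickness_radius_ge[OF cA])
    fix a b assume "A a \<noteq> A b" "(A a - A b) \<bullet> tangent A a = 0" "(A a - A b) \<bullet> tangent A b = 0"
    then have "2 * d \<le> norm (A a - A b)"
      unfolding A_def A.tangent_F by (rule A.double_normal_chord)
    then show "d \<le> norm (A a - A b)" using d by simp
  qed (use d in simp)
  have disj: "range K \<inter> range A = {}"
  proof (rule ccontr)
    assume "range K \<inter> range A \<noteq> {}"
    then obtain x y where "K x = A y" by auto
    then show False using far[of y x] d by simp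
  qed
  have nb: "nbhd (d / 2) (range A) \<inter> nbhd (d / 2) (range K) = {}"
    by (rule disjoint_nbhd) (use far in auto)
  have link: "thin_link d 2 s L"
    unfolding thin_link_def disjoint_family_on_def two
    using cK cA thinK thinA disj nb by (auto simp: s_def L_def less_2_cases_iff)
  obtain aK where aK: "continuous_on UNIV aK" "\<And>u. aK u > (0::real)"
    "range K = {u *\<^sub>R axis 1 1 + w *\<^sub>R axis 2 1 | u w. u\<^sup>2 + (aK u * w)\<^sup>2 = K.R\<^sup>2}"
    by (rule K.scaling_to_circle[folded K_def]) (rule that)
  obtain aA where aA: "continuous_on UNIV aA" "\<And>u. aA u > (0::real)"
    "range A = {u *\<^sub>R axis 2 1 + w *\<^sub>R axis 3 1 | u w. u\<^sup>2 + (aA u * w)\<^sup>2 = A.R\<^sup>2}"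
    by (rule A.scaling_to_circle[folded A_def]) (rule that)
  have low: "w\<^sup>2 \<le> 1" if "u\<^sup>2 + (aK u * w)\<^sup>2 = K.R\<^sup>2" for u w
  proof -
    have "u *\<^sub>R axis 1 1 + w *\<^sub>R axis 2 1 \<in> range K" unfolding aK(3) using that by blast
    then obtain t where t: "u *\<^sub>R axis 1 1 + w *\<^sub>R axis 2 1 = K t" by blast
    have "2 * cos \<phi> - sqrt (1 - v\<^sup>2) \<le> 1" if "\<bar>v\<bar> \<le> K.X" for v
    proof -
      have "\<bar>v\<bar>\<^sup>2 \<le> (sin \<phi>)\<^sup>2" using that unfolding KX by (intro power_mono) auto
      then have "cos \<phi> \<le> sqrt (1 - v\<^sup>2)" by (intro real_le_rsqrt) (simp add: cos_squared_eq)
      then show ?thesis using sin\<phi>(3) by linarith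
    qed
    then have "\<bar>K t \<bullet> axis 2 1\<bar> \<le> 1" unfolding K_def by (rule K.abs_height_le)
    then have "\<bar>w\<bar> \<le> 1" unfolding t[symmetric] K.coordinates .
    then show ?thesis by (simp add: abs_square_le_1)
  qed
  have vec: "u *\<^sub>R axis 1 1 + w *\<^sub>R axis 2 1 = (vector [u, w, 0] :: real^3)"
    "u *\<^sub>R axis 2 1 + w *\<^sub>R axis 3 1 = (vector [0, u, w] :: real^3)" for u w :: real
    by (simp_all add: vec_eq_iff forall_3 axis_def)
  have RK: "K.R > 0" by (rule K.R_pos)
  have RA: "A.R > 1" using m d by (simp add: A.R_def)
  obtain F where F: "isotopic_to_id F" "F ` range K = flat_circle (vector [0, 0, 0])"
    "F ` range A = flat_circle (vector [3, 0, 0])"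
    by (rule unlink_perpendicular[OF aK(1,2) aA(1,2) RK RA], erule low, rule that, assumption,
        unfold aK(3) vec, assumption, unfold aA(3) vec, assumption)
  have unknots: "unknot (range K)" "unknot (range A)" using unknot_shifted_circle F by blast+
  have "F ` (\<Union>i<2. range (L i)) = trivial_link 2"
    unfolding trivial_link_def two using F(2,3) by (simp add: L_def image_Un)
  then have unlinked: "ambient_isotopic (\<Union>i<2. range (L i)) (trivial_link 2)"
    using ambient_isotopic_image[OF F(1)] by metis
  have "\<not> disentangled_by_thin_isotopy d 2 s L"
  proof -
    define y0 where "y0 = 2 * cos \<phi> - 1"
    have y0: "0 < y0" "y0 \<le> m"
    proof -
      show "0 < y0" using sin\<phi> by (simp add: y0_def)
      have "(y0 + d)\<^sup>2 \<le> Y\<^sup>2"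
      proof -
        have "Y\<^sup>2 - (y0 + d)\<^sup>2 = 4 * (d - 1) * (1 - cos \<phi>)"
          unfolding Y2 y0_def sin_squared_eq by (simp add: power2_eq_square algebra_simps)
        moreover have "4 * (d - 1) * (1 - cos \<phi>) \<ge> 0" using d sin\<phi> by (intro mult_nonneg_nonneg) auto
        ultimately show ?thesis by simp
      qed
      then have "y0 + d \<le> Y" by (rule power2_le_imp_le) (use Y d in simp)
      then show "y0 \<le> m" by (simp add: m_def)
    qed
    have Kp: "K \<phi> = y0 *\<^sub>R axis 2 1"
    proof -
      have "K \<phi> = K.f1 \<phi>" unfolding K_def using \<phi> K.l_less_h by (subst antiperiodic_ext_base) auto
      then show ?thesis by (simp add: K.f1_def y0_def)
    qed
    have Kq: "K (\<phi> + K.h) = - (y0 *\<^sub>R axis 2 1)"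
      using Kp antiperiodic_ext_half[OF K.h_pos] unfolding K_def by metis
    have A0: "A y = (y - m) *\<^sub>R axis 2 1 + d *\<^sub>R axis 3 1" if "0 \<le> y" "y \<le> 2 * m" for y
    proof -
      have "A y = A.f1 y" unfolding A_def using that A.l_less_h by (subst antiperiodic_ext_base) auto
      then show ?thesis by (simp add: A.f1_def)
    qed
    have A1: "A (A.h + y) = - ((y - m) *\<^sub>R axis 2 1 + d *\<^sub>R axis 3 1)" if "0 \<le> y" "y \<le> 2 * m" for y
      using A0[OF that] antiperiodic_ext_half[OF A.h_pos, of "2 * m" A.f1 A.f2 y] unfolding A_def by (simp add: add.commute)
    have A2: "A (2 * A.h + y) = (y - m) *\<^sub>R axis 2 1 + d *\<^sub>R axis 3 1" if "0 \<le> y" "y \<le> 2 * m" for y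
      using A0[OF that] constrained_loopD(2)[OF cA, of y] by (simp add: add.commute)
    have "clasped (s 0) (s 1) (L 0) (L 1) (\<phi>, \<phi> + K.h, A.h + (m - y0), A.h + (m + y0), 2 * A.h + (m - y0), 2 * A.h + (m + y0))"
    proof -
      let ?e2 = "axis 2 1 :: real^3" and ?e3 = "axis 3 1 :: real^3"
      have A: "A (A.h + (m - y0)) = y0 *\<^sub>R ?e2 - d *\<^sub>R ?e3" "A (A.h + (m + y0)) = - (y0 *\<^sub>R ?e2) - d *\<^sub>R ?e3"
        "A (2 * A.h + (m - y0)) = - (y0 *\<^sub>R ?e2) + d *\<^sub>R ?e3" "A (2 * A.h + (m + y0)) = y0 *\<^sub>R ?e2 + d *\<^sub>R ?e3"
        by (subst A1 A2, use y0 in simp, use y0 in simp, simp)+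
      have diff: "A (A.h + (m - y0)) - K \<phi> = - (d *\<^sub>R ?e3)" "A (A.h + (m + y0)) - K (\<phi> + K.h) = - (d *\<^sub>R ?e3)"
        "A (2 * A.h + (m - y0)) - K (\<phi> + K.h) = d *\<^sub>R ?e3" "A (2 * A.h + (m + y0)) - K \<phi> = d *\<^sub>R ?e3"
        "K (\<phi> + K.h) - K \<phi> = - (2 * y0) *\<^sub>R ?e2"
        unfolding A Kp Kq by (simp_all add: scaleR_2 scaleR_left.diff[symmetric] flip: scaleR_scaleR)
      have map: "clasp_map K A (\<phi>, \<phi> + K.h, A.h + (m - y0), A.h + (m + y0), 2 * A.h + (m - y0), 2 * A.h + (m + y0)) = 0"
        unfolding clasp_map_def prod.case diff by (simp add: axis_inner zero_prod_def cross_mult_left cross_mult_right)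
      have opp: "- (d *\<^sub>R ?e3) \<bullet> (d *\<^sub>R ?e3) \<le> 0" by (simp add: axis_inner)
      have "0 \<le> pi * d" using d by simp
      then show ?thesis
        unfolding clasped_def prod.case s_def L_def
        using y0 \<phi> m map opp diff by (simp add: hK hA)
    qed
    then show ?thesis
      by (rule clasped_not_disentangled[OF d, rotated -1]) (use \<phi> m in \<open>auto simp: s_def hK hA\<close>)
  qed
  then have "gordian_unlink d 2 s L"
    unfolding gordian_unlink_def using link unknots unlinked by (auto simp: L_def less_2_cases_iff)
  moreover have "\<forall>i<2. constrained_loop 1 (s i) (L i)" using cK cA by (auto simp: s_def L_def)
  ultimately show ?thesis by blast
qed

end
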